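(* Fix $h$, let $\Phi:\mathcal Z\to\mathcal A_{\mathrm{ad}}$ with $\mathcal Z\subset\mathbb R^m$ satisfy $\Phi\in C^1(\mathcal Z;L^\infty(\Omega))$, let $g_N^1,\dots,g_N^L\in H^{-1/2}_\diamond(\partial\Omega)$, and let $U\subset\mathcal Z$ be a convex neighborhood of an interior point $z^\dagger$ of $\mathcal Z$ such that, for some constant $c_L^{\mathrm d}>0$, $$\|z_1-z_2\|\le c_L^{\mathrm d}\|N_{L,h}^\Phi(z_1)-N_{L,h}^\Phi(z_2)\|_{Y_L}\qquad\forall z_1,z_2\in U.$$ Let $N_{L,h,M}^\Phi\in C^1(U;Y_{L,h})$ (the surrogate map) satisfy $$\sup_{z\in U}\|D(N_{L,h}^\Phi-N_{L,h,M}^\Phi)(z)\|_{\mathcal L(\mathbb R^m,Y_L)}\le\frac1{2c_L^{\mathrm d}}.$$ Then $$\|z_1-z_2\|\le2c_L^{\mathrm d}\|N_{L,h,M}^\Phi(z_1)-N_{L,h,M}^\Phi(z_2)\|_{Y_L}\qquad\forall z_1,z_2\in U.$$ In particular, $N_{L,h,M}^\Phi$ is injective on $U$.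
   Context: $\Omega\subset\mathbb R^d$, $d\in\{2,3\}$, is a bounded connected Lipschitz domain, $\gamma$ is the trace operator, $a_{\min},a_{\max}$ are fixed positive constants, and $\mathcal A_{\mathrm{ad}}=\{a\in L^\infty(\Omega):a_{\min}\le a\le a_{\max}\text{ a.e.}\}$. $H^{-1/2}_\diamond(\partial\Omega)=\{g\in H^{-1/2}(\partial\Omega):\langle g,1\rangle_{\partial\Omega}=0\}$. $V_h\subset H^1(\Omega)$ is a standard conforming finite element space (in particular finite-dimensional), $V_h^0=\{v_h\in V_h:(\gamma v_h,1)_{\partial\Omega}=0\}$; for $a\in\mathcal A_{\mathrm{ad}}$ and $g_N\in H^{-1/2}_\diamond(\partial\Omega)$, $u_h(a;g_N)\in V_h^0$ is the unique solution of $(a\nabla u_h,\nabla v_h)_\Omega=\langle g_N,\gamma v_h\rangle_{\partial\Omega}$ for all $v_h\in V_h^0$, and $\mathcal N_{a,h}g_N=\gamma u_h(a;g_N)$. $N_{L,h}^\Phi(z)=(\mathcal N_{\Phi(z),h}g_N^\ell)_{\ell=1}^L$, which is a $C^1$ map of $z$. $Y_L=(H^{1/2}(\partial\Omega))^L$ with norm $\|y\|_{Y_L}^2=\sum_\ell\|y^\ell\|_{H^{1/2}(\partial\Omega)}^2$, and $Y_{L,h}=(\gamma(V_h))^L\subset Y_L$ with the inherited norm. $C^1$ on a set means that the map admits a $C^1$ extension to an open neighborhood of the set. *)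

theory Defs
  imports "HOL-Analysis.Analysis" "HOL-Probability.Essential_Supremum"
    "HOL-Library.Function_Algebras"
begin

text \<open>Elements of the function spaces are represented by functions; two functions represent the
  same element when they agree almost everywhere (on the domain or on its boundary).  Sums and
  scalar multiples of representatives are pointwise.\<close>

instantiation "fun" :: (type, real_vector) real_vector
begin

definition scaleR_fun :: "real \<Rightarrow> ('a \<Rightarrow> 'b) \<Rightarrow> 'a \<Rightarrow> 'b" where
  "scaleR_fun c f = (\<lambda>x. c *\<^sub>R f x)"

instance
  by standard (auto simp: scaleR_fun_def fun_eq_iff scaleR_add_right scaleR_add_left)

end

lemma scaleR_fun_apply [simp]: "(c *\<^sub>R f) x = c *\<^sub>R f x"
  by (simp add: scaleR_fun_def)


section \<open>Calculus in spaces of functions with a seminorm\<close>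

text \<open>\<open>X\<close> is a space of representatives and \<open>N\<close> its seminorm, which vanishes exactly on the
  representatives of zero.\<close>

definition has_seminorm_derivative ::
  "'b::real_vector set \<Rightarrow> ('b \<Rightarrow> real) \<Rightarrow> ('z::euclidean_space \<Rightarrow> 'b) \<Rightarrow> ('z \<Rightarrow> 'b) \<Rightarrow> 'z \<Rightarrow> 'z set \<Rightarrow> bool"
where
  "has_seminorm_derivative X N f D z S \<longleftrightarrow>
     linear D \<and> range D \<subseteq> X \<and> (\<exists>C. \<forall>h. N (D h) \<le> C * norm h) \<and>
     (\<forall>e>0. \<exists>d>0. \<forall>w\<in>S. norm (w - z) < d \<longrightarrow> N (f w - f z - D (w - z)) \<le> e * norm (w - z))"

text \<open>On a convex set with nonempty interior the derivative relative to the set is determined up to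
  representatives of zero, and it is the derivative of every differentiable extension.\<close>

definition seminorm_derivative ::
  "'b::real_vector set \<Rightarrow> ('b \<Rightarrow> real) \<Rightarrow> 'z set \<Rightarrow> ('z::euclidean_space \<Rightarrow> 'b) \<Rightarrow> 'z \<Rightarrow> 'z \<Rightarrow> 'b" where
  "seminorm_derivative X N S f z = (SOME D. has_seminorm_derivative X N f D z S)"

definition seminorm_onorm :: "('b \<Rightarrow> real) \<Rightarrow> ('z::real_normed_vector \<Rightarrow> 'b) \<Rightarrow> ennreal" where
  "seminorm_onorm N D = (SUP h\<in>cball 0 1. ennreal (N (D h)))"

definition C1_on_seminorm ::
  "'b::real_vector set \<Rightarrow> ('b \<Rightarrow> real) \<Rightarrow> 'z set \<Rightarrow> ('z::euclidean_space \<Rightarrow> 'b) \<Rightarrow> bool" where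
  "C1_on_seminorm X N S f \<longleftrightarrow>
     (\<exists>W F D. open W \<and> S \<subseteq> W \<and> F ` W \<subseteq> X \<and> (\<forall>z\<in>S. F z = f z) \<and>
        (\<forall>z\<in>W. has_seminorm_derivative X N F (D z) z W) \<and>
        (\<forall>z\<in>W. \<forall>e>0. \<exists>d>0. \<forall>w\<in>W. norm (w - z) < d \<longrightarrow>
           seminorm_onorm N (\<lambda>h. D w h - D z h) \<le> ennreal e))"


section \<open>Lipschitz domains and surface measure\<close>

definition lipschitz_domain :: "'a::euclidean_space set \<Rightarrow> bool" where
  "lipschitz_domain \<Omega> \<longleftrightarrow>
     open \<Omega> \<and> \<Omega> \<noteq> {} \<and> bounded \<Omega> \<and> connected \<Omega> \<and>
     (\<forall>p\<in>frontier \<Omega>. \<exists>e r \<psi> C. norm e = 1 \<and> r > 0 \<and> C-lipschitz_on UNIV \<psi> \<and>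
        \<Omega> \<inter> ball p r = {x \<in> ball p r. x \<bullet> e < \<psi> (x - (x \<bullet> e) *\<^sub>R e)})"

text \<open>The Hausdorff measure of codimension one, normalised so that it is the usual surface area.\<close>

definition hausdorff_pre :: "real \<Rightarrow> 'a::euclidean_space set \<Rightarrow> ennreal" where
  "hausdorff_pre \<delta> A =
     (INF C \<in> {C :: nat \<Rightarrow> 'a set. A \<subseteq> (\<Union>i. C i) \<and> (\<forall>i. bounded (C i) \<and> diameter (C i) \<le> \<delta>)}.
        \<Sum>i. ennreal (unit_ball_vol (real (DIM('a) - 1)) * (diameter (C i) / 2) ^ (DIM('a) - 1)))"

definition hausdorff_measure :: "'a::euclidean_space measure" where
  "hausdorff_measure = measure_of UNIV (sets borel) (\<lambda>A. SUP \<delta>\<in>{0<..}. hausdorff_pre \<delta> A)"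

definition surface_measure :: "'a::euclidean_space set \<Rightarrow> 'a measure" where
  "surface_measure \<Omega> = restrict_space hausdorff_measure (frontier \<Omega>)"


section \<open>Function spaces\<close>

definition L2_space :: "'a measure \<Rightarrow> ('a \<Rightarrow> 'b::euclidean_space) set" where
  "L2_space M = {f \<in> borel_measurable M. integrable M (\<lambda>x. (norm (f x))\<^sup>2)}"

definition L2_norm :: "'a measure \<Rightarrow> ('a \<Rightarrow> 'b::euclidean_space) \<Rightarrow> real" where
  "L2_norm M f = sqrt (\<integral>x. (norm (f x))\<^sup>2 \<partial>M)"

definition Linf_norm :: "'a measure \<Rightarrow> ('a \<Rightarrow> real) \<Rightarrow> real" where
  "Linf_norm M f = enn2real (esssup M (\<lambda>x. ennreal \<bar>f x\<bar>))"

definition Linf_space :: "'a measure \<Rightarrow> ('a \<Rightarrow> real) set" where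
  "Linf_space M = {f \<in> borel_measurable M. esssup M (\<lambda>x. ennreal \<bar>f x\<bar>) < \<infinity>}"

primrec Ck_fun :: "nat \<Rightarrow> ('a::euclidean_space \<Rightarrow> real) \<Rightarrow> bool" where
  "Ck_fun 0 f \<longleftrightarrow> continuous_on UNIV f"
| "Ck_fun (Suc k) f \<longleftrightarrow>
     (\<exists>G. (\<forall>x. (f has_derivative (\<lambda>h. G x \<bullet> h)) (at x)) \<and> (\<forall>i\<in>Basis. Ck_fun k (\<lambda>x. G x \<bullet> i)))"

definition test_functions :: "'a::euclidean_space set \<Rightarrow> ('a \<Rightarrow> real) set" where
  "test_functions \<Omega> =
     {\<phi>. (\<forall>k. Ck_fun k \<phi>) \<and> (\<exists>K. compact K \<and> K \<subseteq> \<Omega> \<and> (\<forall>x. x \<notin> K \<longrightarrow> \<phi> x = 0))}"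

definition is_weak_gradient ::
  "'a::euclidean_space set \<Rightarrow> ('a \<Rightarrow> real) \<Rightarrow> ('a \<Rightarrow> 'a) \<Rightarrow> bool" where
  "is_weak_gradient \<Omega> v G \<longleftrightarrow>
     (\<forall>\<phi>\<in>test_functions \<Omega>. \<forall>i\<in>Basis.
        (\<integral>x. v x * frechet_derivative \<phi> (at x) i \<partial>lebesgue_on \<Omega>) =
        - (\<integral>x. (G x \<bullet> i) * \<phi> x \<partial>lebesgue_on \<Omega>))"

definition H1_space :: "'a::euclidean_space set \<Rightarrow> ('a \<Rightarrow> real) set" where
  "H1_space \<Omega> = {v \<in> L2_space (lebesgue_on \<Omega>). \<exists>G\<in>L2_space (lebesgue_on \<Omega>). is_weak_gradient \<Omega> v G}"

definition weak_gradient :: "'a::euclidean_space set \<Rightarrow> ('a \<Rightarrow> real) \<Rightarrow> 'a \<Rightarrow> 'a" where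
  "weak_gradient \<Omega> v = (SOME G. G \<in> L2_space (lebesgue_on \<Omega>) \<and> is_weak_gradient \<Omega> v G)"

definition H1_norm :: "'a::euclidean_space set \<Rightarrow> ('a \<Rightarrow> real) \<Rightarrow> real" where
  "H1_norm \<Omega> v = sqrt ((L2_norm (lebesgue_on \<Omega>) v)\<^sup>2 + (L2_norm (lebesgue_on \<Omega>) (weak_gradient \<Omega> v))\<^sup>2)"

text \<open>The trace operator: the bounded linear operator from \<open>H\<^sup>1(\<Omega>)\<close> to \<open>L\<^sup>2(\<partial>\<Omega>)\<close> that restricts to
  the boundary the functions continuous up to it.  By density these conditions determine it (up to
  almost everywhere equality) on a Lipschitz domain.\<close>

definition is_trace_operator ::
  "'a::euclidean_space set \<Rightarrow> (('a \<Rightarrow> real) \<Rightarrow> 'a \<Rightarrow> real) \<Rightarrow> bool" where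
  "is_trace_operator \<Omega> \<gamma> \<longleftrightarrow>
     (\<forall>v\<in>H1_space \<Omega>. \<gamma> v \<in> L2_space (surface_measure \<Omega>)) \<and>
     (\<forall>u\<in>H1_space \<Omega>. \<forall>v\<in>H1_space \<Omega>. \<forall>c. AE x in surface_measure \<Omega>. \<gamma> (u + c *\<^sub>R v) x = \<gamma> u x + c * \<gamma> v x) \<and>
     (\<exists>C. \<forall>v\<in>H1_space \<Omega>. L2_norm (surface_measure \<Omega>) (\<gamma> v) \<le> C * H1_norm \<Omega> v) \<and>
     (\<forall>v\<in>H1_space \<Omega>. continuous_on (closure \<Omega>) v \<longrightarrow> (AE x in surface_measure \<Omega>. \<gamma> v x = v x))"

text \<open>The traces of the functions in a set \<open>W\<close>; for \<open>W = H\<^sup>1(\<Omega>)\<close> this is \<open>H\<^sup>1\<^sup>/\<^sup>2(\<partial>\<Omega>)\<close>, which carries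
  the quotient norm.\<close>

definition trace_space ::
  "'a::euclidean_space set \<Rightarrow> (('a \<Rightarrow> real) \<Rightarrow> 'a \<Rightarrow> real) \<Rightarrow> ('a \<Rightarrow> real) set \<Rightarrow> ('a \<Rightarrow> real) set" where
  "trace_space \<Omega> \<gamma> W =
     {w \<in> borel_measurable (surface_measure \<Omega>). \<exists>v\<in>W. AE x in surface_measure \<Omega>. \<gamma> v x = w x}"

definition Hhalf_space ::
  "'a::euclidean_space set \<Rightarrow> (('a \<Rightarrow> real) \<Rightarrow> 'a \<Rightarrow> real) \<Rightarrow> ('a \<Rightarrow> real) set" where
  "Hhalf_space \<Omega> \<gamma> = trace_space \<Omega> \<gamma> (H1_space \<Omega>)"

definition Hhalf_norm ::
  "'a::euclidean_space set \<Rightarrow> (('a \<Rightarrow> real) \<Rightarrow> 'a \<Rightarrow> real) \<Rightarrow> ('a \<Rightarrow> real) \<Rightarrow> real" where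
  "Hhalf_norm \<Omega> \<gamma> w = Inf {H1_norm \<Omega> v |v. v \<in> H1_space \<Omega> \<and> (AE x in surface_measure \<Omega>. \<gamma> v x = w x)}"

text \<open>The functionals in \<open>H\<^sup>-\<^sup>1\<^sup>/\<^sup>2(\<partial>\<Omega>)\<close>, the dual of \<open>H\<^sup>1\<^sup>/\<^sup>2(\<partial>\<Omega>)\<close>, that annihilate the constants.\<close>

definition Hminushalf_mean0 ::
  "'a::euclidean_space set \<Rightarrow> (('a \<Rightarrow> real) \<Rightarrow> 'a \<Rightarrow> real) \<Rightarrow> (('a \<Rightarrow> real) \<Rightarrow> real) set" where
  "Hminushalf_mean0 \<Omega> \<gamma> =
     {g. (\<forall>w1\<in>Hhalf_space \<Omega> \<gamma>. \<forall>w2\<in>Hhalf_space \<Omega> \<gamma>. \<forall>c. g (w1 + c *\<^sub>R w2) = g w1 + c * g w2) \<and>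
         (\<exists>C. \<forall>w\<in>Hhalf_space \<Omega> \<gamma>. \<bar>g w\<bar> \<le> C * Hhalf_norm \<Omega> \<gamma> w) \<and>
         g (\<lambda>_. 1) = 0}"


section \<open>The discrete Neumann-to-Dirichlet map\<close>

definition admissible :: "'a::euclidean_space set \<Rightarrow> real \<Rightarrow> real \<Rightarrow> ('a \<Rightarrow> real) set" where
  "admissible \<Omega> amin amax =
     {a \<in> Linf_space (lebesgue_on \<Omega>). AE x in lebesgue_on \<Omega>. amin \<le> a x \<and> a x \<le> amax}"

definition mean0_subspace ::
  "'a::euclidean_space set \<Rightarrow> (('a \<Rightarrow> real) \<Rightarrow> 'a \<Rightarrow> real) \<Rightarrow> ('a \<Rightarrow> real) set \<Rightarrow> ('a \<Rightarrow> real) set" where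
  "mean0_subspace \<Omega> \<gamma> V = {v \<in> V. (\<integral>x. \<gamma> v x * 1 \<partial>surface_measure \<Omega>) = 0}"

definition is_discrete_solution ::
  "'a::euclidean_space set \<Rightarrow> (('a \<Rightarrow> real) \<Rightarrow> 'a \<Rightarrow> real) \<Rightarrow> ('a \<Rightarrow> real) set \<Rightarrow>
   ('a \<Rightarrow> real) \<Rightarrow> (('a \<Rightarrow> real) \<Rightarrow> real) \<Rightarrow> ('a \<Rightarrow> real) \<Rightarrow> bool" where
  "is_discrete_solution \<Omega> \<gamma> V a g u \<longleftrightarrow>
     u \<in> mean0_subspace \<Omega> \<gamma> V \<and>
     (\<forall>v\<in>mean0_subspace \<Omega> \<gamma> V.
        (\<integral>x. (a x *\<^sub>R weak_gradient \<Omega> u x) \<bullet> weak_gradient \<Omega> v x \<partial>lebesgue_on \<Omega>) = g (\<gamma> v))"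

text \<open>The solution is unique only up to equality almost everywhere, so a representative is chosen.\<close>

definition discrete_solution ::
  "'a::euclidean_space set \<Rightarrow> (('a \<Rightarrow> real) \<Rightarrow> 'a \<Rightarrow> real) \<Rightarrow> ('a \<Rightarrow> real) set \<Rightarrow>
   ('a \<Rightarrow> real) \<Rightarrow> (('a \<Rightarrow> real) \<Rightarrow> real) \<Rightarrow> 'a \<Rightarrow> real" where
  "discrete_solution \<Omega> \<gamma> V a g = (SOME u. is_discrete_solution \<Omega> \<gamma> V a g u)"

definition discrete_NtD ::
  "'a::euclidean_space set \<Rightarrow> (('a \<Rightarrow> real) \<Rightarrow> 'a \<Rightarrow> real) \<Rightarrow> ('a \<Rightarrow> real) set \<Rightarrow>
   ('a \<Rightarrow> real) \<Rightarrow> (('a \<Rightarrow> real) \<Rightarrow> real) \<Rightarrow> 'a \<Rightarrow> real" where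
  "discrete_NtD \<Omega> \<gamma> V a g = \<gamma> (discrete_solution \<Omega> \<gamma> V a g)"

text \<open>\<open>L\<close>-tuples are functions of the index \<open>l\<close>, of which only the values at \<open>1, \<dots>, L\<close> matter.\<close>

definition measurement_map ::
  "'a::euclidean_space set \<Rightarrow> (('a \<Rightarrow> real) \<Rightarrow> 'a \<Rightarrow> real) \<Rightarrow> ('a \<Rightarrow> real) set \<Rightarrow>
   (nat \<Rightarrow> ('a \<Rightarrow> real) \<Rightarrow> real) \<Rightarrow> ('z \<Rightarrow> 'a \<Rightarrow> real) \<Rightarrow> 'z \<Rightarrow> nat \<Rightarrow> 'a \<Rightarrow> real" where
  "measurement_map \<Omega> \<gamma> V gN \<Phi> z = (\<lambda>l. discrete_NtD \<Omega> \<gamma> V (\<Phi> z) (gN l))"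

definition Y_space ::
  "'a::euclidean_space set \<Rightarrow> (('a \<Rightarrow> real) \<Rightarrow> 'a \<Rightarrow> real) \<Rightarrow> nat \<Rightarrow> (nat \<Rightarrow> 'a \<Rightarrow> real) set" where
  "Y_space \<Omega> \<gamma> L = {y. \<forall>l\<in>{1..L}. y l \<in> Hhalf_space \<Omega> \<gamma>}"

definition Yh_space ::
  "'a::euclidean_space set \<Rightarrow> (('a \<Rightarrow> real) \<Rightarrow> 'a \<Rightarrow> real) \<Rightarrow> ('a \<Rightarrow> real) set \<Rightarrow> nat \<Rightarrow>
   (nat \<Rightarrow> 'a \<Rightarrow> real) set" where
  "Yh_space \<Omega> \<gamma> V L = {y. \<forall>l\<in>{1..L}. y l \<in> trace_space \<Omega> \<gamma> V}"

definition Y_norm ::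
  "'a::euclidean_space set \<Rightarrow> (('a \<Rightarrow> real) \<Rightarrow> 'a \<Rightarrow> real) \<Rightarrow> nat \<Rightarrow> (nat \<Rightarrow> 'a \<Rightarrow> real) \<Rightarrow> real" where
  "Y_norm \<Omega> \<gamma> L y = sqrt (\<Sum>l=1..L. (Hhalf_norm \<Omega> \<gamma> (y l))\<^sup>2)"

definition Y_eq ::
  "'a::euclidean_space set \<Rightarrow> nat \<Rightarrow> (nat \<Rightarrow> 'a \<Rightarrow> real) \<Rightarrow> (nat \<Rightarrow> 'a \<Rightarrow> real) \<Rightarrow> bool" where
  "Y_eq \<Omega> L y1 y2 \<longleftrightarrow> (\<forall>l\<in>{1..L}. AE x in surface_measure \<Omega>. y1 l x = y2 l x)"

end

theory Submission
  imports Defs "HOL-Computational_Algebra.Polynomial"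
begin

text \<open>The error \<open>N - N\<^sub>M\<close> has derivative of norm at most \<open>1 / (2c)\<close>, so by the mean value inequality it is
  \<open>1 / (2c)\<close>-Lipschitz on the convex set \<open>U\<close>; the triangle inequality then absorbs half of the
  distance \<open>\<parallel>z1 - z2\<parallel>\<close> into the stability estimate for \<open>N\<close>.

  The derivative of the error is a choice operator, so \<open>N\<close> must be shown to be differentiable.
  The Galerkin problems are solved by the Riesz theorem for a semi-inner product on a finite
  dimensional space, and their solutions depend differentiably on the coefficient by subtracting the
  variational equations.  This requires that an \<open>H\<^sup>1\<close> function with zero gradient and zero boundary
  mean has zero trace: integration against a function \<open>v\<close> with zero weak gradient is invariant under small
  translations of the test function, hence \<open>v\<close> is locally constant by Fubini's theorem, and
  constant since \<open>\<Omega>\<close> is connected.\<close>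

section \<open>Smooth bump functions\<close>

text \<open>The Galerkin equation sees a function only through its gradient, while the data and the
  norm of the target see it only through its trace. Solvability (the right-hand side must vanish on
  the null vectors of the form) and the passage from gradient estimates to \<open>Hhalf_norm\<close>
  both hinge on the implication from zero gradient and zero boundary mean to zero trace; in finite
  dimension it already yields a Poincare type inequality, with a constant depending on
  \<open>V\<close>. Elements are representatives, so norms are seminorms, and
  \<open>\<gamma>\<close> and \<open>weak_gradient\<close> are linear only almost everywhere; hence
  the linear algebra for semi-inner products on a subspace. Derivatives are taken relative to
  \<open>U\<close>, at its boundary points too. The perturbation argument allows this, because it
  compares only coefficients \<open>\<Phi> w\<close> with \<open>w\<close> in the set, and the mean
  value inequality accepts whichever relative derivative the choice operator selects.\<close>

lemma poly_over_exp_tendsto_0: "((\<lambda>x::real. poly p x * exp (- x)) \<longlongrightarrow> 0) at_top"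
proof -
  have "((\<lambda>x::real. \<Sum>i\<le>degree p. coeff p i * (x ^ i / exp x)) \<longlongrightarrow> (\<Sum>i\<le>degree p. coeff p i * 0)) at_top"
    by (intro tendsto_sum tendsto_mult tendsto_const tendsto_power_div_exp_0)
  moreover have "poly p x * exp (- x) = (\<Sum>i\<le>degree p. coeff p i * (x ^ i / exp x))" for x :: real
    by (simp add: poly_altdef exp_minus sum_distrib_right divide_inverse mult.assoc)
  ultimately show ?thesis by simp
qed

text \<open>The polynomial factor in \<open>1 / t\<close> makes the family of flat functions closed
  under differentiation; the bump functions use the case \<open>p = 1\<close>.\<close>

definition exp_flat :: "real poly \<Rightarrow> real \<Rightarrow> real" where
  "exp_flat p t = (if t > 0 then poly p (1 / t) * exp (- (1 / t)) else 0)"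

text \<open>This is the difference quotient at 0. With \<open>x = 1 / t\<close> on the right,
  dividing by \<open>t\<close> multiplies by \<open>x\<close>, hence the polynomial
  \<open>pCons 0 p\<close>; on the left the function is 0.\<close>

lemma exp_flat_quotient_tendsto_0: "((\<lambda>t. exp_flat p t / t) \<longlongrightarrow> 0) (at 0)"
proof (rule filterlim_split_at)
  have "((\<lambda>x. poly (pCons 0 p) x * exp (- x)) \<longlongrightarrow> 0) at_top"
    by (rule poly_over_exp_tendsto_0)
  then have "((\<lambda>x. exp_flat p (inverse x) / inverse x) \<longlongrightarrow> 0) at_top"
    by (rule Lim_transform_eventually)
       (use eventually_gt_at_top[of 0] in eventually_elim, simp add: exp_flat_def field_simps)
  then show "((\<lambda>t. exp_flat p t / t) \<longlongrightarrow> 0) (at_right 0)"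
    by (simp add: filterlim_at_right_to_top)
  have "\<forall>\<^sub>F t in at_left 0. exp_flat p t / t = 0"
    by (auto simp: eventually_at_filter exp_flat_def)
  then show "((\<lambda>t. exp_flat p t / t) \<longlongrightarrow> 0) (at_left 0)"
    by (simp add: tendsto_eventually)
qed

text \<open>For \<open>x = 1 / t\<close>, whose derivative is \<open>- x^2\<close>, the chain rule
  turns \<open>p x * exp (- x)\<close> into \<open>x^2 * (p x - p' x) * exp (- x)\<close>. The point
  0 is covered by the limit of the difference quotient.\<close>

lemma exp_flat_deriv:
  "(exp_flat p has_real_derivative exp_flat (monom 1 2 * (p - pderiv p)) t) (at t)"
proof -
  consider "t > 0" | "t < 0" | "t = 0" by linarith
  then show ?thesis
  proof cases
    case 1
    have "((\<lambda>t. poly p (1 / t) * exp (- (1 / t))) has_real_derivative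
        exp_flat (monom 1 2 * (p - pderiv p)) t) (at t)"
      using 1
      by (auto intro!: derivative_eq_intros DERIV_chain2[OF poly_DERIV]
          simp: exp_flat_def poly_monom field_simps power2_eq_square)
    then show ?thesis
      by (rule has_field_derivative_transform_within_open[of _ _ _ "{0<..}"])
         (use 1 in \<open>auto simp: exp_flat_def\<close>)
  next
    case 2
    have "((\<lambda>t. 0) has_real_derivative exp_flat (monom 1 2 * (p - pderiv p)) t) (at t)"
      using 2 by (simp add: exp_flat_def)
    then show ?thesis
      by (rule has_field_derivative_transform_within_open[of _ _ _ "{..<0}"])
         (use 2 in \<open>auto simp: exp_flat_def\<close>)
  next
    case 3
    then show ?thesis
      using exp_flat_quotient_tendsto_0[of p]
      by (simp add: has_field_derivative_iff) (simp add: exp_flat_def)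
  qed
qed

section \<open>Closure properties of k times continuously differentiable functions\<close>

lemma Ck_fun_Suc_D: "Ck_fun (Suc k) f \<Longrightarrow> Ck_fun k f"
proof (induction k arbitrary: f)
  case 0
  then show ?case
    by (auto intro!: continuous_at_imp_continuous_on intro: has_derivative_continuous)
next
  case (Suc k)
  then obtain G where "\<forall>x. (f has_derivative (\<lambda>h. G x \<bullet> h)) (at x)"
    "\<forall>i\<in>Basis. Ck_fun (Suc k) (\<lambda>x. G x \<bullet> i)"
    by auto
  with Suc.IH show ?case by (auto simp del: Ck_fun.simps(2) simp: Ck_fun.simps(2)[of k f])
qed

lemma Ck_fun_const [simp]: "Ck_fun k (\<lambda>x::'a::euclidean_space. c)"
proof (induction k arbitrary: c)
  case (Suc k)
  then show ?case by (auto intro!: exI[of _ "\<lambda>_. 0"])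
qed simp

lemma Ck_fun_add: "Ck_fun k f \<Longrightarrow> Ck_fun k g \<Longrightarrow> Ck_fun k (\<lambda>x. f x + g x)"
proof (induction k arbitrary: f g)
  case (Suc k)
  then obtain F G where
    *: "\<And>x. (f has_derivative (\<lambda>h. F x \<bullet> h)) (at x)" "\<And>x. (g has_derivative (\<lambda>h. G x \<bullet> h)) (at x)"
    "\<forall>i\<in>Basis. Ck_fun k (\<lambda>x. F x \<bullet> i)" "\<forall>i\<in>Basis. Ck_fun k (\<lambda>x. G x \<bullet> i)"
    by auto
  show ?case unfolding Ck_fun.simps
    by (rule exI[of _ "\<lambda>x. F x + G x"])
       (use * Suc.IH in \<open>auto intro!: derivative_eq_intros simp: inner_add_left\<close>)
qed (simp add: continuous_on_add)

lemma Ck_fun_mult: "Ck_fun k f \<Longrightarrow> Ck_fun k g \<Longrightarrow> Ck_fun k (\<lambda>x. f x * g x)"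
proof (induction k arbitrary: f g)
  case (Suc k)
  then obtain F G where
    *: "\<And>x. (f has_derivative (\<lambda>h. F x \<bullet> h)) (at x)" "\<And>x. (g has_derivative (\<lambda>h. G x \<bullet> h)) (at x)"
    "\<forall>i\<in>Basis. Ck_fun k (\<lambda>x. F x \<bullet> i)" "\<forall>i\<in>Basis. Ck_fun k (\<lambda>x. G x \<bullet> i)"
    by auto
  \<comment> \<open>The product rule leaves \<open>f\<close> and \<open>g\<close> themselves
    undifferentiated, so they are needed at order \<open>k\<close> as well.\<close>
  have lower: "Ck_fun k f" "Ck_fun k g"
    using Suc.prems by (blast intro: Ck_fun_Suc_D)+
  show ?case unfolding Ck_fun.simps
    by (rule exI[of _ "\<lambda>x. f x *\<^sub>R G x + g x *\<^sub>R F x"])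
       (use * lower Suc.IH in \<open>auto intro!: derivative_eq_intros Ck_fun_add
          simp: inner_add_left algebra_simps\<close>)
qed (simp add: continuous_on_mult)

lemma Ck_fun_prod: "finite I \<Longrightarrow> (\<And>i. i \<in> I \<Longrightarrow> Ck_fun k (f i)) \<Longrightarrow> Ck_fun k (\<lambda>x. \<Prod>i\<in>I. f i x)"
  by (induction I rule: finite_induct) (auto intro: Ck_fun_mult)

lemma Ck_fun_translate: "Ck_fun k f \<Longrightarrow> Ck_fun k (\<lambda>x. f (x - h))"
proof (induction k arbitrary: f)
  case 0
  then show ?case
    by (auto intro!: continuous_on_compose2[of UNIV f] continuous_intros)
next
  case (Suc k)
  then obtain F where
    *: "\<And>x. (f has_derivative (\<lambda>h. F x \<bullet> h)) (at x)" "\<forall>i\<in>Basis. Ck_fun k (\<lambda>x. F x \<bullet> i)"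
    by auto
  have "((\<lambda>x. f (x - h)) has_derivative (\<lambda>k. F (x - h) \<bullet> k)) (at x)" for x
    by (rule has_derivative_compose[of "\<lambda>x. x - h" "\<lambda>k. k", OF _ *(1)])
       (auto intro!: derivative_eq_intros)
  with * Suc.IH show ?case unfolding Ck_fun.simps
    by (intro exI[of _ "\<lambda>x. F (x - h)"]) auto
qed

text \<open>The induction runs over all \<open>p\<close> at once: by \<open>exp_flat_deriv\<close>
  and the chain rule the gradient is \<open>e\<close> times a function of the same family.\<close>

lemma Ck_fun_exp_flat: "Ck_fun k (\<lambda>x. exp_flat p (\<alpha> * (x \<bullet> e) + \<beta>))"
proof (induction k arbitrary: p)
  case 0
  have "continuous_on UNIV (exp_flat p)"
    using exp_flat_deriv DERIV_isCont continuous_at_imp_continuous_on by blast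
  then show ?case
    by (auto intro!: continuous_on_compose2[of UNIV "exp_flat p"] continuous_intros)
next
  case (Suc k)
  let ?q = "monom 1 2 * (p - pderiv p)"
  have "((\<lambda>x. exp_flat p (\<alpha> * (x \<bullet> e) + \<beta>)) has_derivative
     (\<lambda>h. ((\<alpha> * exp_flat ?q (\<alpha> * (x \<bullet> e) + \<beta>)) *\<^sub>R e) \<bullet> h)) (at x)" for x
  proof -
    have "((\<lambda>x. \<alpha> * (x \<bullet> e) + \<beta>) has_derivative (\<lambda>h. \<alpha> * (h \<bullet> e))) (at x)"
      by (auto intro!: derivative_eq_intros)
    from DERIV_compose_FDERIV[OF exp_flat_deriv this] show ?thesis
      by (simp add: inner_commute mult_ac)
  qed
  note deriv = this
  show ?case unfolding Ck_fun.simps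
  proof (intro exI conjI allI ballI)
    show "Ck_fun k (\<lambda>x. (\<alpha> * exp_flat ?q (\<alpha> * (x \<bullet> e) + \<beta>)) *\<^sub>R e \<bullet> i)" for i
      by (auto intro!: Ck_fun_mult Suc)
  qed (rule deriv)
qed

text \<open>Two flat cutoffs per coordinate make the product positive exactly inside
  \<open>box a b\<close>. The slope \<open>Suc n\<close> sharpens them, so that they tend to 1
  there; it is never 0.\<close>

definition bump :: "nat \<Rightarrow> 'a::euclidean_space \<Rightarrow> 'a \<Rightarrow> 'a \<Rightarrow> real" where
  "bump n a b x = (\<Prod>i\<in>Basis. exp_flat 1 (real (Suc n) * (x \<bullet> i - a \<bullet> i)) *
                              exp_flat 1 (real (Suc n) * (b \<bullet> i - x \<bullet> i)))"

lemma exp_flat_1_bounds: "0 \<le> exp_flat 1 t" "exp_flat 1 t \<le> 1"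
  by (auto simp: exp_flat_def)

lemma exp_flat_1_eq_0: "t \<le> 0 \<Longrightarrow> exp_flat 1 t = 0"
  by (auto simp: exp_flat_def)

lemma bump_bounds: "0 \<le> bump n a b x" "bump n a b x \<le> 1"
  unfolding bump_def by (auto intro!: prod_nonneg prod_le_1 mult_le_one simp: exp_flat_1_bounds)

lemma bump_eq_0: "x \<notin> box a b \<Longrightarrow> bump n a b x = 0"
  unfolding bump_def mem_box
  by (auto simp: prod_zero_iff not_less intro!: bexI exp_flat_1_eq_0 mult_nonneg_nonpos)

lemma Ck_fun_bump: "Ck_fun k (bump n a b)"
proof -
  have "Ck_fun k (\<lambda>x. exp_flat 1 (real (Suc n) * (x \<bullet> i - a \<bullet> i)) * exp_flat 1 (real (Suc n) * (b \<bullet> i - x \<bullet> i)))" for i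
    using Ck_fun_mult[OF Ck_fun_exp_flat[of k 1 "real (Suc n)" i "- real (Suc n) * (a \<bullet> i)"]
        Ck_fun_exp_flat[of k 1 "- real (Suc n)" i "real (Suc n) * (b \<bullet> i)"]]
    by (simp add: algebra_simps)
  then show ?thesis
    unfolding bump_def[abs_def] by (intro Ck_fun_prod) auto
qed

lemma bump_test_function:
  assumes "cbox a b \<subseteq> \<Omega>"
  shows "bump n a b \<in> test_functions \<Omega>"
proof -
  have "\<forall>x. x \<notin> cbox a b \<longrightarrow> bump n a b x = 0"
    using box_subset_cbox bump_eq_0 by blast
  then show ?thesis
    using assms by (auto simp: test_functions_def Ck_fun_bump intro: exI[of _ "cbox a b"])
qed

lemma bump_tendsto_indicator: "(\<lambda>n. bump n a b x) \<longlonglongrightarrow> indicator (box a b) x"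
proof (cases "x \<in> box a b")
  case True
  have *: "(\<lambda>n. exp_flat 1 (real (Suc n) * t)) \<longlonglongrightarrow> 1" if "t > 0" for t :: real
  proof -
    have "(\<lambda>n. exp (- (inverse (real (Suc n)) * (1 / t)))) \<longlonglongrightarrow> exp (- (0 * (1 / t)))"
      by (intro tendsto_intros LIMSEQ_inverse_real_of_nat)
    then show ?thesis
      using that by (simp add: exp_flat_def divide_inverse zero_less_mult_iff del: of_nat_Suc)
  qed
  have "(\<lambda>n. bump n a b x) \<longlonglongrightarrow> (\<Prod>i\<in>(Basis::'a set). 1 * 1)"
    unfolding bump_def using True by (intro tendsto_prod tendsto_mult *) (auto simp: mem_box)
  then show ?thesis using True by simp
qed (simp add: bump_eq_0)

lemma Ck_fun_measurable [measurable_dest]: "Ck_fun k f \<Longrightarrow> f \<in> borel_measurable borel"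
proof (induction k)
  case 0
  then show ?case by (simp add: borel_measurable_continuous_onI)
next
  case (Suc k)
  then show ?case by (blast intro: Ck_fun_Suc_D)
qed

section \<open>Test functions and their gradients\<close>

lemma test_function_Ck: "\<phi> \<in> test_functions \<Omega> \<Longrightarrow> Ck_fun k \<phi>"
  by (auto simp: test_functions_def)

lemma test_function_continuous: "\<phi> \<in> test_functions \<Omega> \<Longrightarrow> continuous_on S \<phi>"
  using test_function_Ck[of \<phi> \<Omega> 0] by (auto intro: continuous_on_subset)

lemma test_function_eq_0: "\<phi> \<in> test_functions \<Omega> \<Longrightarrow> x \<notin> \<Omega> \<Longrightarrow> \<phi> x = 0"
  by (auto simp: test_functions_def)

lemma continuous_compact_support_bounded:
  fixes f :: "'a::euclidean_space \<Rightarrow> 'b::real_normed_vector"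
  assumes "continuous_on UNIV f" "compact K" "\<And>x. x \<notin> K \<Longrightarrow> f x = 0"
  obtains B where "B > 0" "\<And>x. norm (f x) \<le> B"
proof -
  have "bounded (f ` K)"
    using assms by (intro compact_imp_bounded compact_continuous_image continuous_on_subset[OF assms(1)]) auto
  then obtain B where "B > 0" "\<And>x. x \<in> K \<Longrightarrow> norm (f x) \<le> B"
    by (auto simp: bounded_pos)
  then show ?thesis
    using that[of B] assms(3) by (metis norm_zero order_less_imp_le)
qed

lemma test_function_bounded:
  assumes "\<phi> \<in> test_functions \<Omega>"
  obtains B where "B > 0" "\<And>x. \<bar>\<phi> x\<bar> \<le> B"
proof -
  from assms obtain K where "compact K" "\<And>x. x \<notin> K \<Longrightarrow> \<phi> x = 0"
    by (auto simp: test_functions_def)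
  with continuous_compact_support_bounded[OF test_function_continuous[OF assms]] that
  show ?thesis by (metis real_norm_def)
qed

lemma test_function_gradient:
  assumes "\<phi> \<in> test_functions \<Omega>"
  obtains G K where "\<And>x. (\<phi> has_derivative (\<lambda>h. G x \<bullet> h)) (at x)" "continuous_on UNIV G"
    "compact K" "K \<subseteq> \<Omega>" "\<And>x. x \<notin> K \<Longrightarrow> \<phi> x = 0" "\<And>x. x \<notin> K \<Longrightarrow> G x = 0"
proof -
  from test_function_Ck[OF assms, of "Suc 0"] obtain G where
    G: "\<And>x. (\<phi> has_derivative (\<lambda>h. G x \<bullet> h)) (at x)" "\<forall>i\<in>Basis. continuous_on UNIV (\<lambda>x. G x \<bullet> i)"
    by auto
  from assms obtain K where K: "compact K" "K \<subseteq> \<Omega>" "\<And>x. x \<notin> K \<Longrightarrow> \<phi> x = 0"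
    by (auto simp: test_functions_def)
  have "continuous_on UNIV G"
    using G(2) by (subst continuous_on_componentwise) auto
  \<comment> \<open>Off \<open>K\<close> the function \<open>\<phi>\<close> vanishes on an open set,
    so its derivative is that of the zero function.\<close>
  moreover have "G x = 0" if "x \<notin> K" for x
  proof -
    have "((\<lambda>_. 0) has_derivative (\<lambda>h. G x \<bullet> h)) (at x)"
      by (rule has_derivative_transform_within_open[OF G(1), of "- K"])
         (use K that in \<open>auto simp: compact_imp_closed open_Compl\<close>)
    then have "(\<lambda>h. G x \<bullet> h) = (\<lambda>h. 0)"
      using has_derivative_unique has_derivative_const by blast
    then show ?thesis by (metis inner_eq_zero_iff)
  qed
  ultimately show ?thesis using that[of G K] G(1) K by blast
qed

lemma test_function_translate:
  assumes "\<phi> \<in> test_functions S" "(\<lambda>x. x + h) ` S \<subseteq> \<Omega>"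
  shows "(\<lambda>x. \<phi> (x - h)) \<in> test_functions \<Omega>"
proof -
  from assms(1) obtain K where K: "compact K" "K \<subseteq> S" "\<And>x. x \<notin> K \<Longrightarrow> \<phi> x = 0"
    by (auto simp: test_functions_def)
  have "compact ((\<lambda>x. x + h) ` K)"
    using K(1) by (intro compact_continuous_image continuous_intros) auto
  moreover have "\<phi> (x - h) = 0" if "x \<notin> (\<lambda>x. x + h) ` K" for x
    using that K(3)[of "x - h"] by (metis diff_add_cancel image_eqI)
  moreover have "(\<lambda>x. x + h) ` K \<subseteq> \<Omega>" using K(2) assms(2) by blast
  ultimately show ?thesis
    using Ck_fun_translate[OF test_function_Ck[OF assms(1)], of _ h]
    unfolding test_functions_def by blast
qed

section \<open>Functions with vanishing weak gradient\<close>

text \<open>By Lindelof countably many of the neighbourhoods cover \<open>S\<close>, so only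
  countably many exceptional null sets are united.\<close>

lemma AE_local:
  fixes S :: "'a::euclidean_space set"
  assumes "\<And>x. x \<in> S \<Longrightarrow> \<exists>T. open T \<and> x \<in> T \<and> (AE y in M. y \<in> T \<longrightarrow> P y)"
  shows "AE y in M. y \<in> S \<longrightarrow> P y"
proof -
  let ?F = "{T. open T \<and> (AE y in M. y \<in> T \<longrightarrow> P y)}"
  obtain F where F: "F \<subseteq> ?F" "countable F" "\<Union>F = \<Union>?F"
    using Lindelof[of ?F] by blast
  have "AE y in M. \<forall>T\<in>F. y \<in> T \<longrightarrow> P y"
    using F(1,2) by (intro AE_ball_countable[THEN iffD2]) auto
  moreover have "S \<subseteq> \<Union>F"
    using assms F(3) by blast
  ultimately show ?thesis by (auto elim!: eventually_mono)
qed

text \<open>Boxes form an intersection-stable generator of the Borel sets, and the sets over which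
  \<open>f\<close> integrates to 0 are closed under complements and disjoint countable unions. So
  all Borel sets have this property, and the density \<open>f\<close> is 0.\<close>

lemma AE_eq_0_if_box_integrals_eq_0:
  fixes f :: "'a::euclidean_space \<Rightarrow> real"
  assumes f: "integrable lborel f"
    and box: "\<And>a b. (\<integral>x. indicator (box a b) x * f x \<partial>lborel) = 0"
  shows "AE x in lborel. f x = 0"
proof (rule sigma_finite_measure.density_zero[OF sigma_finite_lborel f])
  have [measurable]: "f \<in> borel_measurable borel" using f by auto
  have int: "integrable lborel (\<lambda>x. indicator A x * f x)" if "A \<in> sets borel" for A
    using integrable_mult_indicator[of A lborel f] f that by simp
  let ?G = "range (\<lambda>(a, b). box a b :: 'a set)"
  \<comment> \<open>The whole space is not a box, but complements need its integral. It is exhausted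
    by growing boxes, with dominating function \<open>\<bar>f x\<bar>\<close>.\<close>
  have total: "(\<integral>x. f x \<partial>lborel) = 0"
  proof -
    have "(\<lambda>n. \<integral>x. indicator (box (- (real n *\<^sub>R One)) (real n *\<^sub>R One)) x * f x \<partial>lborel)
        \<longlonglongrightarrow> (\<integral>x. f x \<partial>lborel)"
    proof (rule integral_dominated_convergence[where w = "\<lambda>x. \<bar>f x\<bar>"])
      show "AE x in lborel. (\<lambda>n. indicator (box (- (real n *\<^sub>R One)) (real n *\<^sub>R One)) x * f x) \<longlonglongrightarrow> f x"
      proof (rule AE_I2)
        fix x :: 'a
        obtain N :: nat where N: "norm x < real N" using reals_Archimedean2 by blast
        have "x \<in> box (- (real n *\<^sub>R One)) (real n *\<^sub>R One)" if "n \<ge> N" for n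
        proof -
          have "\<bar>x \<bullet> i\<bar> < real n" if "i \<in> Basis" for i
            using Basis_le_norm[OF that, of x] N \<open>n \<ge> N\<close> by linarith
          then show ?thesis by (force simp: mem_box abs_less_iff)
        qed
        then have "\<forall>\<^sub>F n in sequentially. indicator (box (- (real n *\<^sub>R One)) (real n *\<^sub>R One)) x * f x = f x"
          by (auto simp: eventually_sequentially intro!: exI[of _ N])
        then show "(\<lambda>n. indicator (box (- (real n *\<^sub>R One)) (real n *\<^sub>R One)) x * f x) \<longlonglongrightarrow> f x"
          by (rule tendsto_eventually)
      qed
    qed (use f in \<open>auto simp: indicator_def\<close>)
    then show ?thesis by (simp add: box LIMSEQ_const_iff)
  qed
  fix A :: "'a set" assume "A \<in> sets lborel"
  then have gen: "A \<in> sigma_sets UNIV ?G"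
    by (simp add: borel_eq_box)
  have stable: "Int_stable ?G"
    by (auto simp: Int_stable_def box_Int_box)
  show "set_lebesgue_integral lborel A f = 0"
    using stable subset_Pow_Union[of ?G, THEN order_trans, OF Pow_mono[OF subset_UNIV]] gen
  proof (induction rule: sigma_sets_induct_disjoint)
    case (compl A)
    then have A: "A \<in> sets borel" by (simp add: borel_eq_box)
    have "set_lebesgue_integral lborel (UNIV - A) f = (\<integral>x. f x - indicator A x * f x \<partial>lborel)"
      unfolding set_lebesgue_integral_def by (rule Bochner_Integration.integral_cong) (auto simp: indicator_def)
    also have "\<dots> = 0"
      using compl f int[OF A] total by (simp add: set_lebesgue_integral_def)
    finally show ?case .
  next
    case (union A)
    then have A: "range A \<subseteq> sets borel" by (simp add: borel_eq_box)
    then have "set_integrable lborel (\<Union>i. A i) f"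
      using int[of "\<Union>i. A i"] by (auto simp: set_integrable_def)
    then have "set_lebesgue_integral lborel (\<Union>i. A i) f = (\<Sum>i. set_lebesgue_integral lborel (A i) f)"
      using union A by (intro lebesgue_integral_countable_add) (auto simp: disjoint_family_on_def)
    then show ?case using union by simp
  qed (auto simp: set_lebesgue_integral_def box)
qed

text \<open>Bump functions converge boundedly to indicators, so \<open>f\<close> integrates to 0
  over every box whose closed version lies in \<open>\<Omega>\<close>; the box criterion is then
  applied near each point.\<close>

lemma fundamental_lemma_variations:
  fixes f :: "'a::euclidean_space \<Rightarrow> real"
  assumes f: "integrable lborel f" and "open \<Omega>"
    and test: "\<And>\<phi>. \<phi> \<in> test_functions \<Omega> \<Longrightarrow> (\<integral>x. f x * \<phi> x \<partial>lborel) = 0"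
  shows "AE x in lborel. x \<in> \<Omega> \<longrightarrow> f x = 0"
proof (rule AE_local)
  have [measurable]: "f \<in> borel_measurable borel" using f by auto
  have box: "(\<integral>x. indicator (box a b) x * f x \<partial>lborel) = 0" if "cbox a b \<subseteq> \<Omega>" for a b
  proof -
    have [measurable]: "bump n a b \<in> borel_measurable borel" for n
      using Ck_fun_bump by (rule Ck_fun_measurable)
    have "(\<lambda>n. \<integral>x. f x * bump n a b x \<partial>lborel) \<longlonglongrightarrow> (\<integral>x. f x * indicator (box a b) x \<partial>lborel)"
    proof (rule integral_dominated_convergence[where w = "\<lambda>x. \<bar>f x\<bar>"])
      fix n show "AE x in lborel. norm (f x * bump n a b x) \<le> \<bar>f x\<bar>"
        using bump_bounds[of n a b] by (auto simp: abs_mult intro!: mult_left_le)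
    qed (use f in \<open>auto intro!: tendsto_mult bump_tendsto_indicator\<close>)
    moreover have "(\<integral>x. f x * bump n a b x \<partial>lborel) = 0" for n
      using test bump_test_function[OF that] by blast
    ultimately show ?thesis by (simp add: LIMSEQ_const_iff mult.commute)
  qed
  fix x assume "x \<in> \<Omega>"
  then obtain a b where ab: "x \<in> box a b" "cbox a b \<subseteq> \<Omega>"
    using \<open>open \<Omega>\<close> by (meson open_contains_cbox)
  \<comment> \<open>Cutting \<open>f\<close> off outside one box gives a function on the whole
    space. Every box meets this box in a box, so the criterion reduces to boxes inside
    \<open>\<Omega>\<close>.\<close>
  let ?g = "\<lambda>y. indicator (box a b) y * f y"
  have "AE y in lborel. ?g y = 0"
  proof (rule AE_eq_0_if_box_integrals_eq_0)
    show "integrable lborel ?g"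
      using integrable_mult_indicator[of "box a b" lborel f] f by simp
    fix c d
    obtain a' b' where eq: "box c d \<inter> box a b = box a' b'"
      using box_Int_box by blast
    show "(\<integral>x. indicator (box c d) x * ?g x \<partial>lborel) = 0"
    \<comment> \<open>When \<open>box a' b'\<close> is empty, \<open>cbox a' b'\<close> may be
      degenerate but nonempty and lie outside \<open>cbox a b\<close>; the inclusion of closures
      holds in the nonempty case.\<close>
    proof (cases "box a' b' = {}")
      case True
      then have "indicator (box c d) x * ?g x = 0" for x
        using eq by (auto simp: indicator_def)
      then show ?thesis by (simp only: integral_zero)
    next
      case False
      have "box a' b' \<subseteq> cbox a b"
        using eq box_subset_cbox by blast
      then have "cbox a' b' \<subseteq> cbox a b"
        using closure_box[OF False] closure_minimal closed_cbox by metis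
      then have "(\<integral>x. indicator (box a' b') x * f x \<partial>lborel) = 0"
        using ab by (intro box) auto
      moreover have "indicator (box c d) x * ?g x = indicator (box a' b') x * f x" for x
        unfolding eq[symmetric] by (auto simp: indicator_def)
      ultimately show ?thesis by (simp only:)
    qed
  qed
  then have "AE y in lborel. y \<in> box a b \<longrightarrow> f y = 0"
    by eventually_elim (auto simp: indicator_def)
  then show "\<exists>T. open T \<and> x \<in> T \<and> (AE y in lborel. y \<in> T \<longrightarrow> f y = 0)"
    using ab(1) open_box by blast
qed

section \<open>Invariance under translations and local constancy\<close>

lemma uniformly_continuous_compact_support:
  fixes f :: "'a::euclidean_space \<Rightarrow> 'b::real_normed_vector"
  assumes f: "continuous_on UNIV f" and K: "compact K" "\<And>x. x \<notin> K \<Longrightarrow> f x = 0"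
  shows "uniformly_continuous_on UNIV f"
proof -
  \<comment> \<open>The closed neighbourhood of \<open>K\<close> of radius 1: two points closer than
    1 either both lie in \<open>?K\<close> or both lie outside \<open>K\<close>, where
    \<open>f\<close> is 0.\<close>
  let ?K = "{x + y |x y. x \<in> K \<and> y \<in> cball 0 1}"
  have "compact ?K" using K(1) by (intro compact_sums) auto
  then have uc: "uniformly_continuous_on ?K f"
    using f by (intro compact_uniformly_continuous continuous_on_subset[OF f]) auto
  have near: "y \<in> ?K" if "x \<in> K" "dist x y < 1" for x y
    using that by (intro CollectI exI[of _ x] exI[of _ "y - x"]) (auto simp: dist_norm norm_minus_commute)
  have "\<exists>d>0. \<forall>x y. dist x y < d \<longrightarrow> dist (f x) (f y) < e" if "e > 0" for e
  proof -
    from uc[unfolded uniformly_continuous_on_def, rule_format, OF \<open>e > 0\<close>]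
    obtain d where d: "d > 0" "\<forall>x\<in>?K. \<forall>y\<in>?K. dist y x < d \<longrightarrow> dist (f y) (f x) < e"
      by blast
    have "dist (f x) (f y) < e" if "dist x y < min d 1" for x y
    proof (cases "x \<in> K \<or> y \<in> K")
      case True
      then have "x \<in> ?K \<and> y \<in> ?K"
        using near[of x y] near[of y x] near[of x x] near[of y y] that
        by (simp only: dist_commute dist_self min_less_iff_conj zero_less_one) blast
      then have "dist (f y) (f x) < e" using d(2) that by (simp add: dist_commute)
      then show ?thesis by (simp only: dist_commute)
    next
      case False
      then show ?thesis using K(2) \<open>e > 0\<close> by simp
    qed
    then show ?thesis using d(1) by (intro exI[of _ "min d 1"]) auto
  qed
  then show ?thesis unfolding uniformly_continuous_on_def by (simp add: dist_commute)
qed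

text \<open>The error is controlled by the oscillation of \<open>G\<close> on
  \<open>ball x d\<close>, and uniform continuity makes \<open>d\<close> independent of
  \<open>x\<close>.\<close>

lemma uniform_linearization:
  fixes \<phi> :: "'a::euclidean_space \<Rightarrow> real"
  assumes G: "\<And>x. (\<phi> has_derivative (\<lambda>h. G x \<bullet> h)) (at x)"
    and uc: "uniformly_continuous_on UNIV G" and "e > 0"
  obtains d where "d > 0" "\<And>x y. norm (y - x) < d \<Longrightarrow> \<bar>\<phi> y - \<phi> x - G x \<bullet> (y - x)\<bar> \<le> e * norm (y - x)"
proof -
  from uc[unfolded uniformly_continuous_on_def, rule_format, OF \<open>e > 0\<close>]
  obtain d where d: "d > 0" "\<And>x y. dist y x < d \<Longrightarrow> dist (G y) (G x) < e"
    by blast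
  have "\<bar>\<phi> y - \<phi> x - G x \<bullet> (y - x)\<bar> \<le> e * norm (y - x)" if "norm (y - x) < d" for x y
  proof -
    have "norm (\<phi> y - \<phi> x - G x \<bullet> (y - x)) \<le> norm (y - x) * e"
    proof (rule differentiable_bound_linearization[where S = "ball x d" and f' = "\<lambda>x h. G x \<bullet> h"])
      fix t :: real assume "t \<in> {0..1}"
      then have "norm (t *\<^sub>R (y - x)) \<le> norm (y - x)" by (simp add: mult_left_le_one_le)
      then show "x + t *\<^sub>R (y - x) \<in> ball x d" using that by (simp add: dist_norm)
    next
      fix z assume "z \<in> ball x d"
      then have "norm (G z - G x) \<le> e" using d(2)[of z x] by (simp add: dist_norm norm_minus_commute[of x z])
      then show "onorm ((\<lambda>h. G z \<bullet> h) - (\<lambda>h. G x \<bullet> h)) \<le> e"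
        by (intro onorm_le) (simp add: inner_diff_left[symmetric]
            order_trans[OF Cauchy_Schwarz_ineq2 mult_right_mono])
    qed (use d G in \<open>auto intro: has_derivative_at_withinI\<close>)
    then show ?thesis by (simp add: mult.commute)
  qed
  with that d(1) show thesis by blast
qed

lemma integrable_mult_bounded:
  fixes v f :: "'a \<Rightarrow> real"
  assumes "integrable M v" "f \<in> borel_measurable M" "\<And>x. \<bar>f x\<bar> \<le> B"
  shows "integrable M (\<lambda>x. v x * f x)"
proof (rule Bochner_Integration.integrable_bound[of _ "\<lambda>x. B * v x"])
  have [measurable]: "v \<in> borel_measurable M" "f \<in> borel_measurable M" using assms by auto
  show "(\<lambda>x. v x * f x) \<in> borel_measurable M" by measurable
  have "\<bar>v x\<bar> * \<bar>f x\<bar> \<le> \<bar>B\<bar> * \<bar>v x\<bar>" for x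
    using mult_right_mono[OF order_trans[OF assms(3)[of x] abs_ge_self], of "\<bar>v x\<bar>"] by (simp add: mult.commute)
  then show "AE x in M. norm (v x * f x) \<le> norm (B * v x)"
    by (simp add: abs_mult)
qed (use assms in auto)

lemma integrable_test_function:
  assumes \<phi>: "\<phi> \<in> test_functions \<Omega>"
  shows "integrable lborel \<phi>"
proof -
  obtain K where K: "compact K" "\<And>x. x \<notin> K \<Longrightarrow> \<phi> x = 0"
    using \<phi> by (auto simp: test_functions_def)
  have "set_integrable lborel K \<phi>"
    using borel_integrable_compact[OF K(1) test_function_continuous[OF \<phi>]]
    by (simp add: set_integrable_def)
  moreover have "indicator K x *\<^sub>R \<phi> x = \<phi> x" for x
    using K(2)[of x] by (auto simp: indicator_def)
  ultimately show ?thesis by (simp only: set_integrable_def)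
qed

text \<open>As a function of \<open>h\<close>, the left-hand side has as its derivative, up to sign,
  the integral of \<open>v\<close> against a directional derivative of the translated test function.
  This is 0 while the translate stays supported in \<open>\<Omega>\<close>, which
  \<open>norm h < r\<close> guarantees.\<close>

lemma zero_weak_gradient_translation:
  fixes v :: "'a::euclidean_space \<Rightarrow> real"
  assumes v: "integrable lborel v"
    and W: "\<And>\<phi> i. \<phi> \<in> test_functions \<Omega> \<Longrightarrow> i \<in> Basis \<Longrightarrow> (\<integral>x. v x * frechet_derivative \<phi> (at x) i \<partial>lborel) = 0"
    and sub: "ball p (2 * r) \<subseteq> \<Omega>" and \<phi>: "\<phi> \<in> test_functions (ball p r)" and h: "norm h < r"
  shows "(\<integral>x. v x * \<phi> (x - h) \<partial>lborel) = (\<integral>x. v x * \<phi> x \<partial>lborel)"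
proof -
  define F where "F h = (\<integral>x. v x * \<phi> (x - h) \<partial>lborel)" for h
  obtain G K where G: "\<And>x. (\<phi> has_derivative (\<lambda>h. G x \<bullet> h)) (at x)" "continuous_on UNIV G"
    "compact K" "\<And>x. x \<notin> K \<Longrightarrow> G x = 0"
    using test_function_gradient[OF \<phi>] by metis
  obtain B where B: "\<And>x. norm (G x) \<le> B"
    using continuous_compact_support_bounded[OF G(2,3,4)] by metis
  obtain B' where B': "\<And>x. \<bar>\<phi> x\<bar> \<le> B'"
    using test_function_bounded[OF \<phi>] by metis
  have [measurable]: "v \<in> borel_measurable borel" "\<phi> \<in> borel_measurable borel" "G \<in> borel_measurable borel"
    using v Ck_fun_measurable[OF test_function_Ck[OF \<phi>]] borel_measurable_continuous_onI[OF G(2)] by auto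
  have int\<phi>: "integrable lborel (\<lambda>x. v x * \<phi> (x - h))" for h
    by (rule integrable_mult_bounded[OF v, of _ B']) (use B' in auto)
  have intG: "integrable lborel (\<lambda>x. v x * (G (x - h) \<bullet> k))" for h k
    by (rule integrable_mult_bounded[OF v, of _ "B * norm k"])
       (simp_all add: order_trans[OF Cauchy_Schwarz_ineq2 mult_right_mono[OF B]])
  have zero: "(\<integral>x. v x * (G (x - h) \<bullet> k) \<partial>lborel) = 0" if "norm h < r" for h k
  proof -
    have "(\<lambda>x. x + h) ` ball p r \<subseteq> \<Omega>"
    proof
      fix y assume "y \<in> (\<lambda>x. x + h) ` ball p r"
      then obtain x where x: "y = x + h" "dist p x < r" by auto
      have "dist p y \<le> dist p x + norm h"
        using x(1) dist_triangle[of p y x] by (simp add: dist_norm norm_minus_commute)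
      with x that have "y \<in> ball p (2 * r)" by simp
      with sub show "y \<in> \<Omega>" by blast
    qed
    then have T: "(\<lambda>x. \<phi> (x - h)) \<in> test_functions \<Omega>"
      by (rule test_function_translate[OF \<phi>])
    have "((\<lambda>x. \<phi> (x - h)) has_derivative (\<lambda>k. G (x - h) \<bullet> k)) (at x)" for x
      by (rule has_derivative_compose[of "\<lambda>x. x - h" "\<lambda>k. k", OF _ G(1)])
         (auto intro!: derivative_eq_intros)
    then have "frechet_derivative (\<lambda>x. \<phi> (x - h)) (at x) = (\<lambda>k. G (x - h) \<bullet> k)" for x
      using frechet_derivative_at by metis
    then have base: "(\<integral>x. v x * (G (x - h) \<bullet> i) \<partial>lborel) = 0" if "i \<in> Basis" for i
      using W[OF T that] by simp
    \<comment> \<open>The hypothesis speaks of basis directions; an arbitrary \<open>k\<close>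
      follows by expansion in coordinates.\<close>
    have "v x * (G (x - h) \<bullet> k) = (\<Sum>i\<in>Basis. (k \<bullet> i) * (v x * (G (x - h) \<bullet> i)))" for x
      by (subst euclidean_inner) (simp add: sum_distrib_left algebra_simps)
    then show ?thesis
      using base intG by simp
  qed
  have "\<exists>c. \<forall>h\<in>ball 0 r. F h = c"
  proof (rule has_derivative_zero_constant)
    fix h :: 'a assume "h \<in> ball 0 r"
    then have h: "norm h < r" by simp
    show "(F has_derivative (\<lambda>h. 0)) (at h within ball 0 r)"
      unfolding has_derivative_within_alt
    proof (intro conjI allI impI bounded_linear_zero)
      fix e :: real assume "e > 0"
      \<comment> \<open>Integration against \<open>v\<close> multiplies the uniform linearization
        error by at most \<open>I\<close>; dividing by \<open>I + 1\<close> below is safe even for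
        \<open>I = 0\<close>.\<close>
      define I where "I = (\<integral>x. \<bar>v x\<bar> \<partial>lborel)"
      have "I \<ge> 0" by (simp add: I_def)
      with \<open>e > 0\<close> have "e / (I + 1) > 0" by simp
      then obtain d where d: "d > 0" "\<And>x y. norm (y - x) < d \<Longrightarrow>
          \<bar>\<phi> y - \<phi> x - G x \<bullet> (y - x)\<bar> \<le> e / (I + 1) * norm (y - x)"
        using uniform_linearization[OF G(1) uniformly_continuous_compact_support[OF G(2,3,4)]] by metis
      have "norm (F k - F h - 0) \<le> e * norm (k - h)" if "norm (k - h) < d" for k
      proof -
        \<comment> \<open>The linear term may be inserted because it integrates to 0 by
          \<open>zero\<close>.\<close>
        have "F k - F h = (\<integral>x. v x * \<phi> (x - k) - v x * \<phi> (x - h) - v x * (G (x - h) \<bullet> (h - k)) \<partial>lborel)"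
          using int\<phi> intG zero[OF h] by (simp add: F_def)
        also have "\<bar>\<dots>\<bar> \<le> (\<integral>x. (e / (I + 1) * norm (k - h)) * \<bar>v x\<bar> \<partial>lborel)"
        proof (rule order_trans[OF integral_abs_bound integral_mono])
          fix x
          have "\<bar>\<phi> (x - k) - \<phi> (x - h) - G (x - h) \<bullet> (h - k)\<bar> \<le> e / (I + 1) * norm (k - h)"
            using d(2)[of "x - k" "x - h"] that by (simp add: norm_minus_commute)
          from mult_right_mono[OF this abs_ge_zero[of "v x"]]
          show "\<bar>v x * \<phi> (x - k) - v x * \<phi> (x - h) - v x * (G (x - h) \<bullet> (h - k))\<bar>
              \<le> e / (I + 1) * norm (k - h) * \<bar>v x\<bar>"
            by (simp add: abs_mult[symmetric] algebra_simps)
        qed (use int\<phi> intG v in auto)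
        also have "\<dots> = (e * (I / (I + 1))) * norm (k - h)"
          by (simp add: I_def)
        also have "\<dots> \<le> e * norm (k - h)"
          using \<open>I \<ge> 0\<close> \<open>e > 0\<close> by (intro mult_right_mono mult_left_le) auto
        finally show ?thesis by simp
      qed
      then show "\<exists>d>0. \<forall>y\<in>ball 0 r. norm (y - h) < d \<longrightarrow> norm (F y - F h - 0) \<le> e * norm (y - h)"
        using d(1) by blast
    qed
  qed simp
  moreover have "0 \<in> ball (0::'a) r" using h norm_ge_zero[of h] by (simp del: norm_ge_zero)
  ultimately have "F h = F 0" using h by auto
  then show ?thesis by (simp add: F_def)
qed

lemma lborel_integral_reflect:
  fixes f :: "'a::euclidean_space \<Rightarrow> real"
  assumes [measurable]: "f \<in> borel_measurable borel"
  shows "(\<integral>y. f (c - y) \<partial>lborel) = (\<integral>y. f y \<partial>lborel)"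
proof -
  have "lborel = distr lborel borel (\<lambda>y. c - y)"
    using lborel_affine[of "-1" c] by (simp add: density_1)
  then have "(\<integral>y. f y \<partial>lborel) = (\<integral>y. f y \<partial>distr lborel borel (\<lambda>y. c - y))"
    by simp
  also have "\<dots> = (\<integral>y. f (c - y) \<partial>lborel)"
    by (rule integral_distr) auto
  finally show ?thesis by simp
qed

text \<open>Reflecting the inner integral shows that the left-hand side is symmetric in \<open>\<phi>\<close> and \<open>\<psi>\<close>, so that
  integration against \<open>v\<close> is a multiple of integration on test functions near \<open>p\<close>.\<close>

lemma zero_weak_gradient_pairing:
  fixes v :: "'a::euclidean_space \<Rightarrow> real"
  assumes v: "integrable lborel v"
    and W: "\<And>\<phi> i. \<phi> \<in> test_functions \<Omega> \<Longrightarrow> i \<in> Basis \<Longrightarrow> (\<integral>x. v x * frechet_derivative \<phi> (at x) i \<partial>lborel) = 0"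
    and sub: "ball p (2 * r) \<subseteq> \<Omega>"
    and \<phi>: "\<phi> \<in> test_functions (ball p r)" and \<psi>: "\<psi> \<in> test_functions (ball p r)"
  shows "(\<integral>x. v x * (\<integral>y. \<phi> (x - y + p) * \<psi> y \<partial>lborel) \<partial>lborel) =
    (\<integral>y. \<psi> y \<partial>lborel) * (\<integral>x. v x * \<phi> x \<partial>lborel)"
proof -
  have [measurable]: "v \<in> borel_measurable borel" "\<phi> \<in> borel_measurable borel" "\<psi> \<in> borel_measurable borel"
    using v Ck_fun_measurable[OF test_function_Ck[OF \<phi>]] Ck_fun_measurable[OF test_function_Ck[OF \<psi>]] by auto
  obtain B where B: "\<And>x. \<bar>\<phi> x\<bar> \<le> B"
    using test_function_bounded[OF \<phi>] by metis
  have int\<psi>: "integrable lborel \<psi>"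
    by (rule integrable_test_function[OF \<psi>])
  have J: "integrable (lborel \<Otimes>\<^sub>M lborel) (\<lambda>(x, y). v x * (\<phi> (x - y + p) * \<psi> y))"
  proof (rule Bochner_Integration.integrable_bound)
    show "integrable (lborel \<Otimes>\<^sub>M lborel) (\<lambda>(x, y). v x * (B * \<psi> y))"
      by (rule lborel_pair.Fubini_integrable) (use v int\<psi> in \<open>auto simp: abs_mult\<close>)
    show "(\<lambda>(x, y). v x * (\<phi> (x - y + p) * \<psi> y)) \<in> borel_measurable (lborel \<Otimes>\<^sub>M lborel)"
      by measurable
    show "AE x in lborel \<Otimes>\<^sub>M lborel. norm (case x of (x, y) \<Rightarrow> v x * (\<phi> (x - y + p) * \<psi> y))
        \<le> norm (case x of (x, y) \<Rightarrow> v x * (B * \<psi> y))"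
      using B by (intro AE_I2) (auto simp: abs_mult intro!: mult_left_mono mult_right_mono order_trans[OF B abs_ge_self])
  qed
  \<comment> \<open>The function \<open>\<phi> (x - y + p)\<close> is \<open>\<phi>\<close>
    translated by \<open>y - p\<close>, which is shorter than \<open>r\<close> for \<open>y\<close>
    in the ball; for other \<open>y\<close> the factor \<open>\<psi> y\<close> is 0.\<close>
  have inner: "(\<integral>x. v x * (\<phi> (x - y + p) * \<psi> y) \<partial>lborel) = \<psi> y * (\<integral>x. v x * \<phi> x \<partial>lborel)" for y
  proof (cases "y \<in> ball p r")
    case True
    then have "norm (y - p) < r" by (simp add: dist_norm norm_minus_commute)
    from zero_weak_gradient_translation[OF v W sub \<phi> this]
    have "(\<integral>x. v x * \<phi> (x - y + p) \<partial>lborel) = (\<integral>x. v x * \<phi> x \<partial>lborel)"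
      by (simp add: algebra_simps)
    moreover have "(\<integral>x. v x * (\<phi> (x - y + p) * \<psi> y) \<partial>lborel) = (\<integral>x. \<psi> y * (v x * \<phi> (x - y + p)) \<partial>lborel)"
      by (simp add: mult_ac)
    ultimately show ?thesis by simp
  next
    case False
    then show ?thesis using test_function_eq_0[OF \<psi>] by simp
  qed
  have "(\<integral>x. v x * (\<integral>y. \<phi> (x - y + p) * \<psi> y \<partial>lborel) \<partial>lborel)
      = (\<integral>x. (\<integral>y. v x * (\<phi> (x - y + p) * \<psi> y) \<partial>lborel) \<partial>lborel)"
    by simp
  also have "\<dots> = (\<integral>y. (\<integral>x. v x * (\<phi> (x - y + p) * \<psi> y) \<partial>lborel) \<partial>lborel)"
    using lborel_pair.Fubini_integral[OF J] by simp
  also have "\<dots> = (\<integral>y. \<psi> y \<partial>lborel) * (\<integral>x. v x * \<phi> x \<partial>lborel)"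
    unfolding inner by simp
  finally show ?thesis .
qed

lemma AE_lborel_ball_False:
  fixes p :: "'a::euclidean_space"
  assumes "AE x in lborel. x \<notin> ball p r"
  shows "r \<le> 0"
proof (rule ccontr)
  assume "\<not> r \<le> 0"
  then have "\<not> negligible (ball p r)" by (intro open_not_negligible) auto
  moreover have "emeasure lborel (ball p r) = 0"
    using assms by (subst (asm) AE_iff_measurable[of "ball p r"]) auto
  ultimately show False
    by (simp add: negligible_iff_emeasure0 emeasure_completion)
qed

text \<open>Symmetry of the pairing makes integration against \<open>v\<close> proportional to plain
  integration on test functions. The factor \<open>c\<close> is then the value of \<open>v\<close>,
  by the fundamental lemma.\<close>

lemma zero_weak_gradient_ball:
  fixes v :: "'a::euclidean_space \<Rightarrow> real"
  assumes v: "integrable lborel v"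
    and W: "\<And>\<phi> i. \<phi> \<in> test_functions \<Omega> \<Longrightarrow> i \<in> Basis \<Longrightarrow> (\<integral>x. v x * frechet_derivative \<phi> (at x) i \<partial>lborel) = 0"
    and sub: "ball p (2 * r) \<subseteq> \<Omega>" and "r > 0"
  shows "\<exists>c. AE x in lborel. x \<in> ball p r \<longrightarrow> v x = c"
proof -
  have symm: "(\<integral>y. \<psi> y \<partial>lborel) * (\<integral>x. v x * \<phi> x \<partial>lborel) = (\<integral>y. \<phi> y \<partial>lborel) * (\<integral>x. v x * \<psi> x \<partial>lborel)"
    if \<phi>: "\<phi> \<in> test_functions (ball p r)" and \<psi>: "\<psi> \<in> test_functions (ball p r)" for \<phi> \<psi>
  proof -
    have [measurable]: "\<phi> \<in> borel_measurable borel" "\<psi> \<in> borel_measurable borel"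
      using Ck_fun_measurable[OF test_function_Ck[OF \<phi>]] Ck_fun_measurable[OF test_function_Ck[OF \<psi>]] by auto
    \<comment> \<open>The reflection of \<open>y\<close> to \<open>x + p - y\<close> exchanges the
      roles of \<open>\<phi>\<close> and \<open>\<psi>\<close>.\<close>
    have "(\<integral>y. \<phi> (x - y + p) * \<psi> y \<partial>lborel) = (\<integral>y. \<psi> (x - y + p) * \<phi> y \<partial>lborel)" for x
      using lborel_integral_reflect[of "\<lambda>y. \<phi> (x - y + p) * \<psi> y" "x + p"] by (simp add: algebra_simps)
    then show ?thesis
      using zero_weak_gradient_pairing[OF v W sub \<phi> \<psi>] zero_weak_gradient_pairing[OF v W sub \<psi> \<phi>] by simp
  qed
  have fin: "emeasure lborel (ball p r) < \<infinity>"
    by (rule emeasure_bounded_finite) simp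
  have ind: "integrable lborel (\<lambda>x. c * indicator (ball p r) x :: real)" for c
    using fin by auto
  \<comment> \<open>If all test functions had integral 0, the fundamental lemma for the indicator of
    the ball would make the ball a null set.\<close>
  have "\<exists>\<phi>\<in>test_functions (ball p r). (\<integral>x. \<phi> x \<partial>lborel) \<noteq> 0"
  proof (rule ccontr)
    assume none: "\<not> (\<exists>\<phi>\<in>test_functions (ball p r). (\<integral>x. \<phi> x \<partial>lborel) \<noteq> 0)"
    have "AE x in lborel. x \<in> ball p r \<longrightarrow> (1 * indicator (ball p r) x :: real) = 0"
    proof (rule fundamental_lemma_variations[OF ind open_ball])
      fix \<phi> assume \<phi>: "\<phi> \<in> test_functions (ball p r)"
      have "1 * indicator (ball p r) x * \<phi> x = \<phi> x" for x
        using test_function_eq_0[OF \<phi>, of x] by (auto simp: indicator_def)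
      then show "(\<integral>x. 1 * indicator (ball p r) x * \<phi> x \<partial>lborel) = 0"
        using none \<phi> by (simp only:) blast
    qed
    then have "AE x in lborel. x \<notin> ball p r"
      by eventually_elim (auto simp: indicator_def)
    then show False using AE_lborel_ball_False \<open>r > 0\<close> by fastforce
  qed
  then obtain \<phi> where \<phi>: "\<phi> \<in> test_functions (ball p r)" "(\<integral>x. \<phi> x \<partial>lborel) \<noteq> 0"
    by blast
  define c where "c = (\<integral>x. v x * \<phi> x \<partial>lborel) / (\<integral>x. \<phi> x \<partial>lborel)"
  have "AE x in lborel. x \<in> ball p r \<longrightarrow> v x - c * indicator (ball p r) x = 0"
  proof (rule fundamental_lemma_variations)
    show "integrable lborel (\<lambda>x. v x - c * indicator (ball p r) x)"
      using v ind by (rule Bochner_Integration.integrable_diff)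
    fix \<psi> assume \<psi>: "\<psi> \<in> test_functions (ball p r)"
    obtain B where B: "\<And>x. \<bar>\<psi> x\<bar> \<le> B"
      using test_function_bounded[OF \<psi>] by metis
    have "integrable lborel (\<lambda>x. v x * \<psi> x)"
      by (rule integrable_mult_bounded[OF v _ B]) (use Ck_fun_measurable[OF test_function_Ck[OF \<psi>]] in simp)
    moreover have "(v x - c * indicator (ball p r) x) * \<psi> x = v x * \<psi> x - c * \<psi> x" for x
      using test_function_eq_0[OF \<psi>, of x] by (auto simp: indicator_def algebra_simps)
    ultimately have "(\<integral>x. (v x - c * indicator (ball p r) x) * \<psi> x \<partial>lborel)
        = (\<integral>x. v x * \<psi> x \<partial>lborel) - c * (\<integral>x. \<psi> x \<partial>lborel)"
      using integrable_test_function[OF \<psi>] by simp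
    also have "\<dots> = 0"
      using symm[OF \<phi>(1) \<psi>] \<phi>(2) by (simp add: c_def field_simps)
    finally show "(\<integral>x. (v x - c * indicator (ball p r) x) * \<psi> x \<partial>lborel) = 0" .
  qed simp
  then have "AE x in lborel. x \<in> ball p r \<longrightarrow> v x = c"
    by eventually_elim auto
  then show ?thesis by blast
qed

text \<open>Point values carry no information, so \<open>near p c\<close> records the essential
  constant around \<open>p\<close>. It is unique because balls have positive measure, and it is the
  same at nearby points; connectedness makes it global, and \<open>AE_local\<close> joins the
  balls.\<close>

lemma zero_weak_gradient_connected:
  fixes v :: "'a::euclidean_space \<Rightarrow> real"
  assumes v: "integrable lborel v"
    and W: "\<And>\<phi> i. \<phi> \<in> test_functions \<Omega> \<Longrightarrow> i \<in> Basis \<Longrightarrow> (\<integral>x. v x * frechet_derivative \<phi> (at x) i \<partial>lborel) = 0"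
    and "open \<Omega>" "connected \<Omega>"
  shows "\<exists>c. AE x in lborel. x \<in> \<Omega> \<longrightarrow> v x = c"
proof -
  define near where "near p c \<longleftrightarrow> (\<exists>r>0. AE x in lborel. x \<in> ball p r \<longrightarrow> v x = c)" for p c
  have loc: "\<exists>r>0. \<exists>c. ball p r \<subseteq> \<Omega> \<and> (AE x in lborel. x \<in> ball p r \<longrightarrow> v x = c)" if "p \<in> \<Omega>" for p
  proof -
    obtain e where e: "e > 0" "ball p e \<subseteq> \<Omega>"
      using \<open>open \<Omega>\<close> \<open>p \<in> \<Omega>\<close> open_contains_ball by blast
    have "ball p (e / 2) \<subseteq> ball p e" using e(1) using subset_ball[of "e / 2" e p] by simp
    with zero_weak_gradient_ball[OF v W, where p = p and r = "e / 2"] e show ?thesis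
      by (intro exI[of _ "e / 2"]) auto
  qed
  have uniq: "c = c'" if "near p c" "near p c'" for p c c'
  proof (rule ccontr)
    assume "c \<noteq> c'"
    from that obtain r r' where r: "r > 0" "r' > 0"
      "AE x in lborel. x \<in> ball p r \<longrightarrow> v x = c" "AE x in lborel. x \<in> ball p r' \<longrightarrow> v x = c'"
      by (auto simp: near_def)
    from r(3,4) have "AE x in lborel. x \<notin> ball p (min r r')"
      by eventually_elim (use \<open>c \<noteq> c'\<close> in auto)
    then show False using AE_lborel_ball_False r(1,2) by fastforce
  qed
  have open_near: "near y c" if AE: "AE x in lborel. x \<in> ball p r \<longrightarrow> v x = c" and y: "y \<in> ball p r" for p r c y
  proof -
    obtain e where e: "e > 0" "ball y e \<subseteq> ball p r"
      using y open_ball open_contains_ball by blast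
    have "AE x in lborel. x \<in> ball y e \<longrightarrow> v x = c"
      using AE by eventually_elim (use e in blast)
    with e(1) show ?thesis by (auto simp: near_def)
  qed
  show ?thesis
  proof (cases "\<Omega> = {}")
    case False
    then obtain a where "a \<in> \<Omega>" by blast
    then obtain c where c: "near a c" using loc by (force simp: near_def)
    have near_all: "near b c" if "b \<in> \<Omega>" for b
    proof -
      have "\<forall>c. near a c \<longleftrightarrow> near b c"
      proof (rule connected_equivalence_relation[OF \<open>connected \<Omega>\<close> \<open>a \<in> \<Omega>\<close> \<open>b \<in> \<Omega>\<close>])
        fix p assume "p \<in> \<Omega>"
        then obtain r k where r: "r > 0" "ball p r \<subseteq> \<Omega>" "AE x in lborel. x \<in> ball p r \<longrightarrow> v x = k"
          using loc by blast
        have "near y k" if "y \<in> ball p r" for y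
          using open_near[OF r(3) that] .
        moreover have "p \<in> ball p r" using r(1) by simp
        ultimately have "\<forall>y\<in>ball p r. \<forall>c. near p c \<longleftrightarrow> near y c"
          using uniq by metis
        moreover have "openin (top_of_set \<Omega>) (ball p r)"
          using r(2) by (simp add: open_subset)
        ultimately show "\<exists>T. openin (top_of_set \<Omega>) T \<and> p \<in> T \<and> (\<forall>x\<in>T. \<forall>c. near p c \<longleftrightarrow> near x c)"
          using \<open>p \<in> ball p r\<close> by blast
      qed auto
      with c show ?thesis by blast
    qed
    have "AE x in lborel. x \<in> \<Omega> \<longrightarrow> v x = c"
    proof (rule AE_local)
      fix x assume "x \<in> \<Omega>"
      with near_all obtain r where "r > 0" "AE y in lborel. y \<in> ball x r \<longrightarrow> v y = c"
        by (auto simp: near_def)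
      then show "\<exists>T. open T \<and> x \<in> T \<and> (AE y in lborel. y \<in> T \<longrightarrow> v y = c)"
        by (intro exI[of _ "ball x r"]) auto
    qed
    then show ?thesis by blast
  qed auto
qed

text \<open>Translating \<open>\<phi>\<close> preserves its integral, and the difference quotient is
  uniformly close to the partial derivative on a fixed compact set. This later shows that constants
  have weak gradient 0.\<close>

lemma integral_partial_test_function:
  fixes \<phi> :: "'a::euclidean_space \<Rightarrow> real"
  assumes "\<phi> \<in> test_functions \<Omega>"
  shows "(\<integral>x. frechet_derivative \<phi> (at x) i \<partial>lborel) = 0"
proof -
  obtain G K where G: "\<And>x. (\<phi> has_derivative (\<lambda>h. G x \<bullet> h)) (at x)" "continuous_on UNIV G"
    "compact K" "\<And>x. x \<notin> K \<Longrightarrow> \<phi> x = 0" "\<And>x. x \<notin> K \<Longrightarrow> G x = 0"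
    using test_function_gradient[OF assms] by metis
  have eq: "frechet_derivative \<phi> (at x) = (\<lambda>h. G x \<bullet> h)" for x
    using frechet_derivative_at[OF G(1)] by simp
  define J where "J = (\<integral>x. G x \<bullet> i \<partial>lborel)"
  \<comment> \<open>Contains the supports of \<open>\<phi>\<close> and of its translates by vectors
    of length at most 1, so that the uniform error is integrated over a set of finite measure
    \<open>m\<close>.\<close>
  define K' where "K' = {x + y |x y. x \<in> K \<and> y \<in> cball 0 1}"
  have cK: "compact K'" unfolding K'_def using G(3) by (intro compact_sums) auto
  have K': "x + y \<in> K'" if "x \<in> K" "norm y \<le> 1" for x y
    using that by (auto simp: K'_def)
  have intK: "integrable lborel (\<lambda>x. indicator K' x :: real)"
    using cK emeasure_compact_finite[OF cK] by (simp add: compact_imp_closed borel_closed)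
  define m where "m = (\<integral>x. indicator K' x \<partial>lborel :: real)"
  have "m \<ge> 0" by (simp add: m_def)
  have [measurable]: "G \<in> borel_measurable borel" "\<phi> \<in> borel_measurable borel"
    using borel_measurable_continuous_onI[OF G(2)] Ck_fun_measurable[OF test_function_Ck[OF assms]] by auto
  have int\<phi>: "integrable lborel \<phi>" by (rule integrable_test_function[OF assms])
  have int\<phi>': "integrable lborel (\<lambda>x. \<phi> (x + h))"
    and shift: "(\<integral>x. \<phi> (x + h) \<partial>lborel) = (\<integral>x. \<phi> x \<partial>lborel)" for h
  proof -
    have *: "(\<integral>x. \<phi> (h + x) \<partial>lborel) = (\<integral>x. \<phi> x \<partial>lborel)"
      by (subst (2) lborel_distr_plus[of h, symmetric], subst integral_distr) auto
    have "integrable (distr lborel borel ((+) h)) \<phi>" using int\<phi> by (simp add: lborel_distr_plus)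
    then have "integrable lborel (\<lambda>x. \<phi> (h + x))" by (subst (asm) integrable_distr_eq) auto
    with * show "integrable lborel (\<lambda>x. \<phi> (x + h))" "(\<integral>x. \<phi> (x + h) \<partial>lborel) = (\<integral>x. \<phi> x \<partial>lborel)"
      by (simp_all add: add.commute)
  qed
  have intG: "integrable lborel (\<lambda>x. G x \<bullet> i)"
  proof -
    have "integrable lborel (\<lambda>x. indicator K x *\<^sub>R (G x \<bullet> i))"
      using G(2,3) by (intro borel_integrable_compact continuous_intros) (auto intro: continuous_on_subset)
    moreover have "indicator K x *\<^sub>R (G x \<bullet> i) = G x \<bullet> i" for x
      using G(5)[of x] by (auto simp: indicator_def)
    ultimately show ?thesis by (simp only:)
  qed
  have "\<bar>J\<bar> \<le> 0 + e" if "e > 0" for e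
  proof -
    \<comment> \<open>Chosen so that \<open>e' * (norm i + 1) * (m + 1) = e\<close>; the added ones
      keep the denominator positive.\<close>
    define e' where "e' = e / ((norm i + 1) * (m + 1))"
    have "e' > 0" using \<open>e > 0\<close> \<open>m \<ge> 0\<close> by (auto simp: e'_def intro!: divide_pos_pos mult_pos_pos add_nonneg_pos)
    then obtain d where d: "d > 0" "\<And>x y. norm (y - x) < d \<Longrightarrow>
        \<bar>\<phi> y - \<phi> x - G x \<bullet> (y - x)\<bar> \<le> e' * norm (y - x)"
      using uniform_linearization[OF G(1) uniformly_continuous_compact_support[OF G(2,3,5)]] by metis
    define t where "t = min (d / 2) 1 / (norm i + 1)"
    have ni: "norm i + 1 > 0" by (simp add: add_nonneg_pos)
    have t: "t > 0" "t * norm i < d" "t * norm i \<le> 1"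
    proof -
      show "t > 0" using d(1) ni by (simp add: t_def)
      have "t * norm i \<le> t * (norm i + 1)" using \<open>t > 0\<close> by simp
      also have "\<dots> = min (d / 2) 1" using ni by (simp add: t_def)
      finally show "t * norm i < d" "t * norm i \<le> 1" using d(1) by auto
    qed
    \<comment> \<open>By translation invariance the integrals of the first two terms cancel.\<close>
    have "- t * J = (\<integral>x. \<phi> (x + t *\<^sub>R i) - \<phi> x - t * (G x \<bullet> i) \<partial>lborel)"
      using int\<phi> int\<phi>' intG shift by (simp add: J_def)
    also have "\<bar>\<dots>\<bar> \<le> (\<integral>x. (e' * (t * norm i)) * indicator K' x \<partial>lborel)"
    proof (rule order_trans[OF integral_abs_bound integral_mono])
      fix x
      show "\<bar>\<phi> (x + t *\<^sub>R i) - \<phi> x - t * (G x \<bullet> i)\<bar> \<le> e' * (t * norm i) * indicator K' x"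
      proof (cases "x \<in> K'")
        case True
        then show ?thesis using d(2)[of "x + t *\<^sub>R i" x] t by simp
      next
        case False
        have "x \<notin> K"
        proof
          assume "x \<in> K"
          then show False using K'[of x 0] False by simp
        qed
        moreover have "x + t *\<^sub>R i \<notin> K"
        proof
          assume "x + t *\<^sub>R i \<in> K"
          then show False using K'[of "x + t *\<^sub>R i" "- t *\<^sub>R i"] t False by simp
        qed
        ultimately show ?thesis using G(4,5) False by simp
      qed
    qed (use int\<phi> int\<phi>' intG intK in auto)
    also have "\<dots> = e' * (t * norm i) * m" by (simp add: m_def)
    finally have "t * \<bar>J\<bar> \<le> t * (e' * norm i * m)" using t(1) by (simp add: abs_mult mult_ac)
    then have "\<bar>J\<bar> \<le> e' * norm i * m" using t(1) by simp
    also have "\<dots> \<le> e' * (norm i + 1) * (m + 1)"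
      using \<open>e' > 0\<close> \<open>m \<ge> 0\<close> by (intro mult_mono) auto
    also have "\<dots> = e"
      using ni \<open>m \<ge> 0\<close> by (simp add: e'_def)
    finally show ?thesis by simp
  qed
  then have "\<bar>J\<bar> \<le> 0" by (rule field_le_epsilon)
  then show ?thesis by (simp add: eq J_def)
qed

section \<open>Semi-inner products\<close>

text \<open>Representatives of zero have seminorm 0, hence a semidefinite form. The laws are
  confined to \<open>S\<close>: outside, integrals may take their default value 0 and linearity can
  fail.\<close>

locale semi_inner =
  fixes S :: "'v::real_vector set" and b :: "'v \<Rightarrow> 'v \<Rightarrow> real"
  assumes subspace_S: "subspace S"
    and lin: "\<And>u v w c. u \<in> S \<Longrightarrow> v \<in> S \<Longrightarrow> w \<in> S \<Longrightarrow> b (u + c *\<^sub>R v) w = b u w + c * b v w"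
    and sym: "\<And>u v. u \<in> S \<Longrightarrow> v \<in> S \<Longrightarrow> b u v = b v u"
    and nonneg: "\<And>u. u \<in> S \<Longrightarrow> 0 \<le> b u u"
begin

lemma comb_in [intro]: "u \<in> S \<Longrightarrow> v \<in> S \<Longrightarrow> u + c *\<^sub>R v \<in> S"
  by (intro subspace_add subspace_scale subspace_S)

lemma quad:
  assumes "u \<in> S" "v \<in> S"
  shows "b (u + c *\<^sub>R v) (u + c *\<^sub>R v) = b u u + 2 * c * b u v + c\<^sup>2 * b v v"
proof -
  have "b (u + c *\<^sub>R v) (u + c *\<^sub>R v) = b u (u + c *\<^sub>R v) + c * b v (u + c *\<^sub>R v)"
    using assms by (simp add: lin comb_in)
  moreover have "b u (u + c *\<^sub>R v) = b (u + c *\<^sub>R v) u" "b v (u + c *\<^sub>R v) = b (u + c *\<^sub>R v) v"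
    using assms by (auto intro!: sym)
  ultimately show ?thesis
    using assms by (simp add: lin sym[of v u] power2_eq_square algebra_simps)
qed

lemma Cauchy_Schwarz:
  assumes "u \<in> S" "v \<in> S"
  shows "(b u v)\<^sup>2 \<le> b u u * b v v"
proof (cases "b v v = 0")
  case True
  have "b u v = 0"
  proof (rule ccontr)
    assume "b u v \<noteq> 0"
    \<comment> \<open>For null \<open>v\<close> the quadratic polynomial in \<open>c\<close> is
      affine, and this \<open>c\<close> gives it the value -1.\<close>
    then have "b (u + (- (b u u + 1) / (2 * b u v)) *\<^sub>R v) (u + (- (b u u + 1) / (2 * b u v)) *\<^sub>R v) = - 1"
      using quad[OF assms, of "- (b u u + 1) / (2 * b u v)"] True by (simp add: field_simps)
    then show False using nonneg[OF comb_in[OF assms]] by (metis neg_0_le_iff_le not_one_le_zero)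
  qed
  then show ?thesis using True by simp
next
  case False
  then have pos: "b v v > 0" using nonneg[OF assms(2)] by simp
  \<comment> \<open>The value of the quadratic polynomial at its minimum point
    \<open>c = - b u v / b v v\<close>.\<close>
  have "b u u + 2 * (- b u v / b v v) * b u v + (- b u v / b v v)\<^sup>2 * b v v \<ge> 0"
    using quad[OF assms] nonneg[OF comb_in[OF assms]] by metis
  moreover have "2 * (- b u v / b v v) * b u v + (- b u v / b v v)\<^sup>2 * b v v = - ((b u v)\<^sup>2 / b v v)"
    using pos by (simp add: field_simps power2_eq_square)
  ultimately have "(b u v)\<^sup>2 / b v v \<le> b u u" by linarith
  then show ?thesis using pos by (simp add: pos_divide_le_eq)
qed

lemma abs_le: "u \<in> S \<Longrightarrow> v \<in> S \<Longrightarrow> \<bar>b u v\<bar> \<le> sqrt (b u u) * sqrt (b v v)"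
  using real_sqrt_le_mono[OF Cauchy_Schwarz] by (simp add: real_sqrt_mult)

lemma null: "u \<in> S \<Longrightarrow> v \<in> S \<Longrightarrow> b u u = 0 \<Longrightarrow> b u v = 0"
  using Cauchy_Schwarz[of u v] by simp

lemma triangle:
  assumes "u \<in> S" "v \<in> S"
  shows "sqrt (b (u + c *\<^sub>R v) (u + c *\<^sub>R v)) \<le> sqrt (b u u) + \<bar>c\<bar> * sqrt (b v v)"
proof (rule real_le_lsqrt)
  have "c * b u v \<le> \<bar>c\<bar> * (sqrt (b u u) * sqrt (b v v))"
    using mult_left_mono[OF abs_le[OF assms] abs_ge_zero[of c]] by (simp add: abs_mult[symmetric])
  then have "b (u + c *\<^sub>R v) (u + c *\<^sub>R v) \<le> b u u + 2 * (\<bar>c\<bar> * (sqrt (b u u) * sqrt (b v v))) + c\<^sup>2 * b v v"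
    using quad[OF assms, of c] by simp
  also have "\<dots> = (sqrt (b u u) + \<bar>c\<bar> * sqrt (b v v))\<^sup>2"
    using nonneg assms by (simp add: power2_sum power_mult_distrib)
  finally show "b (u + c *\<^sub>R v) (u + c *\<^sub>R v) \<le> (sqrt (b u u) + \<bar>c\<bar> * sqrt (b v v))\<^sup>2" .
qed (use nonneg assms in auto)

lemma zero_left [simp]: "w \<in> S \<Longrightarrow> b 0 w = 0"
  using lin[of 0 0 w 1] subspace_0[OF subspace_S] by simp

lemma diff_left: "u \<in> S \<Longrightarrow> v \<in> S \<Longrightarrow> w \<in> S \<Longrightarrow> b (u - v) w = b u w - b v w"
  using lin[of u v w "- 1"] by simp

lemma sum_in: "(\<And>i. i \<in> I \<Longrightarrow> f i \<in> S) \<Longrightarrow> (\<Sum>i\<in>I. c i *\<^sub>R f i) \<in> S"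
  by (intro subspace_sum subspace_scale subspace_S)

lemma sum_left:
  assumes "finite I" "\<And>i. i \<in> I \<Longrightarrow> f i \<in> S" "w \<in> S"
  shows "b (\<Sum>i\<in>I. c i *\<^sub>R f i) w = (\<Sum>i\<in>I. c i * b (f i) w)"
  using assms
proof (induction I rule: finite_induct)
  case (insert i I)
  have "b ((\<Sum>i\<in>I. c i *\<^sub>R f i) + c i *\<^sub>R f i) w = b (\<Sum>i\<in>I. c i *\<^sub>R f i) w + c i * b (f i) w"
    using insert.prems by (intro lin sum_in) auto
  with insert show ?case by (simp add: add.commute)
qed simp

text \<open>Gram-Schmidt, where vectors of seminorm zero are dropped.\<close>

lemma orthonormal_basis:
  assumes "finite B" "B \<subseteq> S"
  shows "\<exists>E. finite E \<and> E \<subseteq> span B \<and> (\<forall>e\<in>E. \<forall>f\<in>E. b e f = (if e = f then 1 else 0)) \<and>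
    (\<forall>v\<in>span B. b (v - (\<Sum>e\<in>E. b v e *\<^sub>R e)) (v - (\<Sum>e\<in>E. b v e *\<^sub>R e)) = 0)"
  using assms
proof (induction B rule: finite_induct)
  case empty
  show ?case using subspace_0[OF subspace_S] by (intro exI[of _ "{}"]) auto
next
  case (insert x B)
  have "B \<subseteq> S" using insert.prems by simp
  from insert.IH[OF this] obtain E where E: "finite E" "E \<subseteq> span B"
    and on: "\<And>e f. e \<in> E \<Longrightarrow> f \<in> E \<Longrightarrow> b e f = (if e = f then 1 else 0)"
    and res: "\<And>v. v \<in> span B \<Longrightarrow> b (v - (\<Sum>e\<in>E. b v e *\<^sub>R e)) (v - (\<Sum>e\<in>E. b v e *\<^sub>R e)) = 0"
    by blast
  have S: "span (insert x B) \<subseteq> S" "span B \<subseteq> S"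
    using insert.prems by (simp_all add: span_minimal subspace_S)
  have ES: "E \<subseteq> S" using E S by blast
  define P where "P v = (\<Sum>e\<in>E. b v e *\<^sub>R e)" for v
  have PE: "P v \<in> span B" for v
    unfolding P_def using E(2) by (intro span_sum span_scale) auto
  have PS: "P v \<in> S" for v using PE S by blast
  have sp: "span B \<subseteq> span (insert x B)" by (rule span_mono) auto
  have xS: "x \<in> S" using insert.prems by simp
  define y where "y = x - P x"
  have yS: "y \<in> S" using xS PS by (simp add: y_def subspace_diff subspace_S)
  have yspan: "y \<in> span (insert x B)"
    unfolding y_def using PE[of x] sp by (intro span_diff) (auto intro: span_base)
  have Pe: "b (P v) e = b v e" if "e \<in> E" "v \<in> S" for v e
  proof -
    have "b (P v) e = (\<Sum>f\<in>E. b v f * b f e)"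
      unfolding P_def using ES that E(1) by (intro sum_left) auto
    also have "\<dots> = (\<Sum>f\<in>E. if f = e then b v e else 0)"
      using on that by (intro sum.cong) auto
    finally show ?thesis using that E(1) by simp
  qed
  have ye: "b y e = 0" if "e \<in> E" for e
    unfolding y_def using that ES xS PS Pe by (subst diff_left) auto
  have Plin: "P (v + c *\<^sub>R w) = P v + c *\<^sub>R P w" if "v \<in> S" "w \<in> S" for v w c
    using that ES unfolding P_def scaleR_sum_right sum.distrib[symmetric]
    by (intro sum.cong refl) (auto simp: lin scaleR_add_left)
  \<comment> \<open>Writing \<open>v = w + k x\<close> with \<open>w\<close> in
    \<open>span B\<close>, linearity of \<open>P\<close> gives
    \<open>v - k y - P v = w - P w\<close>, a null vector by the induction hypothesis.\<close>
  have decomp: "\<exists>k r. v - k *\<^sub>R y - P v = r \<and> r \<in> S \<and> b r r = 0" if v: "v \<in> span (insert x B)" for v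
  proof -
    obtain k where k: "v - k *\<^sub>R x \<in> span B"
      using v span_breakdown_eq by blast
    define w where "w = v - k *\<^sub>R x"
    have wS: "w \<in> S" using k S by (auto simp: w_def)
    have "P v = P w + k *\<^sub>R P x"
      using Plin[OF wS xS, of k] by (simp add: w_def)
    then have "v - k *\<^sub>R y - P v = w - P w"
      by (simp add: w_def y_def algebra_simps)
    moreover have "w - P w \<in> S" using wS PS by (simp add: subspace_diff subspace_S)
    moreover have "b (w - P w) (w - P w) = 0" using res[of w] k by (simp add: P_def w_def)
    ultimately show ?thesis by metis
  qed
  have vS: "v \<in> S" if "v \<in> span (insert x B)" for v using that S by blast
  show ?case
  proof (cases "b y y = 0")
    case True
    have "b (v - P v) (v - P v) = 0" if v: "v \<in> span (insert x B)" for v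
    proof -
      obtain k r where r: "v - k *\<^sub>R y - P v = r" "r \<in> S" "b r r = 0"
        using decomp[OF v] by blast
      then have "v - P v = r + k *\<^sub>R y" by (auto simp: algebra_simps)
      then show ?thesis using quad[OF r(2) yS, of k] r(3) True null[OF r(2) yS] by simp
    qed
    then show ?thesis using E on sp unfolding P_def
      by (intro exI[of _ E]) auto
  next
    case False
    then have pos: "b y y > 0" using nonneg[OF yS] by simp
    define e0 where "e0 = (1 / sqrt (b y y)) *\<^sub>R y"
    have e0S: "e0 \<in> S" using yS by (simp add: e0_def subspace_scale subspace_S)
    have b0: "b e0 w = b y w / sqrt (b y y)" if "w \<in> S" for w
      using lin[OF subspace_0[OF subspace_S] yS that, of "1 / sqrt (b y y)"] that by (simp add: e0_def)
    have bw0: "b w e0 = b y w / sqrt (b y y)" if "w \<in> S" for w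
      using b0[OF that] sym[OF that e0S] by simp
    have e00: "b e0 e0 = 1"
      using b0[OF e0S] bw0[OF yS] pos by (simp add: field_simps)
    have e0e: "b e0 e = 0" "b e e0 = 0" if "e \<in> E" for e
      using that ye ES b0 bw0 by auto
    have e0E: "e0 \<notin> E" using e0e e00 by fastforce
    have "b (v - (\<Sum>e\<in>insert e0 E. b v e *\<^sub>R e)) (v - (\<Sum>e\<in>insert e0 E. b v e *\<^sub>R e)) = 0"
      if v: "v \<in> span (insert x B)" for v
    proof -
      obtain k r where r: "v - k *\<^sub>R y - P v = r" "r \<in> S" "b r r = 0"
        using decomp[OF v] by blast
      have Py: "b (P v) y = 0"
      proof -
        have "b (P v) y = (\<Sum>f\<in>E. b v f * b f y)"
          unfolding P_def using ES yS E(1) by (intro sum_left) auto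
        also have "\<dots> = 0" using ye sym ES yS by (intro sum.neutral) (auto simp: subset_iff)
        finally show ?thesis .
      qed
      have "v = r + P v + k *\<^sub>R y" using r(1) by (auto simp: algebra_simps)
      moreover have "r + P v \<in> S" using r(2) PS by (simp add: subspace_add subspace_S)
      ultimately have "b v y = b (r + P v) y + k * b y y"
        using lin[of "r + P v" y y k] yS by simp
      also have "b (r + P v) y = b r y + b (P v) y"
        using lin[of r "P v" y 1] r(2) PS yS by simp
      finally have "b v y = k * b y y" using null[OF r(2) yS r(3)] Py by simp
      \<comment> \<open>Up to normalization, the scalar \<open>k\<close> of the decomposition is
        thus the coefficient of \<open>v\<close> along \<open>e0\<close>, so the new residual is
        exactly the null vector \<open>r\<close>.\<close>
      then have "b v e0 = k * sqrt (b y y)"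
        using bw0[OF vS[OF v]] sym[OF yS vS[OF v]] pos
        by (simp add: real_div_sqrt flip: times_divide_eq_right)
      then have "b v e0 *\<^sub>R e0 = k *\<^sub>R y" using pos by (simp add: e0_def)
      then have "v - (\<Sum>e\<in>insert e0 E. b v e *\<^sub>R e) = r"
        using r(1) E(1) e0E by (simp add: P_def algebra_simps)
      then show ?thesis using r(3) by simp
    qed
    moreover have "e0 \<in> span (insert x B)"
      using yspan by (simp add: e0_def span_scale)
    ultimately show ?thesis using E on e0e e00 sp
      using e0E by (intro exI[of _ "insert e0 E"]) auto
  qed
qed

text \<open>The representer is the sum of the vectors \<open>l e *\<^sub>R e\<close> over an
  orthonormal system. Every \<open>v\<close> differs from its projection by a null vector, on which
  \<open>l\<close> vanishes by \<open>l0\<close>, so checking projections suffices.\<close>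

lemma Riesz:
  assumes "finite B" "B \<subseteq> S"
    and l: "\<And>u v c. u \<in> span B \<Longrightarrow> v \<in> span B \<Longrightarrow> l (u + c *\<^sub>R v) = l u + c * l v"
    and l0: "\<And>v. v \<in> span B \<Longrightarrow> b v v = 0 \<Longrightarrow> l v = (0::real)"
  shows "\<exists>u\<in>span B. \<forall>v\<in>span B. b u v = l v"
proof -
  have sub: "span B \<subseteq> S" using assms(2) subspace_S by (simp add: span_minimal)
  obtain E where E: "finite E" "E \<subseteq> span B"
    and res: "\<And>v. v \<in> span B \<Longrightarrow> b (v - (\<Sum>e\<in>E. b v e *\<^sub>R e)) (v - (\<Sum>e\<in>E. b v e *\<^sub>R e)) = 0"
    using orthonormal_basis[OF assms(1,2)] by blast
  have l_zero: "l 0 = 0" using l[of 0 0 1] by (simp add: span_zero)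
  have lsum: "l (\<Sum>e\<in>F. c e *\<^sub>R e) = (\<Sum>e\<in>F. c e * l e)" if "finite F" "F \<subseteq> span B" for F c
    using that
  proof (induction F rule: finite_induct)
    case (insert e F)
    have "l ((\<Sum>e\<in>F. c e *\<^sub>R e) + c e *\<^sub>R e) = l (\<Sum>e\<in>F. c e *\<^sub>R e) + c e * l e"
      using insert.prems by (intro l span_sum span_scale) auto
    with insert show ?case by (simp add: add.commute)
  qed (simp add: l_zero)
  let ?u = "\<Sum>e\<in>E. l e *\<^sub>R e"
  have "b ?u v = l v" if v: "v \<in> span B" for v
  proof -
    let ?s = "\<Sum>e\<in>E. b v e *\<^sub>R e"
    have s: "?s \<in> span B" using E(2) by (intro span_sum span_scale) auto
    have "l (v + (- 1) *\<^sub>R ?s) = l v + (- 1) * l ?s" by (rule l[OF v s])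
    moreover have "l (v + (- 1) *\<^sub>R ?s) = 0"
      using res[OF v] v s by (intro l0) (auto intro: span_diff)
    ultimately have "l v = (\<Sum>e\<in>E. b v e * l e)" using lsum[OF E, of "b v"] by simp
    also have "\<dots> = b ?u v"
      using E v sub sym by (subst sum_left) (auto simp: subset_iff mult.commute intro!: sum.cong)
    finally show ?thesis by simp
  qed
  moreover have "?u \<in> span B" using E(2) by (intro span_sum span_scale) auto
  ultimately show ?thesis by blast
qed

text \<open>Comparison of seminorms in finite dimension: up to null vectors \<open>v\<close> is its
  projection, whose coefficients are bounded by \<open>sqrt (b v v)\<close>. The constant is the sum
  of \<open>p e\<close> over an orthonormal system.\<close>

lemma seminorm_bound:
  assumes "finite B" "B \<subseteq> S"
    and p: "\<And>u v c. u \<in> span B \<Longrightarrow> v \<in> span B \<Longrightarrow> p (u + c *\<^sub>R v) \<le> p u + \<bar>c\<bar> * p v"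
    and p_nonneg: "\<And>v. v \<in> span B \<Longrightarrow> (0::real) \<le> p v"
    and p0: "\<And>v. v \<in> span B \<Longrightarrow> b v v = 0 \<Longrightarrow> p v = 0"
  shows "\<exists>C\<ge>0. \<forall>v\<in>span B. p v \<le> C * sqrt (b v v)"
proof -
  have sub: "span B \<subseteq> S" using assms(2) subspace_S by (simp add: span_minimal)
  obtain E where E: "finite E" "E \<subseteq> span B"
    and on: "\<And>e f. e \<in> E \<Longrightarrow> f \<in> E \<Longrightarrow> b e f = (if e = f then 1 else 0)"
    and res: "\<And>v. v \<in> span B \<Longrightarrow> b (v - (\<Sum>e\<in>E. b v e *\<^sub>R e)) (v - (\<Sum>e\<in>E. b v e *\<^sub>R e)) = 0"
    using orthonormal_basis[OF assms(1,2)] by blast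
  have p_zero: "p 0 = 0" using p0[of 0] subspace_0[OF subspace_S] by (simp add: span_zero)
  have psum: "p (\<Sum>e\<in>F. c e *\<^sub>R e) \<le> (\<Sum>e\<in>F. \<bar>c e\<bar> * p e)" if "finite F" "F \<subseteq> span B" for F c
    using that
  proof (induction F rule: finite_induct)
    case (insert e F)
    have "p ((\<Sum>e\<in>F. c e *\<^sub>R e) + c e *\<^sub>R e) \<le> p (\<Sum>e\<in>F. c e *\<^sub>R e) + \<bar>c e\<bar> * p e"
      using insert.prems by (intro p span_sum span_scale) auto
    with insert show ?case by (simp add: add.commute)
  qed (simp add: p_zero)
  have "p v \<le> (\<Sum>e\<in>E. p e) * sqrt (b v v)" if v: "v \<in> span B" for v
  proof -
    let ?s = "\<Sum>e\<in>E. b v e *\<^sub>R e"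
    have s: "?s \<in> span B" using E(2) by (intro span_sum span_scale) auto
    have "p (v - ?s) = 0" using res[OF v] v s by (intro p0) (auto intro: span_diff)
    moreover have "p ((v - ?s) + 1 *\<^sub>R ?s) \<le> p (v - ?s) + \<bar>1\<bar> * p ?s"
      using v s by (intro p) (auto intro: span_diff)
    ultimately have "p v \<le> p ?s" by simp
    also have "\<dots> \<le> (\<Sum>e\<in>E. \<bar>b v e\<bar> * p e)" by (rule psum[OF E])
    also have "\<dots> \<le> (\<Sum>e\<in>E. sqrt (b v v) * p e)"
    proof (intro sum_mono mult_right_mono)
      fix e assume e: "e \<in> E"
      then show "0 \<le> p e" using E p_nonneg by blast
      have "e \<in> S" "v \<in> S" using e E v sub by auto
      then show "\<bar>b v e\<bar> \<le> sqrt (b v v)" using abs_le[of v e] on[OF e e] by simp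
    qed
    finally show ?thesis by (simp add: sum_distrib_right mult.commute)
  qed
  moreover have "0 \<le> (\<Sum>e\<in>E. p e)" using E p_nonneg by (intro sum_nonneg) auto
  ultimately show ?thesis by blast
qed

end

section \<open>Square integrable functions\<close>

lemma L2_spaceD [dest]:
  assumes "f \<in> L2_space M"
  shows "f \<in> borel_measurable M" "integrable M (\<lambda>x. (norm (f x))\<^sup>2)"
  using assms by (auto simp: L2_space_def)

lemma L2_integrable_inner:
  assumes "f \<in> L2_space M" "g \<in> L2_space M"
  shows "integrable M (\<lambda>x. f x \<bullet> g x)"
proof (rule Bochner_Integration.integrable_bound)
  have [measurable]: "f \<in> borel_measurable M" "g \<in> borel_measurable M" using assms by auto
  show "(\<lambda>x. f x \<bullet> g x) \<in> borel_measurable M" by measurable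
  show "integrable M (\<lambda>x. (norm (f x))\<^sup>2 + (norm (g x))\<^sup>2)" using assms by auto
  have "\<bar>f x \<bullet> g x\<bar> \<le> (norm (f x))\<^sup>2 + (norm (g x))\<^sup>2" for x
  proof -
    have "\<bar>f x \<bullet> g x\<bar> \<le> norm (f x) * norm (g x)" by (rule Cauchy_Schwarz_ineq2)
    also have "\<dots> \<le> (norm (f x))\<^sup>2 + (norm (g x))\<^sup>2"
      using sum_squares_bound[of "norm (f x)" "norm (g x)"] mult_nonneg_nonneg[OF norm_ge_zero[of "f x"] norm_ge_zero[of "g x"]]
      by linarith
    finally show ?thesis .
  qed
  then show "AE x in M. norm (f x \<bullet> g x) \<le> norm ((norm (f x))\<^sup>2 + (norm (g x))\<^sup>2)"
    by simp
qed

lemma L2_zero [simp]: "0 \<in> L2_space M"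
  by (simp add: L2_space_def zero_fun_def)

lemma L2_comb:
  assumes "f \<in> L2_space M" "g \<in> L2_space M"
  shows "f + c *\<^sub>R g \<in> L2_space M"
proof -
  have [measurable]: "f \<in> borel_measurable M" "g \<in> borel_measurable M" using assms by auto
  have eq: "f + c *\<^sub>R g = (\<lambda>x. f x + c *\<^sub>R g x)" by (auto simp: fun_eq_iff)
  have "(norm (f x + c *\<^sub>R g x))\<^sup>2 = (norm (f x))\<^sup>2 + 2 * c * (f x \<bullet> g x) + c\<^sup>2 * (norm (g x))\<^sup>2" for x
    unfolding power2_norm_eq_inner
    by (simp add: inner_add_left inner_add_right inner_commute power2_eq_square algebra_simps)
  then show ?thesis
    unfolding eq L2_space_def using assms L2_integrable_inner[OF assms]
    by (auto intro!: Bochner_Integration.integrable_add)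
qed

lemma L2_subspace: "subspace (L2_space M)"
proof -
  have "f + g \<in> L2_space M" if "f \<in> L2_space M" "g \<in> L2_space M" for f g :: "'a \<Rightarrow> 'b"
    using L2_comb[OF that, of 1] by simp
  moreover have "c *\<^sub>R f \<in> L2_space M" if "f \<in> L2_space M" for f :: "'a \<Rightarrow> 'b" and c
    using L2_comb[OF L2_zero that, of c] by simp
  ultimately show ?thesis by (simp add: subspace_def)
qed

interpretation L2: semi_inner "L2_space M" "\<lambda>f g. \<integral>x. f x \<bullet> g x \<partial>M" for M
proof (unfold_locales; (rule L2_subspace)?)
  fix u v w :: "'a \<Rightarrow> 'b" and c assume "u \<in> L2_space M" "v \<in> L2_space M" "w \<in> L2_space M"
  then show "(\<integral>x. (u + c *\<^sub>R v) x \<bullet> w x \<partial>M) = (\<integral>x. u x \<bullet> w x \<partial>M) + c * (\<integral>x. v x \<bullet> w x \<partial>M)"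
    using L2_integrable_inner[of u M w] L2_integrable_inner[of v M w] by (simp add: inner_add_left)
qed (auto simp: inner_commute)

lemma L2_norm_nonneg [simp]: "0 \<le> L2_norm M f"
  by (simp add: L2_norm_def)

lemma L2_norm_eq_0:
  assumes "f \<in> L2_space M" "L2_norm M f = 0"
  shows "AE x in M. f x = 0"
  using assms integral_nonneg_eq_0_iff_AE[of M "\<lambda>x. (norm (f x))\<^sup>2"]
  by (auto simp: L2_norm_def)

text \<open>The integrand is dominated by \<open>A\<close> times the product of the scalar functions
  \<open>norm (f x)\<close> and \<open>norm (g x)\<close>, to which Cauchy-Schwarz applies.\<close>

lemma L2_weighted_bound:
  fixes f g :: "'a \<Rightarrow> 'b::euclidean_space"
  assumes f: "f \<in> L2_space M" and g: "g \<in> L2_space M"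
    and a: "AE x in M. \<bar>a x\<bar> \<le> A" "a \<in> borel_measurable M" and "0 \<le> A"
  shows "integrable M (\<lambda>x. a x * (f x \<bullet> g x))"
    and "\<bar>\<integral>x. a x * (f x \<bullet> g x) \<partial>M\<bar> \<le> A * (L2_norm M f * L2_norm M g)"
proof -
  have [measurable]: "f \<in> borel_measurable M" "g \<in> borel_measurable M" "a \<in> borel_measurable M"
    using assms by auto
  have nf: "(\<lambda>x. norm (f x)) \<in> L2_space M" and ng: "(\<lambda>x. norm (g x)) \<in> L2_space M"
    using f g by (auto simp: L2_space_def)
  have int: "integrable M (\<lambda>x. A * (norm (f x) * norm (g x)))"
    using L2_integrable_inner[OF nf ng] by simp
  have bound: "AE x in M. \<bar>a x * (f x \<bullet> g x)\<bar> \<le> A * (norm (f x) * norm (g x))"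
    using a(1)
    by eventually_elim (auto simp: abs_mult intro!: mult_mono Cauchy_Schwarz_ineq2 \<open>0 \<le> A\<close>)
  show 1: "integrable M (\<lambda>x. a x * (f x \<bullet> g x))"
    by (rule Bochner_Integration.integrable_bound[OF int]) (use bound in auto)
  have "\<bar>\<integral>x. a x * (f x \<bullet> g x) \<partial>M\<bar> \<le> (\<integral>x. \<bar>a x * (f x \<bullet> g x)\<bar> \<partial>M)"
    by (rule integral_abs_bound)
  also have "\<dots> \<le> (\<integral>x. A * (norm (f x) * norm (g x)) \<partial>M)"
    using 1 int bound by (intro integral_mono_AE) auto
  also have "\<dots> = A * (\<integral>x. norm (f x) * norm (g x) \<partial>M)" by simp
  also have "(\<integral>x. norm (f x) * norm (g x) \<partial>M) \<le> L2_norm M f * L2_norm M g"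
    using L2.abs_le[OF nf ng] by (simp add: L2_norm_def power2_eq_square)
  finally show "\<bar>\<integral>x. a x * (f x \<bullet> g x) \<partial>M\<bar> \<le> A * (L2_norm M f * L2_norm M g)"
    using \<open>0 \<le> A\<close> by (simp add: mult_left_mono)
qed

section \<open>The Sobolev space\<close>

lemma measurable_lebesgue_on_borel:
  assumes "f \<in> borel_measurable borel"
  shows "f \<in> borel_measurable (lebesgue_on S)"
  using assms by (intro measurable_restrict_space1 measurable_completion) simp

lemma AE_lebesgue_on_if_AE_lborel:
  assumes "S \<in> sets lebesgue" "AE x in lborel. x \<in> S \<longrightarrow> P x"
  shows "AE x in lebesgue_on S. P x"
  using assms by (simp add: AE_restrict_space_iff AE_completion_iff)

text \<open>The function spaces live on the completed measure restricted to the domain, whereas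
  Fubini and translations are used on \<open>lborel\<close>. Here \<open>w\<close> is a Borel
  version of the extension of \<open>v\<close> by 0.\<close>

lemma lebesgue_on_ex_lborel:
  fixes v :: "'a::euclidean_space \<Rightarrow> real"
  assumes S: "S \<in> sets lebesgue" and v: "integrable (lebesgue_on S) v"
  obtains w where "integrable lborel w" "AE x in lborel. x \<in> S \<longrightarrow> v x = w x"
    "\<And>g. g \<in> borel_measurable borel \<Longrightarrow> (\<integral>x. v x * g x \<partial>lebesgue_on S) = (\<integral>x. w x * g x \<partial>lborel)"
proof -
  have iv: "integrable lebesgue (\<lambda>x. indicator S x *\<^sub>R v x)"
    using v S by (subst (asm) integrable_restrict_space) auto
  then have mv: "(\<lambda>x. indicator S x *\<^sub>R v x) \<in> borel_measurable lebesgue" by blast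
  then obtain w where w: "w \<in> borel_measurable lborel" "AE x in lborel. indicator S x *\<^sub>R v x = w x"
    using completion_ex_borel_measurable_real by blast
  have AE: "AE x in lebesgue. indicator S x *\<^sub>R v x = w x"
    using w(2) by (simp add: AE_completion_iff)
  have wl: "f \<in> borel_measurable lebesgue" if "f \<in> borel_measurable borel" for f :: "'a \<Rightarrow> real"
    using that by (intro measurable_completion) simp
  have wb: "w \<in> borel_measurable lebesgue" by (rule wl) (use w(1) in simp)
  have "integrable lebesgue w"
    by (rule Bochner_Integration.integrable_cong_AE_imp[OF iv wb AE])
  then have "integrable lborel w"
    using integrable_completion[OF w(1)] by simp
  moreover have "AE x in lborel. x \<in> S \<longrightarrow> v x = w x"
    using w(2) by eventually_elim auto
  moreover have "(\<integral>x. v x * g x \<partial>lebesgue_on S) = (\<integral>x. w x * g x \<partial>lborel)"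
    if g: "g \<in> borel_measurable borel" for g
  proof -
    have [measurable]: "g \<in> borel_measurable lebesgue" "w \<in> borel_measurable lebesgue"
      "g \<in> borel_measurable borel" "w \<in> borel_measurable borel"
      using g w(1) by (auto intro: wl)
    have "(\<integral>x. v x * g x \<partial>lebesgue_on S) = (\<integral>x. indicator S x *\<^sub>R v x * g x \<partial>lebesgue)"
      using S by (subst integral_restrict_space) (auto simp: mult.assoc)
    also have "\<dots> = (\<integral>x. w x * g x \<partial>lebesgue)"
    proof (rule integral_cong_AE)
      show "(\<lambda>x. indicator S x *\<^sub>R v x * g x) \<in> borel_measurable lebesgue"
        using mv by (intro borel_measurable_times) auto
      show "AE x in lebesgue. indicator S x *\<^sub>R v x * g x = w x * g x"
        using AE by eventually_elim simp
    qed simp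
    also have "\<dots> = (\<integral>x. w x * g x \<partial>lborel)"
      by (rule integral_completion) measurable
    finally show ?thesis .
  qed
  ultimately show thesis using that by blast
qed

lemma test_function_partial:
  assumes "\<phi> \<in> test_functions \<Omega>"
  obtains B where "(\<lambda>x. frechet_derivative \<phi> (at x) i) \<in> borel_measurable borel"
    "\<And>x. \<bar>frechet_derivative \<phi> (at x) i\<bar> \<le> B"
proof -
  obtain G K where G: "\<And>x. (\<phi> has_derivative (\<lambda>h. G x \<bullet> h)) (at x)" "continuous_on UNIV G"
    "compact K" "\<And>x. x \<notin> K \<Longrightarrow> G x = 0"
    using test_function_gradient[OF assms] by metis
  obtain B where B: "\<And>x. norm (G x) \<le> B"
    using continuous_compact_support_bounded[OF G(2,3,4)] by metis
  have eq: "frechet_derivative \<phi> (at x) = (\<lambda>h. G x \<bullet> h)" for x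
    using frechet_derivative_at[OF G(1)] by simp
  have [measurable]: "G \<in> borel_measurable borel"
    by (rule borel_measurable_continuous_onI[OF G(2)])
  show thesis
  proof (rule that)
    show "(\<lambda>x. frechet_derivative \<phi> (at x) i) \<in> borel_measurable borel"
      unfolding eq by measurable
    show "\<bar>frechet_derivative \<phi> (at x) i\<bar> \<le> B * norm i" for x
      unfolding eq by (rule order_trans[OF Cauchy_Schwarz_ineq2 mult_right_mono[OF B norm_ge_zero]])
  qed
qed

locale bounded_domain =
  fixes \<Omega> :: "'a::euclidean_space set"
  assumes open_dom: "open \<Omega>" and bounded_dom: "bounded \<Omega>" and connected_dom: "connected \<Omega>"
begin

abbreviation "LM \<equiv> lebesgue_on \<Omega>"
abbreviation "wg \<equiv> weak_gradient \<Omega>"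

lemma dom_sets: "\<Omega> \<in> sets lebesgue"
  using open_dom by simp

lemma finite_LM: "finite_measure LM"
  using bounded_dom dom_sets by (intro finite_measure_lebesgue_on) (simp add: bounded_set_imp_lmeasurable)

lemma L2_integrable:
  assumes "f \<in> L2_space LM"
  shows "integrable LM (f :: 'a \<Rightarrow> real)"
proof -
  have "(\<lambda>x. 1 :: real) \<in> L2_space LM"
    using finite_measure.integrable_const[OF finite_LM, of "1::real"] by (simp add: L2_space_def)
  from L2_integrable_inner[OF assms this] show ?thesis by simp
qed

lemma L2_component:
  assumes "G \<in> L2_space LM"
  shows "(\<lambda>x. G x \<bullet> i) \<in> L2_space LM"
proof -
  have [measurable]: "G \<in> borel_measurable LM" using assms by auto
  have "integrable LM (\<lambda>x. (G x \<bullet> i)\<^sup>2)"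
  proof (rule Bochner_Integration.integrable_bound)
    show "integrable LM (\<lambda>x. (norm i)\<^sup>2 * (norm (G x))\<^sup>2)" using assms by auto
    have "(G x \<bullet> i)\<^sup>2 \<le> (norm i)\<^sup>2 * (norm (G x))\<^sup>2" for x
      using power_mono[OF Cauchy_Schwarz_ineq2 abs_ge_zero, of "G x" i 2]
      by (simp add: power_mult_distrib mult.commute)
    then show "AE x in LM. norm ((G x \<bullet> i)\<^sup>2) \<le> norm ((norm i)\<^sup>2 * (norm (G x))\<^sup>2)" by simp
  qed simp
  then show ?thesis by (simp add: L2_space_def)
qed

lemma test_function_LM:
  assumes "\<phi> \<in> test_functions \<Omega>"
  obtains B where "\<phi> \<in> borel_measurable LM" "\<And>x. \<bar>\<phi> x\<bar> \<le> B"
  using test_function_bounded[OF assms]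
    measurable_lebesgue_on_borel[OF Ck_fun_measurable[OF test_function_Ck[OF assms]]] by metis

lemma integrable_partial:
  assumes "v \<in> L2_space LM" "\<phi> \<in> test_functions \<Omega>"
  shows "integrable LM (\<lambda>x. v x * frechet_derivative \<phi> (at x) i)"
proof -
  obtain B where "(\<lambda>x. frechet_derivative \<phi> (at x) i) \<in> borel_measurable borel"
    "\<And>x. \<bar>frechet_derivative \<phi> (at x) i\<bar> \<le> B"
    using test_function_partial[OF assms(2)] by blast
  then show ?thesis
    by (intro integrable_mult_bounded[OF L2_integrable[OF assms(1)]] measurable_lebesgue_on_borel)
qed

lemma integrable_component:
  assumes "G \<in> L2_space LM" "\<phi> \<in> test_functions \<Omega>"
  shows "integrable LM (\<lambda>x. (G x \<bullet> i) * \<phi> x)"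
proof -
  obtain B where "\<phi> \<in> borel_measurable LM" "\<And>x. \<bar>\<phi> x\<bar> \<le> B"
    using test_function_LM[OF assms(2)] by blast
  then show ?thesis
    by (intro integrable_mult_bounded[OF L2_integrable[OF L2_component[OF assms(1)]]])
qed

lemma fundamental_lemma_dom:
  fixes f :: "'a \<Rightarrow> real"
  assumes "integrable LM f" "\<And>\<phi>. \<phi> \<in> test_functions \<Omega> \<Longrightarrow> (\<integral>x. f x * \<phi> x \<partial>LM) = 0"
  shows "AE x in LM. f x = 0"
proof -
  obtain w where w: "integrable lborel w" "AE x in lborel. x \<in> \<Omega> \<longrightarrow> f x = w x"
    "\<And>g. g \<in> borel_measurable borel \<Longrightarrow> (\<integral>x. f x * g x \<partial>LM) = (\<integral>x. w x * g x \<partial>lborel)"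
    using lebesgue_on_ex_lborel[OF dom_sets assms(1)] by blast
  have "AE x in lborel. x \<in> \<Omega> \<longrightarrow> w x = 0"
  proof (rule fundamental_lemma_variations[OF w(1) open_dom])
    fix \<phi> assume \<phi>: "\<phi> \<in> test_functions \<Omega>"
    then show "(\<integral>x. w x * \<phi> x \<partial>lborel) = 0"
      using w(3)[OF Ck_fun_measurable[OF test_function_Ck[OF \<phi>]]] assms(2) by simp
  qed
  with w(2) have "AE x in lborel. x \<in> \<Omega> \<longrightarrow> f x = 0" by eventually_elim auto
  then show ?thesis by (rule AE_lebesgue_on_if_AE_lborel[OF dom_sets])
qed

text \<open>Since \<open>weak_gradient\<close> is a choice, this is what determines it up to null
  sets and makes it linear almost everywhere. Each coordinate of the difference is annihilated by
  all test functions.\<close>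

lemma weak_gradient_unique:
  assumes "G \<in> L2_space LM" "is_weak_gradient \<Omega> v G" "G' \<in> L2_space LM" "is_weak_gradient \<Omega> v G'"
  shows "AE x in LM. G x = G' x"
proof -
  have "AE x in LM. \<forall>i\<in>Basis. G x \<bullet> i - G' x \<bullet> i = 0"
  proof (rule AE_finite_allI)
    fix i :: 'a assume i: "i \<in> Basis"
    show "AE x in LM. G x \<bullet> i - G' x \<bullet> i = 0"
    proof (rule fundamental_lemma_dom)
      show "integrable LM (\<lambda>x. G x \<bullet> i - G' x \<bullet> i)"
        using assms by (intro Bochner_Integration.integrable_diff L2_integrable L2_component)
      fix \<phi> assume \<phi>: "\<phi> \<in> test_functions \<Omega>"
      have "(\<integral>x. (G x \<bullet> i - G' x \<bullet> i) * \<phi> x \<partial>LM) = (\<integral>x. (G x \<bullet> i) * \<phi> x \<partial>LM) - (\<integral>x. (G' x \<bullet> i) * \<phi> x \<partial>LM)"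
        using integrable_component[OF assms(1) \<phi>, of i] integrable_component[OF assms(3) \<phi>, of i]
        by (simp add: left_diff_distrib)
      also have "\<dots> = 0"
      proof -
        have "(\<integral>x. v x * frechet_derivative \<phi> (at x) i \<partial>LM) = - (\<integral>x. (G x \<bullet> i) * \<phi> x \<partial>LM)"
          "(\<integral>x. v x * frechet_derivative \<phi> (at x) i \<partial>LM) = - (\<integral>x. (G' x \<bullet> i) * \<phi> x \<partial>LM)"
          using assms(2,4) \<phi> i unfolding is_weak_gradient_def by blast+
        then show ?thesis by linarith
      qed
      finally show "(\<integral>x. (G x \<bullet> i - G' x \<bullet> i) * \<phi> x \<partial>LM) = 0" .
    qed
  qed simp
  then show ?thesis by eventually_elim (auto intro: euclidean_eqI)
qed

lemma wg:
  assumes "v \<in> H1_space \<Omega>"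
  shows "wg v \<in> L2_space LM" "is_weak_gradient \<Omega> v (wg v)"
proof -
  have "\<exists>G. G \<in> L2_space LM \<and> is_weak_gradient \<Omega> v G"
    using assms by (auto simp: H1_space_def)
  then have "wg v \<in> L2_space LM \<and> is_weak_gradient \<Omega> v (wg v)"
    unfolding weak_gradient_def by (rule someI_ex)
  then show "wg v \<in> L2_space LM" "is_weak_gradient \<Omega> v (wg v)" by auto
qed

lemma H1_L2: "v \<in> H1_space \<Omega> \<Longrightarrow> v \<in> L2_space LM"
  by (simp add: H1_space_def)

lemma is_weak_gradient_comb:
  assumes "u \<in> L2_space LM" "F \<in> L2_space LM" "is_weak_gradient \<Omega> u F"
    "v \<in> L2_space LM" "G \<in> L2_space LM" "is_weak_gradient \<Omega> v G"
  shows "is_weak_gradient \<Omega> (u + c *\<^sub>R v) (F + c *\<^sub>R G)"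
  unfolding is_weak_gradient_def
proof (intro ballI)
  fix \<phi> and i :: 'a assume \<phi>: "\<phi> \<in> test_functions \<Omega>" and i: "i \<in> Basis"
  have "(\<integral>x. (u + c *\<^sub>R v) x * frechet_derivative \<phi> (at x) i \<partial>LM)
      = (\<integral>x. u x * frechet_derivative \<phi> (at x) i \<partial>LM) + c * (\<integral>x. v x * frechet_derivative \<phi> (at x) i \<partial>LM)"
    using integrable_partial[OF assms(1) \<phi>, of i] integrable_partial[OF assms(4) \<phi>, of i]
    by (simp add: distrib_right mult.assoc)
  also have "\<dots> = - ((\<integral>x. (F x \<bullet> i) * \<phi> x \<partial>LM) + c * (\<integral>x. (G x \<bullet> i) * \<phi> x \<partial>LM))"
  proof -
    have "(\<integral>x. u x * frechet_derivative \<phi> (at x) i \<partial>LM) = - (\<integral>x. (F x \<bullet> i) * \<phi> x \<partial>LM)"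
      "(\<integral>x. v x * frechet_derivative \<phi> (at x) i \<partial>LM) = - (\<integral>x. (G x \<bullet> i) * \<phi> x \<partial>LM)"
      using assms(3,6) \<phi> i unfolding is_weak_gradient_def by blast+
    then show ?thesis by simp
  qed
  also have "(\<integral>x. (F x \<bullet> i) * \<phi> x \<partial>LM) + c * (\<integral>x. (G x \<bullet> i) * \<phi> x \<partial>LM)
      = (\<integral>x. ((F + c *\<^sub>R G) x \<bullet> i) * \<phi> x \<partial>LM)"
    using integrable_component[OF assms(2) \<phi>, of i] integrable_component[OF assms(5) \<phi>, of i]
    by (simp add: inner_add_left distrib_right mult.assoc)
  finally show "(\<integral>x. (u + c *\<^sub>R v) x * frechet_derivative \<phi> (at x) i \<partial>LM)
      = - (\<integral>x. ((F + c *\<^sub>R G) x \<bullet> i) * \<phi> x \<partial>LM)" .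
qed

lemma H1_zero: "0 \<in> H1_space \<Omega>"
proof -
  have "is_weak_gradient \<Omega> 0 0" by (simp add: is_weak_gradient_def)
  then show ?thesis unfolding H1_space_def by (auto intro!: bexI[of _ 0])
qed

lemma H1_comb:
  assumes "u \<in> H1_space \<Omega>" "v \<in> H1_space \<Omega>"
  shows "u + c *\<^sub>R v \<in> H1_space \<Omega>"
  using is_weak_gradient_comb[OF H1_L2[OF assms(1)] wg[OF assms(1)] H1_L2[OF assms(2)] wg[OF assms(2)], of c]
    L2_comb[OF H1_L2[OF assms(1)] H1_L2[OF assms(2)], of c]
    L2_comb[OF wg(1)[OF assms(1)] wg(1)[OF assms(2)], of c]
  by (auto simp: H1_space_def)

lemma H1_subspace: "subspace (H1_space \<Omega>)"
proof -
  have "u + v \<in> H1_space \<Omega>" if "u \<in> H1_space \<Omega>" "v \<in> H1_space \<Omega>" for u v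
    using H1_comb[OF that, of 1] by simp
  moreover have "c *\<^sub>R v \<in> H1_space \<Omega>" if "v \<in> H1_space \<Omega>" for v c
    using H1_comb[OF H1_zero that, of c] by simp
  ultimately show ?thesis using H1_zero by (simp add: subspace_def)
qed

lemma wg_comb:
  assumes "u \<in> H1_space \<Omega>" "v \<in> H1_space \<Omega>"
  shows "AE x in LM. wg (u + c *\<^sub>R v) x = wg u x + c *\<^sub>R wg v x"
  using weak_gradient_unique[OF wg[OF H1_comb[OF assms, of c]]
      L2_comb[OF wg(1)[OF assms(1)] wg(1)[OF assms(2)], of c]
      is_weak_gradient_comb[OF H1_L2[OF assms(1)] wg[OF assms(1)] H1_L2[OF assms(2)] wg[OF assms(2)], of c]]
  by simp

section \<open>The weighted Dirichlet form\<close>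

definition form :: "('a \<Rightarrow> real) \<Rightarrow> ('a \<Rightarrow> real) \<Rightarrow> ('a \<Rightarrow> real) \<Rightarrow> real" where
  "form a u v = (\<integral>x. (a x *\<^sub>R wg u x) \<bullet> wg v x \<partial>LM)"

definition grad_norm :: "('a \<Rightarrow> real) \<Rightarrow> real" where
  "grad_norm u = L2_norm LM (wg u)"

lemma grad_norm_nonneg [simp]: "0 \<le> grad_norm u"
  by (simp add: grad_norm_def)

lemma Linf_bound:
  assumes "a \<in> Linf_space LM"
  shows "AE x in LM. \<bar>a x\<bar> \<le> Linf_norm LM a" "0 \<le> Linf_norm LM a" "a \<in> borel_measurable LM"
proof -
  have "esssup LM (\<lambda>x. ennreal \<bar>a x\<bar>) < \<infinity>" using assms by (simp add: Linf_space_def)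
  then have "esssup LM (\<lambda>x. ennreal \<bar>a x\<bar>) = ennreal (Linf_norm LM a)"
    by (simp add: Linf_norm_def)
  moreover have "AE x in LM. ennreal \<bar>a x\<bar> \<le> esssup LM (\<lambda>x. ennreal \<bar>a x\<bar>)"
    by (rule esssup_AE)
  ultimately have "AE x in LM. ennreal \<bar>a x\<bar> \<le> ennreal (Linf_norm LM a)"
    by simp
  then show "AE x in LM. \<bar>a x\<bar> \<le> Linf_norm LM a"
    by eventually_elim (simp add: Linf_norm_def)
  show "0 \<le> Linf_norm LM a" "a \<in> borel_measurable LM"
    using assms by (auto simp: Linf_norm_def Linf_space_def)
qed

lemma Linf_comb:
  assumes "a \<in> Linf_space LM" "b \<in> Linf_space LM"
  shows "a + c *\<^sub>R b \<in> Linf_space LM"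
proof -
  have [measurable]: "a \<in> borel_measurable LM" "b \<in> borel_measurable LM"
    using assms by (auto simp: Linf_space_def)
  have eq: "a + c *\<^sub>R b = (\<lambda>x. a x + c * b x)" by (auto simp: fun_eq_iff)
  have "AE x in LM. ennreal \<bar>a x + c * b x\<bar> \<le> ennreal (Linf_norm LM a + \<bar>c\<bar> * Linf_norm LM b)"
    using Linf_bound(1)[OF assms(1)] Linf_bound(1)[OF assms(2)]
  proof eventually_elim
    fix x assume *: "\<bar>a x\<bar> \<le> Linf_norm LM a" "\<bar>b x\<bar> \<le> Linf_norm LM b"
    have "\<bar>a x + c * b x\<bar> \<le> \<bar>a x\<bar> + \<bar>c\<bar> * \<bar>b x\<bar>"
      using abs_triangle_ineq[of "a x" "c * b x"] by (simp add: abs_mult)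
    also have "\<dots> \<le> Linf_norm LM a + \<bar>c\<bar> * Linf_norm LM b"
      using * by (intro add_mono mult_left_mono) auto
    finally show "ennreal \<bar>a x + c * b x\<bar> \<le> ennreal (Linf_norm LM a + \<bar>c\<bar> * Linf_norm LM b)"
      by (rule ennreal_leI)
  qed
  then have "esssup LM (\<lambda>x. ennreal \<bar>a x + c * b x\<bar>) \<le> ennreal (Linf_norm LM a + \<bar>c\<bar> * Linf_norm LM b)"
    by (intro esssup_I) measurable
  then have "esssup LM (\<lambda>x. ennreal \<bar>a x + c * b x\<bar>) < \<infinity>"
    using ennreal_less_top le_less_trans by (metis infinity_ennreal_def)
  then show ?thesis unfolding eq Linf_space_def by simp
qed

lemma Linf_const: "(\<lambda>x. c) \<in> Linf_space LM"
proof -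
  have "esssup LM (\<lambda>x. ennreal \<bar>c\<bar>) \<le> ennreal \<bar>c\<bar>" by (intro esssup_I) auto
  then have "esssup LM (\<lambda>x. ennreal \<bar>c\<bar>) < \<infinity>"
    using ennreal_less_top le_less_trans by (metis infinity_ennreal_def)
  then show ?thesis by (simp add: Linf_space_def)
qed

lemma form_integrable:
  assumes "a \<in> Linf_space LM" "u \<in> H1_space \<Omega>" "v \<in> H1_space \<Omega>"
  shows "integrable LM (\<lambda>x. (a x *\<^sub>R wg u x) \<bullet> wg v x)"
  using L2_weighted_bound(1)[OF wg(1)[OF assms(2)] wg(1)[OF assms(3)] Linf_bound(1,3,2)[OF assms(1)]]
  by simp

lemma form_bound:
  assumes "a \<in> Linf_space LM" "u \<in> H1_space \<Omega>" "v \<in> H1_space \<Omega>"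
  shows "\<bar>form a u v\<bar> \<le> Linf_norm LM a * (grad_norm u * grad_norm v)"
  using L2_weighted_bound(2)[OF wg(1)[OF assms(2)] wg(1)[OF assms(3)] Linf_bound(1,3,2)[OF assms(1)]]
  by (simp add: form_def grad_norm_def)

lemma form_sym: "form a u v = form a v u"
  by (simp add: form_def inner_commute)

lemma form_comb:
  assumes "a \<in> Linf_space LM" "u \<in> H1_space \<Omega>" "v \<in> H1_space \<Omega>" "w \<in> H1_space \<Omega>"
  shows "form a (u + c *\<^sub>R v) w = form a u w + c * form a v w"
proof -
  have "form a (u + c *\<^sub>R v) w = (\<integral>x. (a x *\<^sub>R wg u x) \<bullet> wg w x + c * ((a x *\<^sub>R wg v x) \<bullet> wg w x) \<partial>LM)"
    unfolding form_def
  proof (rule integral_cong_AE)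
    show "(\<lambda>x. (a x *\<^sub>R wg (u + c *\<^sub>R v) x) \<bullet> wg w x) \<in> borel_measurable LM"
      using form_integrable[OF assms(1) H1_comb[OF assms(2,3)] assms(4)] by blast
    show "(\<lambda>x. (a x *\<^sub>R wg u x) \<bullet> wg w x + c * ((a x *\<^sub>R wg v x) \<bullet> wg w x)) \<in> borel_measurable LM"
      using form_integrable[OF assms(1,2,4)] form_integrable[OF assms(1,3,4)]
      by (intro borel_measurable_add borel_measurable_times) auto
    show "AE x in LM. (a x *\<^sub>R wg (u + c *\<^sub>R v) x) \<bullet> wg w x =
        (a x *\<^sub>R wg u x) \<bullet> wg w x + c * ((a x *\<^sub>R wg v x) \<bullet> wg w x)"
      using wg_comb[OF assms(2,3), of c] by eventually_elim (simp add: inner_add_left algebra_simps)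
  qed
  then show ?thesis
    using form_integrable[OF assms(1,2,4)] form_integrable[OF assms(1,3,4)] by (simp add: form_def)
qed

lemma form_coeff_comb:
  assumes "a \<in> Linf_space LM" "b \<in> Linf_space LM" "u \<in> H1_space \<Omega>" "v \<in> H1_space \<Omega>"
  shows "form (a + c *\<^sub>R b) u v = form a u v + c * form b u v"
  using form_integrable[OF assms(1,3,4)] form_integrable[OF assms(2,3,4)]
  by (simp add: form_def distrib_right mult.assoc)

lemma grad_norm_sq: "(grad_norm u)\<^sup>2 = (\<integral>x. wg u x \<bullet> wg u x \<partial>LM)"
  by (simp add: grad_norm_def L2_norm_def power2_norm_eq_inner)

lemma form_coercive:
  assumes a: "a \<in> admissible \<Omega> amin amax" and u: "u \<in> H1_space \<Omega>"
  shows "amin * (grad_norm u)\<^sup>2 \<le> form a u u"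
proof -
  have aL: "a \<in> Linf_space LM" using a by (simp add: admissible_def)
  have "amin * (grad_norm u)\<^sup>2 = (\<integral>x. amin * (wg u x \<bullet> wg u x) \<partial>LM)"
    by (simp add: grad_norm_sq)
  also have "\<dots> \<le> form a u u"
    unfolding form_def
  proof (rule integral_mono_AE)
    show "integrable LM (\<lambda>x. amin * (wg u x \<bullet> wg u x))"
      using L2_integrable_inner[OF wg(1)[OF u] wg(1)[OF u]] by simp
    show "integrable LM (\<lambda>x. (a x *\<^sub>R wg u x) \<bullet> wg u x)" by (rule form_integrable[OF aL u u])
    have "AE x in LM. amin \<le> a x" using a by (auto simp: admissible_def)
    then show "AE x in LM. amin * (wg u x \<bullet> wg u x) \<le> (a x *\<^sub>R wg u x) \<bullet> wg u x"
      by eventually_elim (simp add: mult_right_mono)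
  qed
  finally show ?thesis .
qed

lemma semi_inner_form:
  assumes "a \<in> Linf_space LM" "\<And>u. u \<in> H1_space \<Omega> \<Longrightarrow> 0 \<le> form a u u"
  shows "semi_inner (H1_space \<Omega>) (form a)"
  by (unfold_locales; (rule form_sym)?) (use assms in \<open>auto simp: H1_subspace form_comb\<close>)

lemma form_one: "form (\<lambda>x. 1) u u = (grad_norm u)\<^sup>2"
  by (simp add: form_def grad_norm_sq)

lemma semi_inner_grad: "semi_inner (H1_space \<Omega>) (form (\<lambda>x. 1))"
  by (rule semi_inner_form[OF Linf_const]) (simp add: form_one)

text \<open>This form polarizes the square of \<open>H1_norm\<close>, which thereby inherits the
  abstract triangle inequality.\<close>

lemma semi_inner_H1: "semi_inner (H1_space \<Omega>) (\<lambda>u v. (\<integral>x. u x * v x \<partial>LM) + form (\<lambda>x. 1) u v)"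
proof
  fix u v w c assume "u \<in> H1_space \<Omega>" "v \<in> H1_space \<Omega>" "w \<in> H1_space \<Omega>"
  then show "(\<integral>x. (u + c *\<^sub>R v) x * w x \<partial>LM) + form (\<lambda>x. 1) (u + c *\<^sub>R v) w =
     (\<integral>x. u x * w x \<partial>LM) + form (\<lambda>x. 1) u w + c * ((\<integral>x. v x * w x \<partial>LM) + form (\<lambda>x. 1) v w)"
    using form_comb[OF Linf_const, of u v w 1 c]
      L2_integrable_inner[OF H1_L2 H1_L2, of u w] L2_integrable_inner[OF H1_L2 H1_L2, of v w]
    by (simp add: algebra_simps)
next
  fix u assume "u \<in> H1_space \<Omega>"
  show "0 \<le> (\<integral>x. u x * u x \<partial>LM) + form (\<lambda>x. 1) u u"
    by (simp add: form_one)
qed (auto simp: H1_subspace form_sym mult.commute)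

lemma H1_norm_eq: "H1_norm \<Omega> u = sqrt ((\<integral>x. u x * u x \<partial>LM) + form (\<lambda>x. 1) u u)"
  by (simp add: H1_norm_def form_one grad_norm_def L2_norm_def[of _ u] power2_eq_square)

lemma H1_norm_nonneg: "0 \<le> H1_norm \<Omega> u"
  by (simp add: H1_norm_def)

lemma H1_norm_comb:
  assumes "u \<in> H1_space \<Omega>" "v \<in> H1_space \<Omega>"
  shows "H1_norm \<Omega> (u + c *\<^sub>R v) \<le> H1_norm \<Omega> u + \<bar>c\<bar> * H1_norm \<Omega> v"
  unfolding H1_norm_eq by (rule semi_inner.triangle[OF semi_inner_H1 assms])

lemma H1_norm_zero: "H1_norm \<Omega> 0 = 0"
  unfolding H1_norm_eq using semi_inner.zero_left[OF semi_inner_H1 H1_zero] by simp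

section \<open>Functions with zero gradient, and constants\<close>

lemma zero_gradient_imp_const:
  assumes v: "v \<in> H1_space \<Omega>" and "grad_norm v = 0"
  obtains c where "AE x in LM. v x = c"
proof -
  have 0: "AE x in LM. wg v x = 0"
    using L2_norm_eq_0[OF wg(1)[OF v]] assms(2) by (simp add: grad_norm_def)
  obtain w where w: "integrable lborel w" "AE x in lborel. x \<in> \<Omega> \<longrightarrow> v x = w x"
    "\<And>g. g \<in> borel_measurable borel \<Longrightarrow> (\<integral>x. v x * g x \<partial>LM) = (\<integral>x. w x * g x \<partial>lborel)"
    using lebesgue_on_ex_lborel[OF dom_sets L2_integrable[OF H1_L2[OF v]]] by blast
  have "\<exists>c. AE x in lborel. x \<in> \<Omega> \<longrightarrow> w x = c"
  proof (rule zero_weak_gradient_connected[OF w(1) _ open_dom connected_dom])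
    fix \<phi> and i :: 'a assume \<phi>: "\<phi> \<in> test_functions \<Omega>" and i: "i \<in> Basis"
    have "(\<integral>x. w x * frechet_derivative \<phi> (at x) i \<partial>lborel) = (\<integral>x. v x * frechet_derivative \<phi> (at x) i \<partial>LM)"
      by (rule test_function_partial[OF \<phi>, of i]) (simp add: w(3))
    also have "\<dots> = - (\<integral>x. (wg v x \<bullet> i) * \<phi> x \<partial>LM)"
      using wg(2)[OF v] \<phi> i unfolding is_weak_gradient_def by blast
    also have "(\<integral>x. (wg v x \<bullet> i) * \<phi> x \<partial>LM) = 0"
      by (rule integral_eq_zero_AE) (use 0 in eventually_elim, simp)
    finally show "(\<integral>x. w x * frechet_derivative \<phi> (at x) i \<partial>lborel) = 0" by simp
  qed
  then obtain c where "AE x in lborel. x \<in> \<Omega> \<longrightarrow> w x = c" by blast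
  with w(2) have "AE x in lborel. x \<in> \<Omega> \<longrightarrow> v x = c" by eventually_elim auto
  then show thesis
    by (rule that[OF AE_lebesgue_on_if_AE_lborel[OF dom_sets]])
qed

text \<open>A trace operator respects equality almost everywhere through its bound by
  \<open>H1_norm\<close>, once the difference is seen to have norm 0.\<close>

lemma H1_AE_eq:
  assumes v: "v \<in> H1_space \<Omega>" and k: "k \<in> L2_space LM" and eq: "AE x in LM. v x = k x"
  shows "k \<in> H1_space \<Omega>" "H1_norm \<Omega> (v + (- 1) *\<^sub>R k) = 0"
proof -
  have wk: "is_weak_gradient \<Omega> k (wg v)"
    unfolding is_weak_gradient_def
  proof (intro ballI)
    fix \<phi> and i :: 'a assume \<phi>: "\<phi> \<in> test_functions \<Omega>" and i: "i \<in> Basis"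
    have "(\<integral>x. k x * frechet_derivative \<phi> (at x) i \<partial>LM) = (\<integral>x. v x * frechet_derivative \<phi> (at x) i \<partial>LM)"
    proof (rule integral_cong_AE)
      show "AE x in LM. k x * frechet_derivative \<phi> (at x) i = v x * frechet_derivative \<phi> (at x) i"
        using eq by eventually_elim simp
    qed (use integrable_partial[OF k \<phi>, of i] integrable_partial[OF H1_L2[OF v] \<phi>, of i] in auto)
    also have "\<dots> = - (\<integral>x. (wg v x \<bullet> i) * \<phi> x \<partial>LM)"
      using wg(2)[OF v] \<phi> i unfolding is_weak_gradient_def by blast
    finally show "(\<integral>x. k x * frechet_derivative \<phi> (at x) i \<partial>LM) = - (\<integral>x. (wg v x \<bullet> i) * \<phi> x \<partial>LM)" .
  qed
  show kH: "k \<in> H1_space \<Omega>"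
    using k wk wg(1)[OF v] by (auto simp: H1_space_def)
  have "AE x in LM. wg k x = wg v x"
    by (rule weak_gradient_unique[OF wg[OF kH] wg(1)[OF v] wk])
  with wg_comb[OF v kH, of "- 1"] have "AE x in LM. wg (v + (- 1) *\<^sub>R k) x = 0"
    by eventually_elim simp
  then have "form (\<lambda>x. 1) (v + (- 1) *\<^sub>R k) (v + (- 1) *\<^sub>R k) = 0"
    unfolding form_def by (intro integral_eq_zero_AE) (auto elim!: eventually_mono)
  moreover have "(\<integral>x. (v + (- 1) *\<^sub>R k) x * (v + (- 1) *\<^sub>R k) x \<partial>LM) = 0"
    by (rule integral_eq_zero_AE) (use eq in eventually_elim, simp)
  ultimately show "H1_norm \<Omega> (v + (- 1) *\<^sub>R k) = 0" by (simp add: H1_norm_eq)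
qed

text \<open>Membership lets the trace operator act on constants. The integral over
  \<open>\<Omega>\<close> of a partial derivative of a test function extends to the whole space,
  where it is 0.\<close>

lemma H1_one: "(\<lambda>x. 1) \<in> H1_space \<Omega>"
proof -
  have "is_weak_gradient \<Omega> (\<lambda>x. 1) 0"
    unfolding is_weak_gradient_def
  proof (intro ballI)
    fix \<phi> and i :: 'a assume \<phi>: "\<phi> \<in> test_functions \<Omega>"
    obtain G K where G: "\<And>x. (\<phi> has_derivative (\<lambda>h. G x \<bullet> h)) (at x)" "continuous_on UNIV G"
      "K \<subseteq> \<Omega>" "\<And>x. x \<notin> K \<Longrightarrow> G x = 0"
      using test_function_gradient[OF \<phi>] by metis
    have eq: "frechet_derivative \<phi> (at x) = (\<lambda>h. G x \<bullet> h)" for x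
      using frechet_derivative_at[OF G(1)] by simp
    have [measurable]: "G \<in> borel_measurable borel" by (rule borel_measurable_continuous_onI[OF G(2)])
    have "(\<integral>x. 1 * frechet_derivative \<phi> (at x) i \<partial>LM) = (\<integral>x. indicator \<Omega> x *\<^sub>R (G x \<bullet> i) \<partial>lebesgue)"
      using dom_sets by (subst integral_restrict_space) (auto simp: eq)
    also have "\<dots> = (\<integral>x. G x \<bullet> i \<partial>lebesgue)"
    proof (rule Bochner_Integration.integral_cong)
      show "indicator \<Omega> x *\<^sub>R (G x \<bullet> i) = G x \<bullet> i" for x
      proof (cases "x \<in> \<Omega>")
        case False
        then have "G x = 0" using G(3,4) by blast
        then show ?thesis by simp
      qed simp
    qed simp
    also have "\<dots> = (\<integral>x. G x \<bullet> i \<partial>lborel)"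
      by (rule integral_completion) measurable
    also have "\<dots> = 0"
      using integral_partial_test_function[OF \<phi>, of i] by (simp add: eq)
    finally show "(\<integral>x. 1 * frechet_derivative \<phi> (at x) i \<partial>LM) = - (\<integral>x. (0 x \<bullet> i) * \<phi> x \<partial>LM)"
      by simp
  qed
  moreover have "(\<lambda>x. 1 :: real) \<in> L2_space LM"
    using finite_measure.integrable_const[OF finite_LM, of "1::real"] by (simp add: L2_space_def)
  ultimately show ?thesis by (auto simp: H1_space_def intro!: bexI[of _ 0])
qed

lemma form_coeff_sum:
  assumes "finite I" "\<And>i. i \<in> I \<Longrightarrow> a i \<in> Linf_space LM" "u \<in> H1_space \<Omega>" "v \<in> H1_space \<Omega>"
  shows "(\<Sum>i\<in>I. c i *\<^sub>R a i) \<in> Linf_space LM"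
    and "form (\<Sum>i\<in>I. c i *\<^sub>R a i) u v = (\<Sum>i\<in>I. c i * form (a i) u v)"
proof -
  have "(\<Sum>i\<in>I. c i *\<^sub>R a i) \<in> Linf_space LM \<and> form (\<Sum>i\<in>I. c i *\<^sub>R a i) u v = (\<Sum>i\<in>I. c i * form (a i) u v)"
    using assms(1,2)
  proof (induction I rule: finite_induct)
    case empty
    show ?case using Linf_const[of 0] by (simp add: zero_fun_def form_def)
  next
    case (insert i I)
    have IH: "(\<Sum>i\<in>I. c i *\<^sub>R a i) \<in> Linf_space LM"
      "form (\<Sum>i\<in>I. c i *\<^sub>R a i) u v = (\<Sum>i\<in>I. c i * form (a i) u v)" and ai: "a i \<in> Linf_space LM"
      using insert.IH insert.prems by blast+
    have "(\<Sum>i\<in>insert i I. c i *\<^sub>R a i) = (\<Sum>i\<in>I. c i *\<^sub>R a i) + c i *\<^sub>R a i"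
      using insert.hyps by (simp add: add.commute)
    moreover have "(\<Sum>i\<in>insert i I. c i * form (a i) u v) = (\<Sum>i\<in>I. c i * form (a i) u v) + c i * form (a i) u v"
      using insert.hyps by simp
    ultimately show ?case
      using Linf_comb[OF IH(1) ai, of "c i"] form_coeff_comb[OF IH(1) ai assms(3,4), of "c i"] IH(2)
      by (simp only: simp_thms)
  qed
  then show "(\<Sum>i\<in>I. c i *\<^sub>R a i) \<in> Linf_space LM"
    "form (\<Sum>i\<in>I. c i *\<^sub>R a i) u v = (\<Sum>i\<in>I. c i * form (a i) u v)" by auto
qed

lemma Linf_diff: "a \<in> Linf_space LM \<Longrightarrow> b \<in> Linf_space LM \<Longrightarrow> a - b \<in> Linf_space LM"
  using Linf_comb[of a b "- 1"] by simp

lemma form_coeff_diff: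
  assumes "a \<in> Linf_space LM" "b \<in> Linf_space LM" "u \<in> H1_space \<Omega>" "v \<in> H1_space \<Omega>"
  shows "form (a - b) u v = form a u v - form b u v"
  using form_coeff_comb[OF assms, of "- 1"] by simp

lemma form_diff:
  assumes "a \<in> Linf_space LM" "u \<in> H1_space \<Omega>" "v \<in> H1_space \<Omega>" "w \<in> H1_space \<Omega>"
  shows "form a (u - v) w = form a u w - form a v w"
  using form_comb[OF assms, of "- 1"] by simp

end

section \<open>Seminorms and the mean value inequality\<close>

locale seminorm_on =
  fixes S :: "'v::real_vector set" and p :: "'v \<Rightarrow> real"
  assumes subspace_S: "subspace S"
    and zero: "p 0 = 0"
    and comb: "\<And>u v c. u \<in> S \<Longrightarrow> v \<in> S \<Longrightarrow> p (u + c *\<^sub>R v) \<le> p u + \<bar>c\<bar> * p v"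
    and nonneg: "\<And>u. u \<in> S \<Longrightarrow> 0 \<le> p u"
begin

lemma add_le: "u \<in> S \<Longrightarrow> v \<in> S \<Longrightarrow> p (u + v) \<le> p u + p v"
  using comb[of u v 1] by simp

lemma diff_le: "u \<in> S \<Longrightarrow> v \<in> S \<Longrightarrow> p (u - v) \<le> p u + p v"
  using comb[of u v "- 1"] by simp

lemma scale_le: "u \<in> S \<Longrightarrow> p (c *\<^sub>R u) \<le> \<bar>c\<bar> * p u"
  using comb[of 0 u c] subspace_0[OF subspace_S] by (simp add: zero)

text \<open>The reverse inequality is \<open>scale_le\<close> for the scalar
  \<open>1 / c\<close>.\<close>

lemma scale: 
  assumes "u \<in> S"
  shows "p (c *\<^sub>R u) = \<bar>c\<bar> * p u"
proof (cases "c = 0")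
  case False
  have "p ((1 / c) *\<^sub>R (c *\<^sub>R u)) \<le> \<bar>1 / c\<bar> * p (c *\<^sub>R u)"
    using assms by (intro scale_le subspace_scale subspace_S)
  then have "\<bar>c\<bar> * p u \<le> p (c *\<^sub>R u)" using False by (simp add: field_simps)
  with scale_le[OF assms, of c] show ?thesis by simp
qed (simp add: zero)

lemma sum_le:
  assumes "finite I" "\<And>i. i \<in> I \<Longrightarrow> f i \<in> S"
  shows "p (\<Sum>i\<in>I. c i *\<^sub>R f i) \<le> (\<Sum>i\<in>I. \<bar>c i\<bar> * p (f i))"
  using assms
proof (induction I rule: finite_induct)
  case (insert i I)
  have "p ((\<Sum>i\<in>I. c i *\<^sub>R f i) + c i *\<^sub>R f i) \<le> p (\<Sum>i\<in>I. c i *\<^sub>R f i) + \<bar>c i\<bar> * p (f i)"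
    using insert.prems by (intro comb subspace_sum subspace_scale subspace_S) auto
  with insert show ?case by (simp add: add.commute)
qed (simp add: zero)

text \<open>The condition \<open>0 \<le> M\<close> matters because \<open>ennreal\<close> sends
  negative reals to 0.\<close>

lemma seminorm_onorm_le:
  assumes D: "linear D" "range D \<subseteq> S" and M: "seminorm_onorm p D \<le> ennreal M" "0 \<le> M"
  shows "p (D h) \<le> M * norm (h::'z::euclidean_space)"
proof (cases "h = 0")
  case True
  then show ?thesis using linear_0[OF D(1)] zero by simp
next
  case False
  have in_S: "D k \<in> S" for k using D(2) by blast
  define k where "k = (1 / norm h) *\<^sub>R h"
  have "norm k = 1" using False by (simp add: k_def)
  then have "k \<in> cball 0 1" by simp
  then have "ennreal (p (D k)) \<le> ennreal M"
    using M(1) unfolding seminorm_onorm_def by (meson SUP_upper order_trans)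
  then have "p (D k) \<le> M" using M(2) by simp
  moreover have "h = norm h *\<^sub>R k" using False by (simp add: k_def)
  then have "p (D h) = norm h * p (D k)"
    by (metis linear_scale[OF D(1)] scale[OF in_S] abs_norm_cancel)
  ultimately show ?thesis using mult_left_mono[OF _ norm_ge_zero, of "p (D k)" M h] by (simp add: mult.commute[of M])
qed

text \<open>Bisection along the segment: the bound with the constant \<open>M + e'\<close> passes
  from two adjacent intervals to their union, and by differentiability it holds on all small
  intervals around a given point. The slack disappears by \<open>field_le_epsilon\<close>.\<close>

lemma mean_value_inequality:
  fixes G :: "'z::euclidean_space \<Rightarrow> 'v"
  assumes "convex U" and GS: "\<And>z. z \<in> U \<Longrightarrow> G z \<in> S"
    and D: "\<And>z. z \<in> U \<Longrightarrow> has_seminorm_derivative S p G (D z) z U"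
    and M: "\<And>z. z \<in> U \<Longrightarrow> seminorm_onorm p (D z) \<le> ennreal M" "0 \<le> M"
    and z: "z1 \<in> U" "z2 \<in> U"
  shows "p (G z2 - G z1) \<le> M * norm (z2 - z1)"
proof (rule field_le_epsilon)
  fix e :: real assume "e > 0"
  define k where "k = norm (z2 - z1)"
  \<comment> \<open>The denominator \<open>k + 1\<close> instead of \<open>k\<close> covers the case
    \<open>z1 = z2\<close>.\<close>
  define e' where "e' = e / (k + 1)"
  have "k \<ge> 0" by (simp add: k_def)
  have "e' > 0" using \<open>e > 0\<close> \<open>k \<ge> 0\<close> by (simp add: e'_def)
  define c where "c t = z1 + t *\<^sub>R (z2 - z1)" for t :: real
  have cU: "c t \<in> U" if "0 \<le> t" "t \<le> 1" for t
    using convexD_alt[OF \<open>convex U\<close> z that] by (simp add: c_def algebra_simps)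
  have c_diff: "c s - c t = (s - t) *\<^sub>R (z2 - z1)" for s t
    by (simp add: c_def algebra_simps)
  define P where "P s t \<longleftrightarrow> 0 \<le> s \<and> t \<le> 1 \<longrightarrow> p (G (c t) - G (c s)) \<le> (M + e') * k * (t - s)" for s t
  have "P 0 1"
  proof (rule Bolzano)
    fix r s t assume "P r s" "P s t" "r \<le> s" "s \<le> t"
    show "P r t"
      unfolding P_def
    proof
      assume "0 \<le> r \<and> t \<le> 1"
      then have rst: "0 \<le> r" "t \<le> 1" "0 \<le> s" "s \<le> 1" using \<open>r \<le> s\<close> \<open>s \<le> t\<close> by auto
      have "p ((G (c t) - G (c s)) + (G (c s) - G (c r))) \<le> p (G (c t) - G (c s)) + p (G (c s) - G (c r))"
        using rst \<open>r \<le> s\<close> \<open>s \<le> t\<close> by (intro add_le subspace_diff subspace_S GS cU) auto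
      also have "\<dots> \<le> (M + e') * k * (t - s) + (M + e') * k * (s - r)"
        using \<open>P r s\<close> \<open>P s t\<close> rst by (intro add_mono) (auto simp: P_def)
      finally show "p (G (c t) - G (c r)) \<le> (M + e') * k * (t - r)"
        by (simp add: algebra_simps)
    qed
  next
    fix x :: real assume x: "0 \<le> x" "x \<le> 1"
    note cx = cU[OF x]
    have Dx: "linear (D (c x))" "range (D (c x)) \<subseteq> S"
      using D[OF cx] by (auto simp: has_seminorm_derivative_def)
    obtain d where d: "d > 0" "\<And>w. w \<in> U \<Longrightarrow> norm (w - c x) < d \<Longrightarrow>
        p (G w - G (c x) - D (c x) (w - c x)) \<le> e' * norm (w - c x)"
      using D[OF cx] \<open>e' > 0\<close> unfolding has_seminorm_derivative_def by blast
    have pD: "p (D (c x) h) \<le> M * norm h" for h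
      by (rule seminorm_onorm_le[OF Dx M(1)[OF cx] M(2)])
    have near: "c t \<in> U" "p (G (c t) - G (c x) - D (c x) (c t - c x)) \<le> e' * (k * \<bar>t - x\<bar>)"
      if "0 \<le> t" "t \<le> 1" "\<bar>t - x\<bar> < d / (k + 1)" for t
    proof -
      show ct: "c t \<in> U" by (rule cU[OF that(1,2)])
      have nrm: "norm (c t - c x) = k * \<bar>t - x\<bar>" by (simp add: c_diff k_def mult.commute)
      have "k * \<bar>t - x\<bar> \<le> (k + 1) * \<bar>t - x\<bar>" by (simp add: mult_right_mono)
      also have "\<dots> < d" using that(3) \<open>k \<ge> 0\<close> by (simp add: pos_less_divide_eq mult.commute)
      finally show "p (G (c t) - G (c x) - D (c x) (c t - c x)) \<le> e' * (k * \<bar>t - x\<bar>)"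
        using d(2)[OF ct] nrm by simp
    qed
    \<comment> \<open>As \<open>x\<close> lies between \<open>s\<close> and \<open>t\<close>, the
      remainders towards the two ends are proportional to \<open>t - x\<close> and
      \<open>x - s\<close>, which add up to \<open>t - s\<close>.\<close>
    have "P s t" if st: "s \<le> x" "x \<le> t" "t - s < d / (k + 1)" for s t
      unfolding P_def
    proof
      assume "0 \<le> s \<and> t \<le> 1"
      then have t: "c t \<in> U" "p (G (c t) - G (c x) - D (c x) (c t - c x)) \<le> e' * (k * (t - x))"
        and s: "c s \<in> U" "p (G (c s) - G (c x) - D (c x) (c s - c x)) \<le> e' * (k * (x - s))"
        using near[of t] near[of s] st x by auto
      let ?a = "\<lambda>r. G (c r) - G (c x) - D (c x) (c r - c x)"
      have aS: "?a t \<in> S" "?a s \<in> S" "D (c x) (c t - c s) \<in> S"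
        using t(1) s(1) cx Dx(2) by (auto intro!: subspace_diff subspace_S GS)
      have "D (c x) (c t - c s) = D (c x) (c t - c x) - D (c x) (c s - c x)"
        by (simp add: linear_diff[OF Dx(1), symmetric])
      then have eq: "G (c t) - G (c s) = (?a t - ?a s) + D (c x) (c t - c s)"
        by (simp add: algebra_simps)
      have "p (G (c t) - G (c s)) \<le> p (?a t - ?a s) + p (D (c x) (c t - c s))"
        unfolding eq by (rule add_le[OF subspace_diff[OF subspace_S aS(1,2)] aS(3)])
      also have "\<dots> \<le> (p (?a t) + p (?a s)) + p (D (c x) (c t - c s))"
        by (intro add_right_mono diff_le aS)
      also have "\<dots> \<le> (e' * (k * (t - x)) + e' * (k * (x - s))) + M * norm (c t - c s)"
        using t(2) s(2) pD by (intro add_mono)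
      also have "norm (c t - c s) = (t - s) * k"
        using st by (simp add: c_diff k_def)
      finally show "p (G (c t) - G (c s)) \<le> (M + e') * k * (t - s)"
        by (simp add: algebra_simps)
    qed
    then show "\<exists>d>0. \<forall>s t. s \<le> x \<and> x \<le> t \<and> t - s < d \<longrightarrow> P s t"
      using d(1) \<open>k \<ge> 0\<close> by (intro exI[of _ "d / (k + 1)"]) auto
  qed simp
  then have "p (G z2 - G z1) \<le> (M + e') * k"
    by (simp add: P_def c_def)
  also have "\<dots> \<le> M * k + e"
  proof -
    have "e' * k \<le> e" using \<open>e > 0\<close> \<open>k \<ge> 0\<close> by (simp add: e'_def field_simps)
    then show ?thesis by (simp add: algebra_simps)
  qed
  finally show "p (G z2 - G z1) \<le> M * norm (z2 - z1) + e" by (simp add: k_def)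
qed

end

section \<open>Rules for relative derivatives\<close>

lemma (in seminorm_on) has_seminorm_derivative_diff:
  assumes f: "has_seminorm_derivative S p f D z U" and g: "has_seminorm_derivative S p g E z U"
    and S: "\<And>w. w \<in> U \<Longrightarrow> f w \<in> S" "\<And>w. w \<in> U \<Longrightarrow> g w \<in> S" "z \<in> U"
  shows "has_seminorm_derivative S p (f - g) (D - E) z U"
  unfolding has_seminorm_derivative_def
proof (intro conjI allI impI)
  have lin: "linear D" "linear E" and in_S: "D h \<in> S" "E h \<in> S" for h
    using f g by (auto simp: has_seminorm_derivative_def)
  show "linear (D - E)"
    using linear_compose_sub[OF lin] by (simp add: fun_diff_def)
  show "range (D - E) \<subseteq> S" using in_S by (auto intro: subspace_diff[OF subspace_S])
  obtain B C where BC: "\<And>h. p (D h) \<le> B * norm h" "\<And>h. p (E h) \<le> C * norm h"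
    using f g unfolding has_seminorm_derivative_def by blast
  have "p ((D - E) h) \<le> (B + C) * norm h" for h
    using diff_le[OF in_S(1)[of h] in_S(2)[of h]] add_mono[OF BC(1)[of h] BC(2)[of h]]
    by (simp add: distrib_right)
  then show "\<exists>C. \<forall>h. p ((D - E) h) \<le> C * norm h" by blast
  fix e :: real assume "e > 0"
  then have "e / 2 > 0" by simp
  then obtain d1 d2 where d: "d1 > 0" "d2 > 0"
    "\<And>w. w \<in> U \<Longrightarrow> norm (w - z) < d1 \<Longrightarrow> p (f w - f z - D (w - z)) \<le> e / 2 * norm (w - z)"
    "\<And>w. w \<in> U \<Longrightarrow> norm (w - z) < d2 \<Longrightarrow> p (g w - g z - E (w - z)) \<le> e / 2 * norm (w - z)"
    using f g unfolding has_seminorm_derivative_def by metis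
  have "p ((f - g) w - (f - g) z - (D - E) (w - z)) \<le> e * norm (w - z)"
    if w: "w \<in> U" "norm (w - z) < min d1 d2" for w
  proof -
    have "(f - g) w - (f - g) z - (D - E) (w - z) = (f w - f z - D (w - z)) - (g w - g z - E (w - z))"
      by (simp add: algebra_simps)
    also have "p \<dots> \<le> p (f w - f z - D (w - z)) + p (g w - g z - E (w - z))"
      using S w(1) in_S by (intro diff_le subspace_diff subspace_S) auto
    also have "\<dots> \<le> e / 2 * norm (w - z) + e / 2 * norm (w - z)"
      using w by (intro add_mono d) auto
    finally show ?thesis by simp
  qed
  then show "\<exists>d>0. \<forall>w\<in>U. norm (w - z) < d \<longrightarrow> p ((f - g) w - (f - g) z - (D - E) (w - z)) \<le> e * norm (w - z)"
    using d(1,2) by (intro exI[of _ "min d1 d2"]) auto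
qed

lemma has_seminorm_derivative_subset:
  assumes f: "has_seminorm_derivative X N f D z W" and sub: "S \<subseteq> W" "X \<subseteq> X'"
    and eq: "\<And>w. w \<in> S \<Longrightarrow> f w = g w" and z: "z \<in> S"
  shows "has_seminorm_derivative X' N g D z S"
  unfolding has_seminorm_derivative_def
proof (intro conjI allI impI)
  show "linear D" "range D \<subseteq> X'" "\<exists>C. \<forall>h. N (D h) \<le> C * norm h"
    using f sub(2) unfolding has_seminorm_derivative_def by blast+
  fix e :: real assume "e > 0"
  then obtain d where d: "d > 0" "\<And>w. w \<in> W \<Longrightarrow> norm (w - z) < d \<Longrightarrow> N (f w - f z - D (w - z)) \<le> e * norm (w - z)"
    using f unfolding has_seminorm_derivative_def by blast
  have "N (g w - g z - D (w - z)) \<le> e * norm (w - z)" if "w \<in> S" "norm (w - z) < d" for w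
    using d(2)[of w] that sub(1) eq[OF that(1)] eq[OF z] by auto
  with d(1) show "\<exists>d>0. \<forall>w\<in>S. norm (w - z) < d \<longrightarrow> N (g w - g z - D (w - z)) \<le> e * norm (w - z)"
    by blast
qed

lemma C1_on_seminorm_imp_derivative:
  assumes "C1_on_seminorm X N Z f" "z \<in> U" "U \<subseteq> Z" "X \<subseteq> X'"
  shows "\<exists>D. has_seminorm_derivative X' N f D z U"
proof -
  from assms(1)[unfolded C1_on_seminorm_def] obtain W F D where W: "Z \<subseteq> W" "\<forall>w\<in>Z. F w = f w"
    "\<forall>z\<in>W. has_seminorm_derivative X N F (D z) z W"
    by (elim exE conjE) (rule that)
  have sub: "U \<subseteq> W" using assms(3) W(1) by blast
  then have "z \<in> W" using assms(2) by blast
  moreover have "F w = f w" if "w \<in> U" for w using that W(2) assms(3) by blast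
  ultimately show ?thesis
    by (intro exI) (rule has_seminorm_derivative_subset[OF bspec[OF W(3)] sub assms(4) _ assms(2)])
qed

lemma C1_on_seminorm_in_space:
  assumes "C1_on_seminorm X N Z f" "z \<in> Z"
  shows "f z \<in> X"
  using assms unfolding C1_on_seminorm_def by (metis image_subset_iff subset_iff)

section \<open>Trace spaces\<close>

locale trace_setting = bounded_domain \<Omega> for \<Omega> :: "'a::euclidean_space set" +
  fixes \<gamma> :: "('a \<Rightarrow> real) \<Rightarrow> 'a \<Rightarrow> real"
  assumes trace: "is_trace_operator \<Omega> \<gamma>"
begin

abbreviation "SM \<equiv> surface_measure \<Omega>"

lemma trace_L2: "v \<in> H1_space \<Omega> \<Longrightarrow> \<gamma> v \<in> L2_space SM"
  using trace by (simp add: is_trace_operator_def)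

lemma trace_comb:
  "u \<in> H1_space \<Omega> \<Longrightarrow> v \<in> H1_space \<Omega> \<Longrightarrow> AE x in SM. \<gamma> (u + c *\<^sub>R v) x = \<gamma> u x + c * \<gamma> v x"
  using trace by (simp add: is_trace_operator_def)

lemma trace_zero: "AE x in SM. \<gamma> 0 x = 0"
  using trace_comb[OF H1_zero H1_zero, of 1] by (auto elim: eventually_mono)

lemma trace_null:
  assumes "v \<in> H1_space \<Omega>" "H1_norm \<Omega> v = 0"
  shows "AE x in SM. \<gamma> v x = 0"
proof -
  obtain C where "L2_norm SM (\<gamma> v) \<le> C * H1_norm \<Omega> v"
    using trace assms(1) unfolding is_trace_operator_def by blast
  then have "L2_norm SM (\<gamma> v) = 0"
    using assms(2) L2_norm_nonneg[of SM "\<gamma> v"] by simp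
  then show ?thesis using L2_norm_eq_0 trace_L2[OF assms(1)] by blast
qed

text \<open>A constant is continuous up to the boundary, hence is its own trace, and
  \<open>v\<close> differs from it by a function of norm 0.\<close>

lemma trace_of_AE_const:
  assumes v: "v \<in> H1_space \<Omega>" and c: "AE x in LM. v x = c"
  shows "AE x in SM. \<gamma> v x = c"
proof -
  have L2: "(\<lambda>x. c) \<in> L2_space LM"
    using finite_measure.integrable_const[OF finite_LM, of "c\<^sup>2"] by (simp add: L2_space_def)
  note k = H1_AE_eq[OF v L2 c]
  have "\<forall>v\<in>H1_space \<Omega>. continuous_on (closure \<Omega>) v \<longrightarrow> (AE x in SM. \<gamma> v x = v x)"
    using trace by (simp add: is_trace_operator_def)
  from bspec[OF this k(1)] have "AE x in SM. \<gamma> (\<lambda>x. c) x = c" by simp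
  moreover have "AE x in SM. \<gamma> (v + (- 1) *\<^sub>R (\<lambda>x. c)) x = 0"
    by (rule trace_null[OF H1_comb[OF v k(1)] k(2)])
  moreover have "AE x in SM. \<gamma> (v + (- 1) *\<^sub>R (\<lambda>x. c)) x = \<gamma> v x + (- 1) * \<gamma> (\<lambda>x. c) x"
    by (rule trace_comb[OF v k(1)])
  ultimately show ?thesis by eventually_elim simp
qed

text \<open>The trace is a constant \<open>c\<close> whose integral is 0, so either \<open>c\<close>
  is 0 or the boundary is a null set.\<close>

lemma zero_gradient_imp_zero_trace:
  assumes v: "v \<in> H1_space \<Omega>" and "grad_norm v = 0" and mean: "(\<integral>x. \<gamma> v x \<partial>SM) = 0"
  shows "AE x in SM. \<gamma> v x = 0"
proof -
  obtain c where "AE x in LM. v x = c" using zero_gradient_imp_const[OF assms(1,2)] .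
  then have c: "AE x in SM. \<gamma> v x = c" by (rule trace_of_AE_const[OF v])
  have [measurable]: "\<gamma> v \<in> borel_measurable SM" using trace_L2[OF v] by blast
  have "integrable SM (\<lambda>x. (\<gamma> v x)\<^sup>2)" using trace_L2[OF v] by (auto simp: L2_space_def)
  then have "integrable SM (\<lambda>x. c\<^sup>2)"
    by (rule Bochner_Integration.integrable_cong_AE_imp) (use c in \<open>auto elim: eventually_mono\<close>)
  \<comment> \<open>An infinite total measure also has \<open>measure\<close> 0; it is excluded for
    nonzero \<open>c\<close> by square integrability of the trace.\<close>
  then have fin: "c = 0 \<or> emeasure SM (space SM) < \<infinity>"
    by (auto simp: integrable_iff_bounded ennreal_mult_less_top)
  have "(\<integral>x. \<gamma> v x \<partial>SM) = (\<integral>x. c \<partial>SM)"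
    by (rule integral_cong_AE) (use c in auto)
  then have "c = 0 \<or> measure SM (space SM) = 0" using mean by auto
  then show ?thesis
  proof
    assume "c = 0"
    then show ?thesis using c by simp
  next
    assume "measure SM (space SM) = 0"
    with fin have "c = 0 \<or> emeasure SM (space SM) = 0"
      by (auto simp: measure_def enn2real_eq_0_iff)
    then show ?thesis
    proof
      assume "emeasure SM (space SM) = 0"
      then have "space SM \<in> null_sets SM" by (auto simp: null_sets_def)
      then show ?thesis by (rule AE_I') auto
    qed (use c in simp)
  qed
qed

section \<open>The quotient norm on traces and on tuples of traces\<close>

abbreviation "Hh \<equiv> Hhalf_space \<Omega> \<gamma>"
abbreviation "nHh \<equiv> Hhalf_norm \<Omega> \<gamma>"

lemma Hhalf_le: "v \<in> H1_space \<Omega> \<Longrightarrow> AE x in SM. \<gamma> v x = w x \<Longrightarrow> nHh w \<le> H1_norm \<Omega> v"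
  unfolding Hhalf_norm_def by (rule cInf_lower) (auto intro!: bdd_belowI[of _ 0] simp: H1_norm_nonneg)

text \<open>A lift attaining the infimum is not at hand, so estimates of the quotient norm carry a
  slack \<open>e\<close>.\<close>

lemma Hhalf_ex_lift:
  assumes "w \<in> Hh" "0 < e"
  obtains v where "v \<in> H1_space \<Omega>" "AE x in SM. \<gamma> v x = w x" "H1_norm \<Omega> v < nHh w + e"
proof -
  let ?T = "{H1_norm \<Omega> v |v. v \<in> H1_space \<Omega> \<and> (AE x in SM. \<gamma> v x = w x)}"
  have ne: "?T \<noteq> {}" using assms(1) by (auto simp: Hhalf_space_def trace_space_def)
  have "Inf ?T < nHh w + e" using assms(2) by (simp add: Hhalf_norm_def)
  then obtain t where "t \<in> ?T" "t < nHh w + e"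
    using cInf_lessD[OF ne] by blast
  then show thesis using that by blast
qed

lemma Hhalf_nonneg: "w \<in> Hh \<Longrightarrow> 0 \<le> nHh w"
  unfolding Hhalf_norm_def
  by (rule cInf_greatest) (auto simp: Hhalf_space_def trace_space_def H1_norm_nonneg)

lemma Hhalf_cong: 
  assumes "AE x in SM. w x = w' x"
  shows "nHh w = nHh w'"
proof -
  have "(AE x in SM. \<gamma> v x = w x) \<longleftrightarrow> (AE x in SM. \<gamma> v x = w' x)" for v
    by (rule iffI; erule eventually_rev_mp; rule eventually_mono[OF assms]; simp)
  then show ?thesis by (simp add: Hhalf_norm_def)
qed

lemma trace_in_Hhalf: "v \<in> H1_space \<Omega> \<Longrightarrow> \<gamma> v \<in> Hh"
  using trace_L2[of v] by (auto simp: Hhalf_space_def trace_space_def)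

text \<open>Equality with \<open>\<gamma> 0\<close> almost everywhere makes the zero function of
  \<open>H1_space\<close> a lift of \<open>w\<close>.\<close>

lemma Hhalf_null: "AE x in SM. w x = 0 \<Longrightarrow> nHh w = 0"
proof -
  assume w: "AE x in SM. w x = 0"
  have "AE x in SM. w x = \<gamma> 0 x"
    using w trace_zero by eventually_elim simp
  then have "nHh w = nHh (\<gamma> 0)" by (rule Hhalf_cong)
  moreover have "nHh (\<gamma> 0) \<le> 0"
    using Hhalf_le[OF H1_zero, of "\<gamma> 0"] by (simp add: H1_norm_zero)
  ultimately show ?thesis using Hhalf_nonneg[OF trace_in_Hhalf[OF H1_zero]] by simp
qed

lemma Hhalf_comb_in:
  assumes "w \<in> Hh" "w' \<in> Hh"
  shows "w + c *\<^sub>R w' \<in> Hh"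
proof -
  have [measurable]: "w \<in> borel_measurable SM" "w' \<in> borel_measurable SM"
    using assms by (auto simp: Hhalf_space_def trace_space_def)
  obtain v v' where v: "v \<in> H1_space \<Omega>" "AE x in SM. \<gamma> v x = w x"
    "v' \<in> H1_space \<Omega>" "AE x in SM. \<gamma> v' x = w' x"
    using assms by (auto simp: Hhalf_space_def trace_space_def)
  have "AE x in SM. \<gamma> (v + c *\<^sub>R v') x = (w + c *\<^sub>R w') x"
    using v(2,4) trace_comb[OF v(1,3), of c] by eventually_elim simp
  moreover have "w + c *\<^sub>R w' \<in> borel_measurable SM"
    by (simp add: plus_fun_def scaleR_fun_def)
  ultimately show ?thesis
    using H1_comb[OF v(1,3), of c] by (auto simp: Hhalf_space_def trace_space_def)
qed

lemma Hhalf_comb: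
  assumes "w \<in> Hh" "w' \<in> Hh"
  shows "nHh (w + c *\<^sub>R w') \<le> nHh w + \<bar>c\<bar> * nHh w'"
proof (rule field_le_epsilon)
  fix e :: real assume "e > 0"
  \<comment> \<open>The second slack is later multiplied by \<open>\<bar>c\<bar>\<close> and then
    still contributes at most \<open>e / 2\<close>.\<close>
  have "e / 2 > 0" "e / (2 * (\<bar>c\<bar> + 1)) > 0" using \<open>e > 0\<close> by (auto intro!: divide_pos_pos)
  obtain v where v: "v \<in> H1_space \<Omega>" "AE x in SM. \<gamma> v x = w x" "H1_norm \<Omega> v < nHh w + e / 2"
    using Hhalf_ex_lift[OF assms(1) \<open>e / 2 > 0\<close>] .
  obtain v' where v': "v' \<in> H1_space \<Omega>" "AE x in SM. \<gamma> v' x = w' x"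
    "H1_norm \<Omega> v' < nHh w' + e / (2 * (\<bar>c\<bar> + 1))"
    using Hhalf_ex_lift[OF assms(2) \<open>e / (2 * (\<bar>c\<bar> + 1)) > 0\<close>] .
  have "AE x in SM. \<gamma> (v + c *\<^sub>R v') x = (w + c *\<^sub>R w') x"
    using v(2) v'(2) trace_comb[OF v(1) v'(1), of c] by eventually_elim simp
  then have "nHh (w + c *\<^sub>R w') \<le> H1_norm \<Omega> (v + c *\<^sub>R v')"
    by (rule Hhalf_le[OF H1_comb[OF v(1) v'(1)]])
  also have "\<dots> \<le> H1_norm \<Omega> v + \<bar>c\<bar> * H1_norm \<Omega> v'" by (rule H1_norm_comb[OF v(1) v'(1)])
  also have "\<dots> \<le> (nHh w + e / 2) + \<bar>c\<bar> * (nHh w' + e / (2 * (\<bar>c\<bar> + 1)))"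
    using v(3) v'(3) by (intro add_mono mult_left_mono) auto
  also have "\<dots> \<le> nHh w + \<bar>c\<bar> * nHh w' + e"
  proof -
    have "\<bar>c\<bar> * (e / (2 * (\<bar>c\<bar> + 1))) \<le> e / 2"
      using \<open>e > 0\<close> by (simp add: field_simps)
    then show ?thesis
      using distrib_left[of "\<bar>c\<bar>" "nHh w'" "e / (2 * (\<bar>c\<bar> + 1))"] by linarith
  qed
  finally show "nHh (w + c *\<^sub>R w') \<le> nHh w + \<bar>c\<bar> * nHh w' + e" .
qed

text \<open>The trace \<open>\<gamma> 0\<close> is 0 only almost everywhere, so the zero function is
  written as \<open>\<gamma> 0 - \<gamma> 0\<close>.\<close>

lemma Hhalf_zero_in: "0 \<in> Hh"
  using Hhalf_comb_in[OF trace_in_Hhalf[OF H1_zero] trace_in_Hhalf[OF H1_zero], of "- 1"] by simp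

sublocale Hhalf: seminorm_on Hh nHh
proof
  have "u + v \<in> Hh" if "u \<in> Hh" "v \<in> Hh" for u v
    using Hhalf_comb_in[OF that, of 1] by simp
  moreover have "c *\<^sub>R v \<in> Hh" if "v \<in> Hh" for v c
    using Hhalf_comb_in[OF Hhalf_zero_in that, of c] by simp
  ultimately show "subspace Hh" using Hhalf_zero_in by (simp add: subspace_def)
  show "nHh 0 = 0" by (rule Hhalf_null) simp
qed (auto simp: Hhalf_comb Hhalf_nonneg)

lemma Y_norm_L2_set: "Y_norm \<Omega> \<gamma> L y = L2_set (\<lambda>l. nHh (y l)) {1..L}"
  by (simp add: Y_norm_def L2_set_def)

sublocale Y: seminorm_on "Y_space \<Omega> \<gamma> L" "Y_norm \<Omega> \<gamma> L" for L
proof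
  show "subspace (Y_space \<Omega> \<gamma> L)"
    using Hhalf.subspace_S by (auto simp: Y_space_def subspace_def)
  show "Y_norm \<Omega> \<gamma> L 0 = 0"
    by (simp add: Y_norm_def Hhalf.zero)
  fix u v c assume u: "u \<in> Y_space \<Omega> \<gamma> L" and v: "v \<in> Y_space \<Omega> \<gamma> L"
  have "Y_norm \<Omega> \<gamma> L (u + c *\<^sub>R v) \<le> L2_set (\<lambda>l. nHh (u l) + \<bar>c\<bar> * nHh (v l)) {1..L}"
    unfolding Y_norm_L2_set
  proof (rule L2_set_mono)
    fix l assume "l \<in> {1..L}"
    then have "u l \<in> Hh" "v l \<in> Hh" using u v by (auto simp: Y_space_def)
    then show "nHh ((u + c *\<^sub>R v) l) \<le> nHh (u l) + \<bar>c\<bar> * nHh (v l)"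
      "0 \<le> nHh ((u + c *\<^sub>R v) l)"
      by (auto intro: Hhalf_comb Hhalf_nonneg Hhalf_comb_in)
  qed
  also have "\<dots> \<le> Y_norm \<Omega> \<gamma> L u + L2_set (\<lambda>l. \<bar>c\<bar> * nHh (v l)) {1..L}"
    unfolding Y_norm_L2_set by (rule L2_set_triangle_ineq)
  also have "L2_set (\<lambda>l. \<bar>c\<bar> * nHh (v l)) {1..L} = \<bar>c\<bar> * Y_norm \<Omega> \<gamma> L v"
    unfolding Y_norm_L2_set by (rule L2_set_right_distrib[symmetric]) simp
  finally show "Y_norm \<Omega> \<gamma> L (u + c *\<^sub>R v) \<le> Y_norm \<Omega> \<gamma> L u + \<bar>c\<bar> * Y_norm \<Omega> \<gamma> L v" .
next
  fix u show "0 \<le> Y_norm \<Omega> \<gamma> L u" by (simp add: Y_norm_L2_set)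
qed

lemma Y_norm_le_sum:
  assumes "y \<in> Y_space \<Omega> \<gamma> L"
  shows "Y_norm \<Omega> \<gamma> L y \<le> (\<Sum>l=1..L. nHh (y l))"
  unfolding Y_norm_L2_set using assms
  by (intro L2_set_le_sum Hhalf_nonneg) (auto simp: Y_space_def)

lemma Y_norm_eq_0:
  assumes "Y_eq \<Omega> L y1 y2"
  shows "Y_norm \<Omega> \<gamma> L (y1 - y2) = 0"
proof -
  have "nHh ((y1 - y2) l) = 0" if "l \<in> {1..L}" for l
    using assms that by (intro Hhalf_null) (auto simp: Y_eq_def elim!: eventually_mono)
  then show ?thesis by (simp add: Y_norm_def)
qed

text \<open>The constant \<open>1\<close> has trace \<open>1\<close>, which must be square integrable, so the surface measure is finite.\<close>

lemma trace_integrable: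
  assumes "v \<in> H1_space \<Omega>"
  shows "integrable SM (\<gamma> v)"
proof -
  have "AE x in SM. \<gamma> (\<lambda>x. 1) x = 1" by (rule trace_of_AE_const[OF H1_one]) simp
  moreover have "integrable SM (\<lambda>x. \<gamma> v x \<bullet> \<gamma> (\<lambda>x. 1) x)"
    by (rule L2_integrable_inner[OF trace_L2[OF assms] trace_L2[OF H1_one]])
  moreover have "\<gamma> v \<in> borel_measurable SM" using trace_L2[OF assms] by blast
  ultimately show ?thesis
    by (elim Bochner_Integration.integrable_cong_AE_imp) (auto elim!: eventually_mono)
qed

lemma trace_sum:
  assumes "finite I" "\<And>i. i \<in> I \<Longrightarrow> v i \<in> H1_space \<Omega>"
  shows "AE x in SM. \<gamma> (\<Sum>i\<in>I. c i *\<^sub>R v i) x = (\<Sum>i\<in>I. c i *\<^sub>R \<gamma> (v i)) x"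
  using assms
proof (induction I rule: finite_induct)
  case empty
  then show ?case using trace_zero by (simp add: zero_fun_def)
next
  case (insert i I)
  have "(\<Sum>i\<in>I. c i *\<^sub>R v i) \<in> H1_space \<Omega>"
    using insert.prems by (intro subspace_sum subspace_scale H1_subspace) auto
  then have comb: "AE x in SM. \<gamma> ((\<Sum>i\<in>I. c i *\<^sub>R v i) + c i *\<^sub>R v i) x = \<gamma> (\<Sum>i\<in>I. c i *\<^sub>R v i) x + c i * \<gamma> (v i) x"
    using insert.prems by (intro trace_comb) auto
  have IH: "AE x in SM. \<gamma> (\<Sum>i\<in>I. c i *\<^sub>R v i) x = (\<Sum>i\<in>I. c i *\<^sub>R \<gamma> (v i)) x"
    using insert.IH insert.prems by blast
  have split: "(\<Sum>i\<in>insert i I. c i *\<^sub>R v i) = (\<Sum>i\<in>I. c i *\<^sub>R v i) + c i *\<^sub>R v i"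
    "(\<Sum>i\<in>insert i I. c i *\<^sub>R \<gamma> (v i)) = (\<Sum>i\<in>I. c i *\<^sub>R \<gamma> (v i)) + c i *\<^sub>R \<gamma> (v i)"
    using insert.hyps by (simp_all add: add.commute)
  have apply_split: "((\<Sum>i\<in>I. c i *\<^sub>R \<gamma> (v i)) + c i *\<^sub>R \<gamma> (v i)) x
      = (\<Sum>i\<in>I. c i *\<^sub>R \<gamma> (v i)) x + c i * \<gamma> (v i) x" for x
    by (rule trans[OF plus_fun_apply]) (simp only: scaleR_fun_apply real_scaleR_def)
  show ?case
    unfolding split apply_split using comb IH by eventually_elim metis
qed

text \<open>Boundedness by the quotient norm makes \<open>g\<close> blind to null sets, which turns
  the almost everywhere linearity of \<open>\<gamma>\<close> into exact linearity of
  \<open>g (\<gamma> v)\<close>. The second part supplies the compatibility with null vectors that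
  \<open>Riesz\<close> asks for.\<close>

lemma functional_trace:
  assumes g: "g \<in> Hminushalf_mean0 \<Omega> \<gamma>"
  shows "u \<in> H1_space \<Omega> \<Longrightarrow> v \<in> H1_space \<Omega> \<Longrightarrow> g (\<gamma> (u + c *\<^sub>R v)) = g (\<gamma> u) + c * g (\<gamma> v)"
    and "v \<in> H1_space \<Omega> \<Longrightarrow> AE x in SM. \<gamma> v x = 0 \<Longrightarrow> g (\<gamma> v) = 0"
proof -
  have lin: "g (w1 + c *\<^sub>R w2) = g w1 + c * g w2" if "w1 \<in> Hh" "w2 \<in> Hh" for w1 w2 c
    using g that unfolding Hminushalf_mean0_def by blast
  obtain C where C: "\<And>w. w \<in> Hh \<Longrightarrow> \<bar>g w\<bar> \<le> C * nHh w"
    using g unfolding Hminushalf_mean0_def by blast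
  have null: "g w = 0" if "w \<in> Hh" "AE x in SM. w x = 0" for w
    using C[OF that(1)] Hhalf_null[OF that(2)] by simp
  show "v \<in> H1_space \<Omega> \<Longrightarrow> AE x in SM. \<gamma> v x = 0 \<Longrightarrow> g (\<gamma> v) = 0"
    by (rule null[OF trace_in_Hhalf])
  assume u: "u \<in> H1_space \<Omega>" and v: "v \<in> H1_space \<Omega>"
  note uv = trace_in_Hhalf[OF H1_comb[OF u v, of c]] and tu = trace_in_Hhalf[OF u] and tv = trace_in_Hhalf[OF v]
  let ?w = "\<gamma> u + c *\<^sub>R \<gamma> v"
  have w: "?w \<in> Hh" by (rule Hhalf_comb_in[OF tu tv])
  have "AE x in SM. (\<gamma> (u + c *\<^sub>R v) + (- 1) *\<^sub>R ?w) x = 0"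
    using trace_comb[OF u v, of c] by eventually_elim simp
  then have "g (\<gamma> (u + c *\<^sub>R v) + (- 1) *\<^sub>R ?w) = 0"
    by (rule null[OF Hhalf_comb_in[OF uv w]])
  then have "g (\<gamma> (u + c *\<^sub>R v)) = g ?w" using lin[OF uv w, of "- 1"] by simp
  then show "g (\<gamma> (u + c *\<^sub>R v)) = g (\<gamma> u) + c * g (\<gamma> v)" using lin[OF tu tv] by simp
qed

text \<open>The components are treated separately and their Euclidean combination is estimated by
  the sum. Indices outside \<open>{1..L}\<close> get the value 0 because \<open>T l\<close> is
  unconstrained there and might not be linear.\<close>

lemma Y_derivative:
  fixes f :: "'z::euclidean_space \<Rightarrow> nat \<Rightarrow> 'a \<Rightarrow> real"
  assumes T: "\<And>l. l \<in> {1..L} \<Longrightarrow> has_seminorm_derivative Hh nHh (\<lambda>w. f w l) (T l) z S"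
    and f: "\<And>w. w \<in> S \<Longrightarrow> f w \<in> Y_space \<Omega> \<gamma> L" and z: "z \<in> S"
  shows "has_seminorm_derivative (Y_space \<Omega> \<gamma> L) (Y_norm \<Omega> \<gamma> L) f
    (\<lambda>h l. if l \<in> {1..L} then T l h else 0) z S"
    (is "has_seminorm_derivative _ _ f ?T z S")
  unfolding has_seminorm_derivative_def
proof (intro conjI allI impI)
  have lin: "linear (T l)" and in_Hh: "T l h \<in> Hh" if "l \<in> {1..L}" for l h
    using T[OF that] by (auto simp: has_seminorm_derivative_def)
  show "linear ?T"
    by (rule linearI) (auto simp: fun_eq_iff linear_add[OF lin] linear_scale[OF lin])
  show TY: "range ?T \<subseteq> Y_space \<Omega> \<gamma> L"
    using in_Hh by (auto simp: Y_space_def)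
  have "\<forall>l\<in>{1..L}. \<exists>C. \<forall>h. nHh (T l h) \<le> C * norm h"
    using T unfolding has_seminorm_derivative_def by blast
  then obtain C where C: "\<And>l h. l \<in> {1..L} \<Longrightarrow> nHh (T l h) \<le> C l * norm h"
    by metis
  have "Y_norm \<Omega> \<gamma> L (?T h) \<le> (\<Sum>l=1..L. C l) * norm h" for h
  proof -
    have "Y_norm \<Omega> \<gamma> L (?T h) \<le> (\<Sum>l=1..L. nHh (?T h l))"
      by (rule Y_norm_le_sum) (use TY in auto)
    also have "\<dots> \<le> (\<Sum>l=1..L. C l * norm h)"
      by (intro sum_mono) (use C in auto)
    finally show ?thesis by (simp add: sum_distrib_right)
  qed
  then show "\<exists>C. \<forall>h. Y_norm \<Omega> \<gamma> L (?T h) \<le> C * norm h" by blast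
  fix e :: real assume "e > 0"
  define e' where "e' = e / (real L + 1)"
  have "e' > 0" using \<open>e > 0\<close> by (simp add: e'_def)
  then have "\<forall>l\<in>{1..L}. \<exists>d>0. \<forall>w\<in>S. norm (w - z) < d \<longrightarrow> nHh (f w l - f z l - T l (w - z)) \<le> e' * norm (w - z)"
    using T unfolding has_seminorm_derivative_def by blast
  then obtain d where d: "\<And>l. l \<in> {1..L} \<Longrightarrow> d l > 0"
    "\<And>l w. l \<in> {1..L} \<Longrightarrow> w \<in> S \<Longrightarrow> norm (w - z) < d l \<Longrightarrow> nHh (f w l - f z l - T l (w - z)) \<le> e' * norm (w - z)"
    by metis
  \<comment> \<open>The inserted 1 keeps the minimum defined for \<open>L = 0\<close>.\<close>
  define d0 where "d0 = Min (insert 1 (d ` {1..L}))"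
  have "d0 > 0" using d(1) by (auto simp: d0_def)
  have d0: "d0 \<le> d l" if "l \<in> {1..L}" for l unfolding d0_def using that by (intro Min_le) auto
  have "Y_norm \<Omega> \<gamma> L (f w - f z - ?T (w - z)) \<le> e * norm (w - z)" if w: "w \<in> S" "norm (w - z) < d0" for w
  proof -
    have "?T (w - z) \<in> Y_space \<Omega> \<gamma> L" using TY by blast
    then have "Y_norm \<Omega> \<gamma> L (f w - f z - ?T (w - z)) \<le> (\<Sum>l=1..L. nHh ((f w - f z - ?T (w - z)) l))"
      by (intro Y_norm_le_sum subspace_diff Y.subspace_S f w z)
    also have "\<dots> \<le> (\<Sum>l=1..L. e' * norm (w - z))"
    proof (rule sum_mono)
      fix l assume l: "l \<in> {1..L}"
      then show "nHh ((f w - f z - ?T (w - z)) l) \<le> e' * norm (w - z)"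
        using d(2)[OF l w(1)] d0[OF l] w(2) by simp
    qed
    also have "\<dots> = e * (real L / (real L + 1)) * norm (w - z)" by (simp add: e'_def)
    also have "\<dots> \<le> e * norm (w - z)"
      using \<open>e > 0\<close> by (intro mult_right_mono mult_left_le) auto
    finally show ?thesis .
  qed
  then show "\<exists>d>0. \<forall>w\<in>S. norm (w - z) < d \<longrightarrow> Y_norm \<Omega> \<gamma> L (f w - f z - ?T (w - z)) \<le> e * norm (w - z)"
    using \<open>d0 > 0\<close> by blast
qed

lemma Yh_subset_Y: "W \<subseteq> H1_space \<Omega> \<Longrightarrow> Yh_space \<Omega> \<gamma> W L \<subseteq> Y_space \<Omega> \<gamma> L"
  unfolding Yh_space_def Y_space_def Hhalf_space_def trace_space_def by blast

end

section \<open>Differentiability of the discrete Neumann-to-Dirichlet map\<close>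

text \<open>The generators must lie in \<open>S\<close> itself, so they are a maximal independent
  subset of \<open>S\<close>, which is finite because it lies in the span of a finite set.\<close>

lemma span_finite_if_subspace:
  assumes "subspace S" "S \<subseteq> span B" "finite B"
  obtains B' where "finite B'" "B' \<subseteq> S" "S = span B'"
proof -
  obtain B' where B': "B' \<subseteq> S" "independent B'" "S \<subseteq> span B'"
    using maximal_independent_subset by blast
  have "B' \<subseteq> span B" using B'(1) assms(2) by blast
  then have "finite B'" using independent_span_bound[OF assms(3) B'(2)] by blast
  moreover have "S = span B'" using B'(1,3) assms(1) by (simp add: span_minimal subset_antisym)
  ultimately show thesis using that B'(1) by blast
qed

locale galerkin_setting = trace_setting \<Omega> \<gamma> for \<Omega> :: "'a::euclidean_space set" and \<gamma> +
  fixes V :: "('a \<Rightarrow> real) set" and amin amax :: real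
  assumes V_H1: "V \<subseteq> H1_space \<Omega>" and V_fin: "\<exists>B. finite B \<and> V = span B" and amin: "0 < amin"
begin

abbreviation "V0 \<equiv> mean0_subspace \<Omega> \<gamma> V"
abbreviation "sol \<equiv> discrete_solution \<Omega> \<gamma> V"

lemma V0_H1: "v \<in> V0 \<Longrightarrow> v \<in> H1_space \<Omega>"
  using V_H1 by (auto simp: mean0_subspace_def)

text \<open>The boundary mean is linear because traces are integrable; otherwise the default value
  of the integral could destroy linearity.\<close>

lemma V0_subspace: "subspace V0"
proof -
  have V: "subspace V" using V_fin by auto
  have comb: "u + c *\<^sub>R v \<in> V0" if "u \<in> V0" "v \<in> V0" for u v c
  proof -
    note H = V0_H1[OF that(1)] V0_H1[OF that(2)]
    have "(\<integral>x. \<gamma> (u + c *\<^sub>R v) x \<partial>SM) = (\<integral>x. \<gamma> u x + c * \<gamma> v x \<partial>SM)"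
      using trace_comb[OF H, of c] trace_integrable[OF H1_comb[OF H, of c]] trace_integrable[OF H(1)] trace_integrable[OF H(2)]
      by (intro integral_cong_AE) auto
    also have "\<dots> = 0"
      using that trace_integrable[OF H(1)] trace_integrable[OF H(2)] by (simp add: mean0_subspace_def)
    finally show ?thesis
      using that V by (simp add: mean0_subspace_def subspace_add subspace_scale)
  qed
  have "(\<integral>x. \<gamma> 0 x \<partial>SM) = 0"
    by (rule integral_eq_zero_AE[OF trace_zero])
  then have 0: "0 \<in> V0" using V by (simp add: mean0_subspace_def subspace_0)
  have "u + v \<in> V0" if "u \<in> V0" "v \<in> V0" for u v using comb[OF that, of 1] by simp
  moreover have "c *\<^sub>R v \<in> V0" if "v \<in> V0" for v c using comb[OF 0 that, of c] by simp
  ultimately show ?thesis using 0 by (simp add: subspace_def)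
qed

lemma V0_basis:
  obtains B where "finite B" "B \<subseteq> H1_space \<Omega>" "V0 = span B"
proof -
  obtain B where B: "finite B" "V = span B" using V_fin by blast
  have "V0 \<subseteq> span B" using B(2) by (auto simp: mean0_subspace_def)
  then obtain B' where "finite B'" "B' \<subseteq> V0" "V0 = span B'"
    using span_finite_if_subspace[OF V0_subspace _ B(1)] by blast
  then show thesis using that V0_H1 by blast
qed

lemma V0_null:
  assumes "v \<in> V0" "grad_norm v = 0"
  shows "AE x in SM. \<gamma> v x = 0"
  using assms by (intro zero_gradient_imp_zero_trace V0_H1) (auto simp: mean0_subspace_def)

text \<open>By \<open>V0_null\<close> the trace seminorm vanishes wherever the gradient seminorm
  does, and finite dimension turns this into an inequality. It carries the gradient estimates below
  over to \<open>Hhalf_norm\<close>.\<close>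

lemma Poincare:
  obtains C where "C \<ge> 0" "\<And>v. v \<in> V0 \<Longrightarrow> nHh (\<gamma> v) \<le> C * grad_norm v"
proof -
  obtain B where B: "finite B" "B \<subseteq> H1_space \<Omega>" "V0 = span B" by (rule V0_basis)
  have "\<exists>C\<ge>0. \<forall>v\<in>span B. nHh (\<gamma> v) \<le> C * sqrt (form (\<lambda>x. 1) v v)"
  proof (rule semi_inner.seminorm_bound[OF semi_inner_grad B(1,2)])
    fix u v c assume "u \<in> span B" "v \<in> span B"
    then have H: "u \<in> H1_space \<Omega>" "v \<in> H1_space \<Omega>" using B(3) V0_H1 by auto
    have "nHh (\<gamma> (u + c *\<^sub>R v)) = nHh (\<gamma> u + c *\<^sub>R \<gamma> v)"
      using trace_comb[OF H, of c] by (intro Hhalf_cong) simp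
    also have "\<dots> \<le> nHh (\<gamma> u) + \<bar>c\<bar> * nHh (\<gamma> v)"
      by (intro Hhalf_comb trace_in_Hhalf H)
    finally show "nHh (\<gamma> (u + c *\<^sub>R v)) \<le> nHh (\<gamma> u) + \<bar>c\<bar> * nHh (\<gamma> v)" .
  next
    fix v assume "v \<in> span B"
    then have v: "v \<in> V0" using B(3) by simp
    show "0 \<le> nHh (\<gamma> v)" by (rule Hhalf_nonneg[OF trace_in_Hhalf[OF V0_H1[OF v]]])
    assume "form (\<lambda>x. 1) v v = 0"
    then show "nHh (\<gamma> v) = 0" by (intro Hhalf_null V0_null v) (simp add: form_one)
  qed
  then show thesis using that B(3) by (auto simp: form_one)
qed

lemma admissible_Linf: "a \<in> admissible \<Omega> amin amax \<Longrightarrow> a \<in> Linf_space LM"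
  by (simp add: admissible_def)

lemma admissible_semi_inner:
  assumes "a \<in> admissible \<Omega> amin amax"
  shows "semi_inner (H1_space \<Omega>) (form a)"
proof (rule semi_inner_form[OF admissible_Linf[OF assms]])
  fix u assume "u \<in> H1_space \<Omega>"
  from form_coercive[OF assms this] show "0 \<le> form a u u"
    using amin by (meson mult_nonneg_nonneg order_less_imp_le order_trans zero_le_power2)
qed

text \<open>By coercivity the null vectors of \<open>form a\<close> have zero gradient, so the
  solvability condition \<open>l0\<close> can be stated without the coefficient.\<close>

lemma variational_solution:
  assumes a: "a \<in> admissible \<Omega> amin amax"
    and l: "\<And>u v c. u \<in> V0 \<Longrightarrow> v \<in> V0 \<Longrightarrow> l (u + c *\<^sub>R v) = l u + c * l v"
    and l0: "\<And>v. v \<in> V0 \<Longrightarrow> grad_norm v = 0 \<Longrightarrow> l v = (0::real)"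
  shows "\<exists>u\<in>V0. \<forall>v\<in>V0. form a u v = l v"
proof -
  obtain B where B: "finite B" "B \<subseteq> H1_space \<Omega>" "V0 = span B" by (rule V0_basis)
  have "grad_norm v = 0" if "v \<in> V0" "form a v v = 0" for v
  proof -
    have "amin * (grad_norm v)\<^sup>2 \<le> 0" using form_coercive[OF a V0_H1[OF that(1)]] that(2) by simp
    then show ?thesis using amin by (simp add: mult_le_0_iff)
  qed
  then show ?thesis
    using semi_inner.Riesz[OF admissible_semi_inner[OF a] B(1,2), of l] l l0 unfolding B(3) by blast
qed

lemma sol:
  assumes a: "a \<in> admissible \<Omega> amin amax" and g: "g \<in> Hminushalf_mean0 \<Omega> \<gamma>"
  shows "sol a g \<in> V0" "\<And>v. v \<in> V0 \<Longrightarrow> form a (sol a g) v = g (\<gamma> v)"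
proof -
  have "\<exists>u\<in>V0. \<forall>v\<in>V0. form a u v = g (\<gamma> v)"
    by (rule variational_solution[OF a])
       (auto intro!: functional_trace[OF g] V0_H1 V0_null)
  then have "\<exists>u. is_discrete_solution \<Omega> \<gamma> V a g u"
    by (auto simp: is_discrete_solution_def form_def)
  then have "is_discrete_solution \<Omega> \<gamma> V a g (sol a g)"
    unfolding discrete_solution_def by (rule someI_ex)
  then show "sol a g \<in> V0" "\<And>v. v \<in> V0 \<Longrightarrow> form a (sol a g) v = g (\<gamma> v)"
    by (auto simp: is_discrete_solution_def form_def)
qed

lemma coercive_bound:
  assumes a: "a \<in> admissible \<Omega> amin amax" and r: "r \<in> V0"
    and b: "form a r r \<le> X * grad_norm r" "0 \<le> X"
  shows "grad_norm r \<le> X / amin"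
proof (cases "grad_norm r = 0")
  case True
  then show ?thesis using b(2) amin by simp
next
  case False
  then have "grad_norm r > 0" using grad_norm_nonneg[of r] by linarith
  have "(amin * grad_norm r) * grad_norm r \<le> X * grad_norm r"
    using form_coercive[OF a V0_H1[OF r]] b(1) by (simp add: power2_eq_square)
  then have "amin * grad_norm r \<le> X" using \<open>grad_norm r > 0\<close> by simp
  then show ?thesis using amin by (simp add: field_simps)
qed

lemma V0_diff: "u \<in> V0 \<Longrightarrow> v \<in> V0 \<Longrightarrow> u - v \<in> V0"
  by (rule subspace_diff[OF V0_subspace])

text \<open>Subtracting the two equations cancels the common data. The perturbed solution
  \<open>sol b g\<close> remains on the right, which calls for a bound uniform in
  \<open>b\<close>.\<close>

lemma sol_perturbation:
  assumes a: "a \<in> admissible \<Omega> amin amax" and b: "b \<in> admissible \<Omega> amin amax"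
    and g: "g \<in> Hminushalf_mean0 \<Omega> \<gamma>" and v: "v \<in> V0"
  shows "form a (sol b g - sol a g) v = - form (b - a) (sol b g) v"
proof -
  note H = V0_H1[OF sol(1)[OF a g]] V0_H1[OF sol(1)[OF b g]] V0_H1[OF v]
  note L = admissible_Linf[OF a] admissible_Linf[OF b]
  show ?thesis
    using form_diff[OF L(1) H(2,1,3)] form_coeff_diff[OF L(2,1) H(2,3)] sol(2)[OF a g v] sol(2)[OF b g v]
    by simp
qed

text \<open>Testing with \<open>sol b g\<close> and expressing the data through
  \<open>sol a g\<close> for a fixed coefficient \<open>a\<close> gives a bound that does not vary
  with \<open>b\<close>.\<close>

lemma sol_bound:
  assumes a: "a \<in> admissible \<Omega> amin amax" and b: "b \<in> admissible \<Omega> amin amax"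
    and g: "g \<in> Hminushalf_mean0 \<Omega> \<gamma>"
  shows "grad_norm (sol b g) \<le> Linf_norm LM a * grad_norm (sol a g) / amin"
proof (rule coercive_bound[OF b sol(1)[OF b g]])
  note V = sol(1)[OF a g] sol(1)[OF b g]
  have "form b (sol b g) (sol b g) = form a (sol a g) (sol b g)"
    using sol(2)[OF b g V(2)] sol(2)[OF a g V(2)] by simp
  also have "\<dots> \<le> Linf_norm LM a * grad_norm (sol a g) * grad_norm (sol b g)"
    using form_bound[OF admissible_Linf[OF a] V0_H1[OF V(1)] V0_H1[OF V(2)]] by simp
  finally show "form b (sol b g) (sol b g) \<le> Linf_norm LM a * grad_norm (sol a g) * grad_norm (sol b g)" .
  show "0 \<le> Linf_norm LM a * grad_norm (sol a g)"
    using Linf_bound(2)[OF admissible_Linf[OF a]] by simp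
qed

text \<open>The linearized equation is solved for each basis direction only, and the derivative is the linear
  extension of the traces: \<open>\<gamma>\<close> itself is linear only almost everywhere.\<close>

lemma discrete_NtD_differentiable:
  fixes \<Phi> :: "'z::euclidean_space \<Rightarrow> 'a \<Rightarrow> real"
  assumes \<Phi>: "\<And>w. w \<in> S \<Longrightarrow> \<Phi> w \<in> admissible \<Omega> amin amax"
    and D: "has_seminorm_derivative (Linf_space LM) (Linf_norm LM) \<Phi> D z S" and z: "z \<in> S"
    and g: "g \<in> Hminushalf_mean0 \<Omega> \<gamma>"
  shows "\<exists>T. has_seminorm_derivative Hh nHh (\<lambda>w. discrete_NtD \<Omega> \<gamma> V (\<Phi> w) g) T z S"
proof -
  define u where "u w = sol (\<Phi> w) g" for w
  note a = \<Phi>[OF z]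
  have uV: "u w \<in> V0" if "w \<in> S" for w using sol(1)[OF \<Phi>[OF that] g] by (simp add: u_def)
  note uH = V0_H1[OF uV]
  have linD: "linear D" and DL: "D h \<in> Linf_space LM" for h
    using D by (auto simp: has_seminorm_derivative_def)
  obtain C' where C': "\<And>h. Linf_norm LM (D h) \<le> C' * norm h"
    using D unfolding has_seminorm_derivative_def by blast
  define C where "C = \<bar>C'\<bar>"
  have "C' * norm h \<le> C * norm h" for h :: 'z
    unfolding C_def by (intro mult_right_mono) auto
  from order_trans[OF C' this] have C: "C \<ge> 0" "\<And>h. Linf_norm LM (D h) \<le> C * norm h"
    by (simp_all add: C_def)
  \<comment> \<open>The linearized equation in direction \<open>i\<close>, obtained by formally
    differentiating \<open>form (\<Phi> w) (u w) v = g (\<gamma> v)\<close> at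
    \<open>z\<close>.\<close>
  have "\<exists>q\<in>V0. \<forall>v\<in>V0. form (\<Phi> z) q v = - form (D i) (u z) v" for i
  proof (rule variational_solution[OF a])
    fix v1 v2 :: "'a \<Rightarrow> real" and c :: real assume v: "v1 \<in> V0" "v2 \<in> V0"
    show "- form (D i) (u z) (v1 + c *\<^sub>R v2) = - form (D i) (u z) v1 + c * - form (D i) (u z) v2"
      using form_comb[OF DL V0_H1[OF v(1)] V0_H1[OF v(2)] uH[OF z], of i c]
      by (simp add: form_sym[of _ "u z"])
  next
    fix v assume "v \<in> V0" "grad_norm v = 0"
    then show "- form (D i) (u z) v = 0"
      using form_bound[OF DL uH[OF z] V0_H1, of v i] by simp
  qed
  then obtain q where q: "\<And>i. q i \<in> V0" "\<And>i v. v \<in> V0 \<Longrightarrow> form (\<Phi> z) (q i) v = - form (D i) (u z) v"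
    by metis
  define Q where "Q h = (\<Sum>i\<in>Basis. (h \<bullet> i) *\<^sub>R q i)" for h
  define T where "T h = (\<Sum>i\<in>Basis. (h \<bullet> i) *\<^sub>R \<gamma> (q i))" for h
  have QV: "Q h \<in> V0" for h
    unfolding Q_def by (intro subspace_sum subspace_scale V0_subspace q)
  have formQ: "form (\<Phi> z) (Q h) v = - form (D h) (u z) v" if v: "v \<in> V0" for h v
  proof -
    have Dh: "D h = (\<Sum>i\<in>Basis. (h \<bullet> i) *\<^sub>R D i)"
      by (subst euclidean_representation[symmetric]) (simp only: linear_sum[OF linD] linear_scale[OF linD])
    have "form (\<Phi> z) (Q h) v = (\<Sum>i\<in>Basis. (h \<bullet> i) * form (\<Phi> z) (q i) v)"
      unfolding Q_def using q(1) V0_H1 v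
      by (intro semi_inner.sum_left[OF admissible_semi_inner[OF a]]) auto
    also have "\<dots> = - (\<Sum>i\<in>Basis. (h \<bullet> i) * form (D i) (u z) v)"
      by (simp add: q(2)[OF v] sum_negf)
    also have "(\<Sum>i\<in>Basis. (h \<bullet> i) * form (D i) (u z) v) = form (D h) (u z) v"
      unfolding Dh by (rule form_coeff_sum(2)[OF finite_Basis DL uH[OF z] V0_H1[OF v], symmetric])
    finally show ?thesis .
  qed
  obtain P where P: "P \<ge> 0" "\<And>v. v \<in> V0 \<Longrightarrow> nHh (\<gamma> v) \<le> P * grad_norm v"
    using Poincare by blast
  define A where "A = Linf_norm LM (\<Phi> z) * grad_norm (u z) / amin"
  have "A \<ge> 0" using Linf_bound(2)[OF admissible_Linf[OF a]] amin by (simp add: A_def)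
  have uA: "grad_norm (u w) \<le> A" if "w \<in> S" for w
    using sol_bound[OF a \<Phi>[OF that] g] by (simp add: A_def u_def)
  \<comment> \<open>Two energy estimates. First \<open>e = u w - u z\<close> is of order
    \<open>norm h\<close>; then \<open>r = e - Q h\<close> solves an equation driven by the
    remainder \<open>\<rho>\<close> of the coefficient and by the product of \<open>D h\<close> and
    \<open>e\<close>, which is quadratic in \<open>norm h\<close>.\<close>
  have remainder: "nHh (\<gamma> (u w) - \<gamma> (u z) - T (w - z)) \<le> P * (A / amin * (s + C * (s + C) / amin * norm (w - z)) * norm (w - z))"
    if w: "w \<in> S" and s: "0 \<le> s" "Linf_norm LM (\<Phi> w - \<Phi> z - D (w - z)) \<le> s * norm (w - z)" for w s
  proof -
    define h where "h = w - z"
    define \<rho> where "\<rho> = \<Phi> w - \<Phi> z - D h"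
    have \<rho>: "\<rho> \<in> Linf_space LM" "Linf_norm LM \<rho> \<le> s * norm h"
      using s(2) admissible_Linf[OF \<Phi>[OF w]] admissible_Linf[OF a] DL
      by (auto simp: \<rho>_def h_def intro!: Linf_diff)
    define e where "e = u w - u z"
    have eV: "e \<in> V0" using uV w z by (simp add: e_def V0_diff)
    define r where "r = e - Q h"
    have rV: "r \<in> V0" using eV QV by (simp add: r_def V0_diff)
    have split: "form (\<Phi> w - \<Phi> z) x v = form \<rho> x v + form (D h) x v"
      if "x \<in> H1_space \<Omega>" "v \<in> H1_space \<Omega>" for x v
      using form_coeff_diff[OF Linf_diff[OF admissible_Linf[OF \<Phi>[OF w]] admissible_Linf[OF a]] DL that, of h]
      by (simp add: \<rho>_def)
    have fe: "form (\<Phi> z) e v = - form \<rho> (u w) v - form (D h) (u w) v" if "v \<in> V0" for v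
      using sol_perturbation[OF a \<Phi>[OF w] g that] split[OF uH[OF w] V0_H1[OF that]]
      by (simp add: e_def u_def)
    have b\<rho>: "\<bar>form \<rho> (u w) v\<bar> \<le> s * norm h * A * grad_norm v" if "v \<in> V0" for v
    proof -
      have "\<bar>form \<rho> (u w) v\<bar> \<le> Linf_norm LM \<rho> * (grad_norm (u w) * grad_norm v)"
        by (rule form_bound[OF \<rho>(1) uH[OF w] V0_H1[OF that]])
      also have "\<dots> \<le> (s * norm h) * (A * grad_norm v)"
        using \<rho>(2) uA[OF w] s(1) \<open>A \<ge> 0\<close> by (intro mult_mono) auto
      finally show ?thesis by (simp add: mult_ac)
    qed
    have bD: "\<bar>form (D h) x v\<bar> \<le> C * norm h * X * grad_norm v"
      if "x \<in> V0" "v \<in> V0" "grad_norm x \<le> X" for x v X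
    proof -
      have "\<bar>form (D h) x v\<bar> \<le> Linf_norm LM (D h) * (grad_norm x * grad_norm v)"
        by (rule form_bound[OF DL V0_H1[OF that(1)] V0_H1[OF that(2)]])
      also have "\<dots> \<le> (C * norm h) * (X * grad_norm v)"
        using C that(3) order_trans[OF grad_norm_nonneg that(3)] by (intro mult_mono) auto
      finally show ?thesis by (simp add: mult_ac)
    qed
    define E where "E = (s * norm h * A + C * norm h * A) / amin"
    have ge: "grad_norm e \<le> E"
      unfolding E_def
    proof (rule coercive_bound[OF a eV])
      show "form (\<Phi> z) e e \<le> (s * norm h * A + C * norm h * A) * grad_norm e"
        using fe[OF eV] b\<rho>[OF eV] bD[OF uV[OF w] eV uA[OF w]] by (simp add: distrib_right)
    qed (use s(1) C(1) \<open>A \<ge> 0\<close> in auto)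
    then have "E \<ge> 0" using order_trans[OF grad_norm_nonneg] by blast
    have gr: "grad_norm r \<le> (s * norm h * A + C * norm h * E) / amin"
    proof (rule coercive_bound[OF a rV])
      \<comment> \<open>Subtracting \<open>formQ\<close> from \<open>fe\<close> leaves
        \<open>u w - u z = e\<close> in the term with \<open>D h\<close>; this yields its second
        factor of \<open>norm h\<close>.\<close>
      have "form (\<Phi> z) r r = - form \<rho> (u w) r - (form (D h) (u w) r - form (D h) (u z) r)"
        using form_diff[OF admissible_Linf[OF a] V0_H1[OF eV] V0_H1[OF QV] V0_H1[OF rV], of h]
          fe[OF rV] formQ[OF rV, of h] by (simp add: r_def)
      also have "form (D h) (u w) r - form (D h) (u z) r = form (D h) e r"
        using form_diff[OF DL uH[OF w] uH[OF z] V0_H1[OF rV]] by (simp add: e_def)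
      finally show "form (\<Phi> z) r r \<le> (s * norm h * A + C * norm h * E) * grad_norm r"
        using b\<rho>[OF rV] bD[OF eV rV ge] by (simp add: distrib_right)
    qed (use s(1) C(1) \<open>A \<ge> 0\<close> \<open>E \<ge> 0\<close> in auto)
    have "AE x in SM. (\<gamma> (u w) - \<gamma> (u z) - T h) x = \<gamma> r x"
    proof -
      have "AE x in SM. \<gamma> (u w + (- 1) *\<^sub>R u z) x = \<gamma> (u w) x + (- 1) * \<gamma> (u z) x"
        by (rule trace_comb[OF uH[OF w] uH[OF z]])
      moreover have "AE x in SM. \<gamma> (e + (- 1) *\<^sub>R Q h) x = \<gamma> e x + (- 1) * \<gamma> (Q h) x"
        by (rule trace_comb[OF V0_H1[OF eV] V0_H1[OF QV]])
      moreover have "AE x in SM. \<gamma> (Q h) x = T h x"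
        unfolding Q_def T_def by (rule trace_sum) (use q V0_H1 in auto)
      moreover have "u w + (- 1) *\<^sub>R u z = e" "e + (- 1) *\<^sub>R Q h = r"
        by (simp_all add: e_def r_def)
      ultimately have "AE x in SM. \<gamma> e x = \<gamma> (u w) x + (- 1) * \<gamma> (u z) x"
        "AE x in SM. \<gamma> r x = \<gamma> e x + (- 1) * \<gamma> (Q h) x" "AE x in SM. \<gamma> (Q h) x = T h x"
        by simp_all
      then show ?thesis by eventually_elim simp
    qed
    then have "nHh (\<gamma> (u w) - \<gamma> (u z) - T h) = nHh (\<gamma> r)" by (rule Hhalf_cong)
    also have "\<dots> \<le> P * grad_norm r" by (rule P(2)[OF rV])
    also have "\<dots> \<le> P * ((s * norm h * A + C * norm h * E) / amin)"
      by (rule mult_left_mono[OF gr P(1)])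
    also have "(s * norm h * A + C * norm h * E) / amin = A / amin * (s + C * (s + C) / amin * norm h) * norm h"
      using amin by (simp add: E_def field_simps)
    finally show ?thesis unfolding h_def .
  qed
  define K where "K = P * A / amin"
  have "K \<ge> 0" using P(1) \<open>A \<ge> 0\<close> amin by (simp add: K_def)
  have "has_seminorm_derivative Hh nHh (\<lambda>w. \<gamma> (u w)) T z S"
    unfolding has_seminorm_derivative_def
  proof (intro conjI allI impI)
    have tq: "\<gamma> (q i) \<in> Hh" for i by (rule trace_in_Hhalf[OF V0_H1[OF q(1)]])
    show "linear T"
      unfolding T_def
      by (rule linearI) (simp_all add: inner_add_left scaleR_add_left sum.distrib scaleR_sum_right)
    show "range T \<subseteq> Hh"
      unfolding T_def by (auto intro!: subspace_sum subspace_scale Hhalf.subspace_S tq)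
    have "nHh (T h) \<le> (\<Sum>i\<in>Basis. nHh (\<gamma> (q i))) * norm h" for h
    proof -
      have "nHh (T h) \<le> (\<Sum>i\<in>Basis. \<bar>h \<bullet> i\<bar> * nHh (\<gamma> (q i)))"
        unfolding T_def by (intro Hhalf.sum_le tq) auto
      also have "\<dots> \<le> (\<Sum>i\<in>Basis. norm h * nHh (\<gamma> (q i)))"
        by (intro sum_mono mult_right_mono Basis_le_norm Hhalf_nonneg tq)
      finally show ?thesis by (simp add: sum_distrib_left[symmetric] mult.commute)
    qed
    then show "\<exists>C. \<forall>h. nHh (T h) \<le> C * norm h" by blast
    fix \<epsilon> :: real assume "\<epsilon> > 0"
    \<comment> \<open>One \<open>\<eta>\<close> is for the remainder of \<open>\<Phi>\<close>, the
      other for the quadratic term, and \<open>K * (2 * \<eta>) \<le> \<epsilon>\<close> holds even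
      for \<open>K = 0\<close>.\<close>
    define \<eta> where "\<eta> = \<epsilon> / (2 * (K + 1))"
    have "\<eta> > 0" using \<open>\<epsilon> > 0\<close> \<open>K \<ge> 0\<close> by (simp add: \<eta>_def)
    \<comment> \<open>The cap at 1 bounds \<open>C * (s + C) / amin\<close> by the constant
      \<open>B\<close>, which is independent of \<open>s\<close>.\<close>
    define s where "s = min 1 \<eta>"
    have s: "0 < s" "s \<le> 1" "s \<le> \<eta>" using \<open>\<eta> > 0\<close> by (auto simp: s_def)
    obtain d where d: "d > 0" "\<And>w. w \<in> S \<Longrightarrow> norm (w - z) < d \<Longrightarrow>
        Linf_norm LM (\<Phi> w - \<Phi> z - D (w - z)) \<le> s * norm (w - z)"
      using D s(1) unfolding has_seminorm_derivative_def by blast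
    define B where "B = C * (1 + C) / amin"
    have "B \<ge> 0" using C(1) amin by (simp add: B_def)
    have "nHh (\<gamma> (u w) - \<gamma> (u z) - T (w - z)) \<le> \<epsilon> * norm (w - z)"
      if w: "w \<in> S" "norm (w - z) < min d (\<eta> / (B + 1))" for w
    proof -
      have "C * (s + C) / amin \<le> B"
        unfolding B_def using C(1) amin s(2) by (intro divide_right_mono mult_left_mono) auto
      then have "C * (s + C) / amin * norm (w - z) \<le> B * norm (w - z)"
        by (rule mult_right_mono) simp
      also have "\<dots> \<le> (B + 1) * norm (w - z)" by (simp add: mult_right_mono)
      also have "\<dots> \<le> \<eta>" using w(2) \<open>B \<ge> 0\<close> by (simp add: field_simps)
      finally have "s + C * (s + C) / amin * norm (w - z) \<le> 2 * \<eta>" using s(3) by simp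
      then have "K * (s + C * (s + C) / amin * norm (w - z)) \<le> K * (2 * \<eta>)"
        using \<open>K \<ge> 0\<close> by (rule mult_left_mono)
      also have "\<dots> \<le> \<epsilon>" using \<open>\<epsilon> > 0\<close> \<open>K \<ge> 0\<close> by (simp add: \<eta>_def field_simps)
      finally have "K * (s + C * (s + C) / amin * norm (w - z)) * norm (w - z) \<le> \<epsilon> * norm (w - z)"
        by (rule mult_right_mono) simp
      with remainder[OF w(1) less_imp_le[OF s(1)] d(2)[OF w(1)]] w(2) show ?thesis
        by (simp add: K_def mult.assoc)
    qed
    then show "\<exists>d>0. \<forall>w\<in>S. norm (w - z) < d \<longrightarrow>
        nHh (\<gamma> (u w) - \<gamma> (u z) - T (w - z)) \<le> \<epsilon> * norm (w - z)"
      using d(1) \<open>\<eta> > 0\<close> \<open>B \<ge> 0\<close> by (intro exI[of _ "min d (\<eta> / (B + 1))"]) auto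
  qed
  then show ?thesis by (auto simp: discrete_NtD_def u_def)
qed

lemma measurement_map_in_Y:
  assumes "\<Phi> z \<in> admissible \<Omega> amin amax" "\<forall>l\<in>{1..L}. gN l \<in> Hminushalf_mean0 \<Omega> \<gamma>"
  shows "measurement_map \<Omega> \<gamma> V gN \<Phi> z \<in> Y_space \<Omega> \<gamma> L"
  using assms by (auto simp: measurement_map_def Y_space_def discrete_NtD_def
      intro!: trace_in_Hhalf V0_H1 sol)

end

lemma (in galerkin_setting) measurement_map_differentiable:
  fixes \<Phi> :: "'z::euclidean_space \<Rightarrow> 'a \<Rightarrow> real"
  assumes \<Phi>: "\<And>w. w \<in> S \<Longrightarrow> \<Phi> w \<in> admissible \<Omega> amin amax"
    and D: "has_seminorm_derivative (Linf_space LM) (Linf_norm LM) \<Phi> D z S" and z: "z \<in> S"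
    and g: "\<forall>l\<in>{1..L}. gN l \<in> Hminushalf_mean0 \<Omega> \<gamma>"
  shows "\<exists>T. has_seminorm_derivative (Y_space \<Omega> \<gamma> L) (Y_norm \<Omega> \<gamma> L) (measurement_map \<Omega> \<gamma> V gN \<Phi>) T z S"
proof -
  have "\<forall>l\<in>{1..L}. \<exists>T. has_seminorm_derivative Hh nHh (\<lambda>w. measurement_map \<Omega> \<gamma> V gN \<Phi> w l) T z S"
    unfolding measurement_map_def
    by (intro ballI discrete_NtD_differentiable[OF _ D z]) (use \<Phi> g in auto)
  then obtain T where "\<And>l. l \<in> {1..L} \<Longrightarrow>
      has_seminorm_derivative Hh nHh (\<lambda>w. measurement_map \<Omega> \<gamma> V gN \<Phi> w l) (T l) z S"
    by metis
  from Y_derivative[OF this measurement_map_in_Y[OF \<Phi> g] z] show ?thesis by blast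
qed

section \<open>Stability and injectivity of the surrogate map\<close>

theorem theorem4p2:
  fixes \<Omega> :: "(real ^ 'd) set"
    and \<gamma> :: "(real ^ 'd \<Rightarrow> real) \<Rightarrow> real ^ 'd \<Rightarrow> real"
    and V :: "(real ^ 'd \<Rightarrow> real) set"
    and amin amax c :: real
    and L :: nat
    and gN :: "nat \<Rightarrow> (real ^ 'd \<Rightarrow> real) \<Rightarrow> real"
    and Z U :: "(real ^ 'm) set"
    and zd :: "real ^ 'm"
    and \<Phi> :: "real ^ 'm \<Rightarrow> real ^ 'd \<Rightarrow> real"
    and N_M :: "real ^ 'm \<Rightarrow> nat \<Rightarrow> real ^ 'd \<Rightarrow> real"
  assumes "CARD('d) \<in> {2, 3}"
    and "lipschitz_domain \<Omega>"
    and "is_trace_operator \<Omega> \<gamma>"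
    and "0 < amin" and "0 < amax"
    and "V \<subseteq> H1_space \<Omega>" and "\<exists>B. finite B \<and> V = span B"
    and "\<Phi> ` Z \<subseteq> admissible \<Omega> amin amax"
    and "C1_on_seminorm (Linf_space (lebesgue_on \<Omega>)) (Linf_norm (lebesgue_on \<Omega>)) Z \<Phi>"
    and "\<forall>l\<in>{1..L}. gN l \<in> Hminushalf_mean0 \<Omega> \<gamma>"
    and "zd \<in> interior Z"
    and "U \<subseteq> Z" and "convex U" and "zd \<in> interior U"
    and "0 < c"
    and "\<forall>z1\<in>U. \<forall>z2\<in>U. 
          norm (z1 - z2) \<le> c * Y_norm \<Omega> \<gamma> L (measurement_map \<Omega> \<gamma> V gN \<Phi> z1 - measurement_map \<Omega> \<gamma> V gN \<Phi> z2)"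
    and "C1_on_seminorm (Yh_space \<Omega> \<gamma> V L) (Y_norm \<Omega> \<gamma> L) U N_M"
    and "(SUP z\<in>U. seminorm_onorm (Y_norm \<Omega> \<gamma> L)
            (seminorm_derivative (Y_space \<Omega> \<gamma> L) (Y_norm \<Omega> \<gamma> L) U (measurement_map \<Omega> \<gamma> V gN \<Phi> - N_M) z))
          \<le> ennreal (1 / (2 * c))"
  shows "(\<forall>z1\<in>U. \<forall>z2\<in>U. norm (z1 - z2) \<le> 2 * c * Y_norm \<Omega> \<gamma> L (N_M z1 - N_M z2)) \<and>
         (\<forall>z1\<in>U. \<forall>z2\<in>U. Y_eq \<Omega> L (N_M z1) (N_M z2) \<longrightarrow> z1 = z2)"
proof -
  interpret galerkin_setting \<Omega> \<gamma> V amin amax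
    using assms(2-4,6,7) by unfold_locales (auto simp: lipschitz_domain_def)
  let ?Y = "Y_space \<Omega> \<gamma> L" and ?N = "Y_norm \<Omega> \<gamma> L" and ?F = "measurement_map \<Omega> \<gamma> V gN \<Phi>"
  have adm: "\<Phi> z \<in> admissible \<Omega> amin amax" if "z \<in> U" for z
    using that assms(8,12) by blast
  have FY: "?F z \<in> ?Y" if "z \<in> U" for z
    by (rule measurement_map_in_Y[where \<Phi> = \<Phi>, OF adm[OF that] assms(10)])
  have MY: "N_M z \<in> ?Y" if "z \<in> U" for z
    using C1_on_seminorm_in_space[OF assms(17) that] Yh_subset_Y[OF assms(6)] by blast
  have deriv: "has_seminorm_derivative ?Y ?N (?F - N_M) (seminorm_derivative ?Y ?N U (?F - N_M) z) z U"
    if z: "z \<in> U" for z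
  proof -
    obtain D where D: "has_seminorm_derivative (Linf_space LM) (Linf_norm LM) \<Phi> D z U"
      using C1_on_seminorm_imp_derivative[OF assms(9) z assms(12) order_refl] by blast
    obtain T where T: "has_seminorm_derivative ?Y ?N ?F T z U"
      using measurement_map_differentiable[OF adm D z assms(10)] by blast
    obtain E where E: "has_seminorm_derivative ?Y ?N N_M E z U"
      using C1_on_seminorm_imp_derivative[OF assms(17) z order_refl Yh_subset_Y[OF assms(6)]] by blast
    have "\<exists>D. has_seminorm_derivative ?Y ?N (?F - N_M) D z U"
      using Y.has_seminorm_derivative_diff[OF T E FY MY z] by blast
    then show ?thesis unfolding seminorm_derivative_def by (rule someI_ex)
  qed
  have bound: "seminorm_onorm ?N (seminorm_derivative ?Y ?N U (?F - N_M) z) \<le> ennreal (1 / (2 * c))"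
    if "z \<in> U" for z
    using that assms(18) by (meson SUP_upper order_trans)
  have stable: "norm (z1 - z2) \<le> 2 * c * ?N (N_M z1 - N_M z2)" if z: "z1 \<in> U" "z2 \<in> U" for z1 z2
  proof -
    have diffY: "(?F - N_M) z \<in> ?Y" if "z \<in> U" for z
      using FY[OF that] MY[OF that] by (simp add: subspace_diff Y.subspace_S)
    have mvi: "?N ((?F - N_M) z1 - (?F - N_M) z2) \<le> 1 / (2 * c) * norm (z1 - z2)"
      using assms(15) by (intro Y.mean_value_inequality[OF assms(13) diffY deriv bound _ z(2,1)]) auto
    have "?F z1 - ?F z2 = (N_M z1 - N_M z2) + ((?F - N_M) z1 - (?F - N_M) z2)"
      by simp
    then have "?N (?F z1 - ?F z2) \<le> ?N (N_M z1 - N_M z2) + ?N ((?F - N_M) z1 - (?F - N_M) z2)"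
      using z by (metis Y.add_le subspace_diff Y.subspace_S MY diffY)
    with mvi have "?N (?F z1 - ?F z2) \<le> ?N (N_M z1 - N_M z2) + 1 / (2 * c) * norm (z1 - z2)"
      by linarith
    then have "c * ?N (?F z1 - ?F z2) \<le> c * (?N (N_M z1 - N_M z2) + 1 / (2 * c) * norm (z1 - z2))"
      using assms(15) by (intro mult_left_mono) auto
    with assms(16) z have "norm (z1 - z2) \<le> c * (?N (N_M z1 - N_M z2) + 1 / (2 * c) * norm (z1 - z2))"
      by (meson order_trans)
    also have "\<dots> = c * ?N (N_M z1 - N_M z2) + norm (z1 - z2) / 2"
      using assms(15) by (simp add: field_simps)
    finally show ?thesis by simp
  qed
  \<comment> \<open>Tuples that agree almost everywhere have a difference of seminorm 0, so the
    stability estimate itself forces equality.\<close>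
  moreover have "z1 = z2" if "z1 \<in> U" "z2 \<in> U" "Y_eq \<Omega> L (N_M z1) (N_M z2)" for z1 z2
    using stable[OF that(1,2)] Y_norm_eq_0[OF that(3)] by simp
  ultimately show ?thesis by blast
qed

end
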